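(* Let $\mathfrak{g}$ be a complex finite-dimensional Lie algebra and let $\tilde{\mathfrak{g}}=\mathfrak{g}\otimes\mathbb{C}[t,t^{-1}]$ be its loop algebra. There exists a representation of the $N=2$ superconformal algebra in the semi-infinite cohomology $H^{\frac{\infty}{2}+*}(\tilde{\mathfrak{g}},S^{\frac{\infty}{2}+*}(\tilde{\mathfrak{g}}))$ with central charge $3\dim\mathfrak{g}$.
   Context: Semi-infinite spaces. Let $V=\bigoplus_{n\in\mathbb{Z}}V_n$ be a graded complex vector space with $\dim V_n<\infty$, $V'=\bigoplus_n V_n^*$ its restricted dual, $V_+=\bigoplus_{n>0}V_n$, $V_-=\bigoplus_{n\le 0}V_n$, $V_-'=\bigoplus_{n\le 0}V_n^*$. On $V\oplus V'$ let $(\cdot,\cdot)$ be the natural skew-symmetric form and $\{\cdot,\cdot\}$ the natural symmetric form ($V$ and $V'$ isotropic, $(x',x)=-(x,x')=x'(x)$, $\{x',x\}=x'(x)$ for $x\in V$, $x'\in V'$). Let $H(V)$ (resp. $C(V)$) be the quotient of the tensor algebra of $V\oplus V'$ by the relations $xy-yx=(x,y)$ (resp. $xy+yx=\{x,y\}$). Let $S^{\frac{\infty}{2}+*}(V)$ (resp. $\Lambda^{\frac{\infty}{2}+*}(V)$) be the $H(V)$-module (resp. $C(V)$-module) induced from the trivial one-dimensional representation of the subalgebra $S^*(V_+\oplus V_-')\subset H(V)$ (resp. $\Lambda^*(V_+\oplus V_-')\subset C(V)$), in which $V_+\oplus V_-'$ acts by $0$. The actions of $x\in V$, $x'\in V'$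 are denoted $\beta(x),\gamma(x')$ on $S^{\frac{\infty}{2}+*}(V)$ and $\tau(x),\varepsilon(x')$ on $\Lambda^{\frac{\infty}{2}+*}(V)$. Set $W^{\frac{\infty}{2}+*}(V)=S^{\frac{\infty}{2}+*}(V)\otimes\Lambda^{\frac{\infty}{2}+*}(V)$, a superspace with $\mathbb{Z}/2$-grading given by the parity of the $\Lambda$-factor. Normal ordering $:\ :$ of a product of these operators means moving the operators $\beta(x),\tau(x)$ with $x\in V_+$ and $\gamma(x'),\varepsilon(x')$ with $x'\in V_-'$ (those annihilating the vacuum) to the right, with the sign of the resulting permutation of the $\tau$'s and $\varepsilon$'s. Semi-infinite cohomology. Take $V=\tilde{\mathfrak{g}}$ with grading $\tilde{\mathfrak{g}}_n=\mathfrak{g}\otimes t^n$. Let $u,v$ run through a fixed basis of $\mathfrak{g}$, $u_i=u\otimes t^i$, and $\{u_i'\}$ be the dual basis of $\tilde{\mathfrak{g}}'$. The operator $$d=\tfrac12\sum_{u,v,i,j}:\tau([u_i,v_j])\varepsilon(v_j')\varepsilon(u_i'):+\sum_{u,v,i,j}:\beta([u_i,v_j])\gamma(v_j')\varepsilon(u_i'):$$ on $W^{\frac{\infty}{2}+*}(\tilde{\mathfrak{g}})$ satisfies $d^2=0$; $H^{\frac{\infty}{2}+*}(\tilde{\mathfrak{g}},S^{\frac{\infty}{2}+*}(\tilde{\mathfrak{g}}))$ denotes the cohomology $\ker d/\operatorname{im} d$ of $W^{\frac{\infty}{2}+*}(\tilde{\mathfrak{g}})$. The $N=2$ superconformal algebra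 is the complex Lie superalgebra spanned by even elements $\mathcal{L}_n,H_n$ ($n\in\mathbb{Z}$), odd elements $G^{\pm}_r$ ($r\in\mathbb{Z}+\frac12$) and an even central element $C$, with non-vanishing commutation relations $[\mathcal{L}_n,\mathcal{L}_m]=(n-m)\mathcal{L}_{n+m}+\frac{C}{12}(n^3-n)\delta_{n,-m}$, $[\mathcal{L}_n,H_m]=-mH_{n+m}$, $[\mathcal{L}_n,G^{\pm}_r]=(\frac n2-r)G^{\pm}_{n+r}$, $[G^+_r,G^-_s]=2\mathcal{L}_{r+s}+(r-s)H_{r+s}+\frac{C}{3}(r^2-\frac14)\delta_{r,-s}$, $[H_n,H_m]=\frac{C}{3}n\,\delta_{n,-m}$, $[H_n,G^{\pm}_r]=\pm G^{\pm}_{n+r}$. A representation has central charge $c$ if $C$ acts as multiplication by $c$. *)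

theory Defs
  imports Complex_Main "HOL-Library.Poly_Mapping" "HOL-Library.Product_Plus"
begin

section \<open>Complex vector spaces\<close>

class scaleC =
  fixes scaleC :: "complex \<Rightarrow> 'a \<Rightarrow> 'a" (infixr "*\<^sub>C" 75)

class complex_vector = ab_group_add + scaleC +
  assumes scaleC_add_right: "c *\<^sub>C (x + y) = c *\<^sub>C x + c *\<^sub>C y"
    and scaleC_add_left: "(a + b) *\<^sub>C x = a *\<^sub>C x + b *\<^sub>C x"
    and scaleC_scaleC: "a *\<^sub>C b *\<^sub>C x = (a * b) *\<^sub>C x"
    and scaleC_one: "1 *\<^sub>C x = x"

global_interpretation cvec: vector_space "scaleC :: complex \<Rightarrow> 'a \<Rightarrow> 'a::complex_vector"
  by unfold_locales
    (simp_all add: scaleC_add_right scaleC_add_left scaleC_scaleC scaleC_one)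

abbreviation clinear :: "('a::complex_vector \<Rightarrow> 'b::complex_vector) \<Rightarrow> bool" where
  "clinear \<equiv> Vector_Spaces.linear scaleC scaleC"

lemma clinear_iff:
  "clinear f \<longleftrightarrow> (\<forall>x y. f (x + y) = f x + f y) \<and> (\<forall>c x. f (c *\<^sub>C x) = c *\<^sub>C f x)"
proof
  assume "clinear f"
  then interpret Vector_Spaces.linear scaleC scaleC f .
  show "(\<forall>x y. f (x + y) = f x + f y) \<and> (\<forall>c x. f (c *\<^sub>C x) = c *\<^sub>C f x)"
    by (simp add: add scale)
next
  assume "(\<forall>x y. f (x + y) = f x + f y) \<and> (\<forall>c x. f (c *\<^sub>C x) = c *\<^sub>C f x)"
  then show "clinear f"
    by unfold_locales auto
qed

instantiation complex :: complex_vector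
begin

definition scaleC_complex :: "complex \<Rightarrow> complex \<Rightarrow> complex" where
  "scaleC_complex c x = c * x"

instance
  by standard (simp_all add: scaleC_complex_def algebra_simps)

end

instantiation prod :: (complex_vector, complex_vector) complex_vector
begin

definition scaleC_prod :: "complex \<Rightarrow> 'a \<times> 'b \<Rightarrow> 'a \<times> 'b" where
  "scaleC_prod c x = (c *\<^sub>C fst x, c *\<^sub>C snd x)"

instance
  by standard (simp_all add: scaleC_prod_def scaleC_add_right scaleC_add_left
      scaleC_scaleC scaleC_one)

end

instantiation poly_mapping :: (type, complex_vector) complex_vector
begin

lift_definition scaleC_poly_mapping :: "complex \<Rightarrow> ('a \<Rightarrow>\<^sub>0 'b) \<Rightarrow> ('a \<Rightarrow>\<^sub>0 'b)"
  is "\<lambda>c p k. c *\<^sub>C p k"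
  by (rule finite_subset[rotated]) auto

instance
  by standard (transfer, simp add: fun_eq_iff scaleC_add_right scaleC_add_left
      scaleC_scaleC scaleC_one)+

end

lemma lookup_scaleC: "Poly_Mapping.lookup (c *\<^sub>C p) k = c *\<^sub>C Poly_Mapping.lookup p k"
  by transfer simp

lemma scaleC_single: "c *\<^sub>C Poly_Mapping.single k x = Poly_Mapping.single k (c *\<^sub>C x)"
  by (rule poly_mapping_eqI) (simp add: lookup_scaleC lookup_single when_def)

lemma span_diff_swap: "p - q \<in> cvec.span S \<Longrightarrow> q - p \<in> cvec.span S"
  using cvec.span_neg by fastforce

lemma span_diff_equivp: "equivp (\<lambda>p q. p - q \<in> cvec.span S)"
proof (rule equivpI)
  show "reflp (\<lambda>p q. p - q \<in> cvec.span S)"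
    by (simp add: reflp_def cvec.span_zero)
  show "symp (\<lambda>p q. p - q \<in> cvec.span S)"
    by (auto simp: symp_def intro: span_diff_swap)
  show "transp (\<lambda>p q. p - q \<in> cvec.span S)"
  proof (rule transpI)
    fix x y z assume "x - y \<in> cvec.span S" "y - z \<in> cvec.span S"
    then have "(x - y) + (y - z) \<in> cvec.span S" by (rule cvec.span_add)
    then show "x - z \<in> cvec.span S" by simp
  qed
qed

lemma span_diff_add:
  assumes "a - b \<in> cvec.span S" "c - d \<in> cvec.span S"
  shows "(a + c) - (b + d) \<in> cvec.span S"
  using cvec.span_add[OF assms] by (simp add: algebra_simps)

lemma span_diff_minus:
  assumes "a - b \<in> cvec.span S" "c - d \<in> cvec.span S"
  shows "(a - c) - (b - d) \<in> cvec.span S"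
  using cvec.span_diff[OF assms] by (simp add: algebra_simps)

lemma span_diff_uminus:
  assumes "a - b \<in> cvec.span S"
  shows "- a - - b \<in> cvec.span S"
  using cvec.span_neg[OF assms] by simp

lemma span_diff_scale:
  assumes "a - b \<in> cvec.span S"
  shows "c *\<^sub>C a - c *\<^sub>C b \<in> cvec.span S"
  using cvec.span_scale[OF assms, of c] by (simp add: cvec.scale_right_diff_distrib)

lemmas span_diff_resp = span_diff_add span_diff_minus span_diff_uminus span_diff_scale

typedef (overloaded) 'a dual = "{f :: 'a::complex_vector \<Rightarrow> complex. clinear f}"
  morphisms dual_apply Abs_dual
  by (rule exI[of _ "\<lambda>_. 0"]) (simp add: clinear_iff)

setup_lifting type_definition_dual

instantiation dual :: (complex_vector) complex_vector
begin

lift_definition zero_dual :: "'a dual" is "\<lambda>_. 0"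
  by (simp add: clinear_iff)
lift_definition plus_dual :: "'a dual \<Rightarrow> 'a dual \<Rightarrow> 'a dual" is "\<lambda>f g x. f x + g x"
  by (simp add: clinear_iff algebra_simps scaleC_add_right)
lift_definition minus_dual :: "'a dual \<Rightarrow> 'a dual \<Rightarrow> 'a dual" is "\<lambda>f g x. f x - g x"
  by (simp add: clinear_iff algebra_simps cvec.scale_right_diff_distrib)
lift_definition uminus_dual :: "'a dual \<Rightarrow> 'a dual" is "\<lambda>f x. - f x"
  by (simp add: clinear_iff)
lift_definition scaleC_dual :: "complex \<Rightarrow> 'a dual \<Rightarrow> 'a dual" is "\<lambda>c f x. c *\<^sub>C f x"
  by (simp add: clinear_iff scaleC_add_right scaleC_scaleC mult.commute)

instance
  by standard (transfer, simp add: fun_eq_iff scaleC_add_right scaleC_add_left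
      scaleC_scaleC scaleC_one)+

end

definition lin_ext :: "('k \<Rightarrow> 'v::complex_vector) \<Rightarrow> ('k \<Rightarrow>\<^sub>0 complex) \<Rightarrow> 'v" where
  "lin_ext f p = (\<Sum>k\<in>Poly_Mapping.keys p. Poly_Mapping.lookup p k *\<^sub>C f k)"

lemma lin_ext_superset:
  assumes "finite A" "Poly_Mapping.keys p \<subseteq> A"
  shows "lin_ext f p = (\<Sum>k\<in>A. Poly_Mapping.lookup p k *\<^sub>C f k)"
  unfolding lin_ext_def using assms
  by (intro sum.mono_neutral_left) (auto simp: in_keys_iff)

lemma lin_ext_add: "lin_ext f (p + q) = lin_ext f p + lin_ext f q"
proof -
  let ?A = "Poly_Mapping.keys p \<union> Poly_Mapping.keys q"
  have "lin_ext f (p + q) = (\<Sum>k\<in>?A. Poly_Mapping.lookup (p + q) k *\<^sub>C f k)"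
    by (rule lin_ext_superset) (auto dest: subsetD[OF keys_add])
  then show ?thesis
    by (simp add: lin_ext_superset[of ?A] lookup_add scaleC_add_left sum.distrib)
qed

lemma lin_ext_scale: "lin_ext f (c *\<^sub>C p) = c *\<^sub>C lin_ext f p"
proof -
  have "lin_ext f (c *\<^sub>C p) = (\<Sum>k\<in>Poly_Mapping.keys p. Poly_Mapping.lookup (c *\<^sub>C p) k *\<^sub>C f k)"
    by (rule lin_ext_superset) (auto simp: in_keys_iff lookup_scaleC)
  then show ?thesis
    by (simp add: lin_ext_def cvec.scale_sum_right lookup_scaleC scaleC_complex_def scaleC_scaleC)
qed

lemma lin_ext_single: "lin_ext f (Poly_Mapping.single k c) = c *\<^sub>C f k"
  by (simp add: lin_ext_def)

lemma clinear_lin_ext: "clinear (lin_ext f)"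
  by (simp add: clinear_iff lin_ext_add lin_ext_scale)

section \<open>Tensor products of vector spaces\<close>

definition tensor_relations :: "('a::complex_vector \<times> 'b::complex_vector \<Rightarrow>\<^sub>0 complex) set" where
  "tensor_relations =
     {Poly_Mapping.single (a + a', b) 1 - Poly_Mapping.single (a, b) 1
        - Poly_Mapping.single (a', b) 1 | a a' b. True} \<union>
     {Poly_Mapping.single (a, b + b') 1 - Poly_Mapping.single (a, b) 1
        - Poly_Mapping.single (a, b') 1 | a b b'. True} \<union>
     {Poly_Mapping.single (c *\<^sub>C a, b) 1 - c *\<^sub>C Poly_Mapping.single (a, b) 1 | c a b. True} \<union>
     {Poly_Mapping.single (a, c *\<^sub>C b) 1 - c *\<^sub>C Poly_Mapping.single (a, b) 1 | c a b. True}"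

quotient_type (overloaded) ('a, 'b) tensor =
  "('a::complex_vector \<times> 'b::complex_vector) \<Rightarrow>\<^sub>0 complex" /
  "\<lambda>p q. p - q \<in> cvec.span tensor_relations"
  by (rule span_diff_equivp)

instantiation tensor :: (complex_vector, complex_vector) complex_vector
begin

lift_definition zero_tensor :: "('a, 'b) tensor" is 0 .
lift_definition plus_tensor :: "('a, 'b) tensor \<Rightarrow> ('a, 'b) tensor \<Rightarrow> ('a, 'b) tensor" is "(+)"
  by (rule span_diff_resp)
lift_definition minus_tensor :: "('a, 'b) tensor \<Rightarrow> ('a, 'b) tensor \<Rightarrow> ('a, 'b) tensor" is "(-)"
  by (rule span_diff_resp)
lift_definition uminus_tensor :: "('a, 'b) tensor \<Rightarrow> ('a, 'b) tensor" is uminus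
  by (rule span_diff_resp)
lift_definition scaleC_tensor :: "complex \<Rightarrow> ('a, 'b) tensor \<Rightarrow> ('a, 'b) tensor" is scaleC
  by (rule span_diff_resp)

instance
  by standard (transfer, simp add: cvec.span_zero scaleC_add_right scaleC_add_left
      scaleC_scaleC scaleC_one algebra_simps)+

end

lift_definition tens :: "'a::complex_vector \<Rightarrow> 'b::complex_vector \<Rightarrow> ('a, 'b) tensor" (infixr "\<otimes>" 70)
  is "\<lambda>a b. Poly_Mapping.single (a, b) 1" .

text \<open>The linear map on the tensor product induced by a bilinear map \<open>h\<close>; for bilinear \<open>h\<close> it
  does not depend on the representative chosen (lemma \<open>tensor_lift_abs\<close>).\<close>

definition tensor_lift ::
  "('a::complex_vector \<Rightarrow> 'b::complex_vector \<Rightarrow> 'c::complex_vector) \<Rightarrow> ('a, 'b) tensor \<Rightarrow> 'c" where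
  "tensor_lift h t = lin_ext (\<lambda>(a, b). h a b) (rep_tensor t)"

definition cbilinear ::
  "('a::complex_vector \<Rightarrow> 'b::complex_vector \<Rightarrow> 'c::complex_vector) \<Rightarrow> bool" where
  "cbilinear h \<longleftrightarrow> (\<forall>a. clinear (h a)) \<and> (\<forall>b. clinear (\<lambda>a. h a b))"

definition on_left ::
  "('a::complex_vector \<Rightarrow> 'a) \<Rightarrow> ('a, 'b::complex_vector) tensor \<Rightarrow> ('a, 'b) tensor" where
  "on_left f = tensor_lift (\<lambda>a b. f a \<otimes> b)"

definition on_right ::
  "('b::complex_vector \<Rightarrow> 'b) \<Rightarrow> ('a::complex_vector, 'b) tensor \<Rightarrow> ('a, 'b) tensor" where
  "on_right f = tensor_lift (\<lambda>a b. a \<otimes> f b)"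

section \<open>Free associative algebras and ideals\<close>

datatype 'x word = Word (letters: "'x list")

instantiation word :: (type) monoid_add
begin

definition zero_word :: "'x word" where "zero_word = Word []"
definition plus_word :: "'x word \<Rightarrow> 'x word \<Rightarrow> 'x word" where
  "plus_word v w = Word (letters v @ letters w)"

instance
  by standard (simp_all add: zero_word_def plus_word_def)

end

text \<open>Words form a monoid under concatenation, written additively so that
  \<^typ>\<open>'x word \<Rightarrow>\<^sub>0 complex\<close> with its convolution product is the free associative unital algebra.\<close>

type_synonym 'x free_algebra = "'x word \<Rightarrow>\<^sub>0 complex"

definition gen :: "'x \<Rightarrow> 'x free_algebra" where
  "gen x = Poly_Mapping.single (Word [x]) 1"

definition two_sided_ideal :: "'x free_algebra set \<Rightarrow> 'x free_algebra set" where
  "two_sided_ideal R = cvec.span {a * r * b | a r b. r \<in> R}"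

definition left_ideal :: "'x free_algebra set \<Rightarrow> 'x free_algebra set" where
  "left_ideal R = cvec.span {a * r | a r. r \<in> R}"

text \<open>The tensor algebra of \<open>E\<close> is the free algebra on the set \<open>E\<close> modulo these relations.\<close>

definition linearity_relations :: "'x::complex_vector free_algebra set" where
  "linearity_relations =
     {gen (x + y) - gen x - gen y | x y. True} \<union> {gen (c *\<^sub>C x) - c *\<^sub>C gen x | c x. True}"

section \<open>Semi-infinite spaces\<close>

text \<open>\<^typ>\<open>int \<Rightarrow>\<^sub>0 'g\<close> is \<open>\<gg> \<otimes> \<complex>[t, t\<inverse>]\<close>, where \<open>single n x\<close> is \<open>x \<otimes> t\<^sup>n\<close>. Its restricted dual is
  the direct sum of the duals of the homogeneous components.\<close>

type_synonym 'g loop = "int \<Rightarrow>\<^sub>0 'g"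
type_synonym 'g loop_dual = "int \<Rightarrow>\<^sub>0 'g dual"
type_synonym 'g double = "'g loop \<times> 'g loop_dual"

definition loop_pair :: "'g::complex_vector loop_dual \<Rightarrow> 'g loop \<Rightarrow> complex" where
  "loop_pair f x = (\<Sum>n\<in>Poly_Mapping.keys f. dual_apply (Poly_Mapping.lookup f n) (Poly_Mapping.lookup x n))"

definition skew_form :: "'g::complex_vector double \<Rightarrow> 'g double \<Rightarrow> complex" where
  "skew_form x y = loop_pair (snd x) (fst y) - loop_pair (snd y) (fst x)"

definition sym_form :: "'g::complex_vector double \<Rightarrow> 'g double \<Rightarrow> complex" where
  "sym_form x y = loop_pair (snd x) (fst y) + loop_pair (snd y) (fst x)"

definition V_plus :: "'g::complex_vector loop set" where
  "V_plus = {x. Poly_Mapping.keys x \<subseteq> {0<..}}"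

definition V_dual_minus :: "'g::complex_vector loop_dual set" where
  "V_dual_minus = {f. Poly_Mapping.keys f \<subseteq> {..0}}"

definition heisenberg_ideal :: "'g::complex_vector double free_algebra set" where
  "heisenberg_ideal = two_sided_ideal (linearity_relations \<union>
     {gen x * gen y - gen y * gen x - skew_form x y *\<^sub>C 1 | x y. True})"

definition clifford_ideal :: "'g::complex_vector double free_algebra set" where
  "clifford_ideal = two_sided_ideal (linearity_relations \<union>
     {gen x * gen y + gen y * gen x - sym_form x y *\<^sub>C 1 | x y. True})"

definition vacuum_ideal :: "'g::complex_vector double free_algebra set" where
  "vacuum_ideal = left_ideal (gen ` (V_plus \<times> V_dual_minus))"

text \<open>The module over \<open>A\<close> induced from the trivial representation of a subalgebra \<open>B\<close> is
  \<open>A \<otimes>\<^sub>B \<complex> = A / A B\<^sub>+\<close>, where \<open>B\<^sub>+\<close> is the augmentation ideal; here \<open>B\<^sub>+\<close> is generated by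
  \<open>V\<^sub>+ \<oplus> V\<^sub>-'\<close>, so \<open>A B\<^sub>+ = A (V\<^sub>+ \<oplus> V\<^sub>-')\<close>. As \<open>A\<close> is itself the free algebra modulo the ideal
  of relations, the induced module is the free algebra modulo the sum of that two-sided ideal and
  the left ideal generated by \<open>V\<^sub>+ \<oplus> V\<^sub>-'\<close>.\<close>

quotient_type (overloaded) 'g sym_fock = "'g::complex_vector double free_algebra" /
  "\<lambda>p q. p - q \<in> cvec.span (heisenberg_ideal \<union> vacuum_ideal)"
  by (rule span_diff_equivp)

quotient_type (overloaded) 'g ext_fock = "'g::complex_vector double free_algebra" /
  "\<lambda>p q. p - q \<in> cvec.span (clifford_ideal \<union> vacuum_ideal)"
  by (rule span_diff_equivp)

instantiation sym_fock :: (complex_vector) complex_vector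
begin

lift_definition zero_sym_fock :: "'a sym_fock" is 0 .
lift_definition plus_sym_fock :: "'a sym_fock \<Rightarrow> 'a sym_fock \<Rightarrow> 'a sym_fock" is "(+)"
  by (rule span_diff_resp)
lift_definition minus_sym_fock :: "'a sym_fock \<Rightarrow> 'a sym_fock \<Rightarrow> 'a sym_fock" is "(-)"
  by (rule span_diff_resp)
lift_definition uminus_sym_fock :: "'a sym_fock \<Rightarrow> 'a sym_fock" is uminus
  by (rule span_diff_resp)
lift_definition scaleC_sym_fock :: "complex \<Rightarrow> 'a sym_fock \<Rightarrow> 'a sym_fock" is scaleC
  by (rule span_diff_resp)

instance
  by standard (transfer, simp add: cvec.span_zero scaleC_add_right scaleC_add_left
      scaleC_scaleC scaleC_one algebra_simps)+

end

instantiation ext_fock :: (complex_vector) complex_vector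
begin

lift_definition zero_ext_fock :: "'a ext_fock" is 0 .
lift_definition plus_ext_fock :: "'a ext_fock \<Rightarrow> 'a ext_fock \<Rightarrow> 'a ext_fock" is "(+)"
  by (rule span_diff_resp)
lift_definition minus_ext_fock :: "'a ext_fock \<Rightarrow> 'a ext_fock \<Rightarrow> 'a ext_fock" is "(-)"
  by (rule span_diff_resp)
lift_definition uminus_ext_fock :: "'a ext_fock \<Rightarrow> 'a ext_fock" is uminus
  by (rule span_diff_resp)
lift_definition scaleC_ext_fock :: "complex \<Rightarrow> 'a ext_fock \<Rightarrow> 'a ext_fock" is scaleC
  by (rule span_diff_resp)

instance
  by standard (transfer, simp add: cvec.span_zero scaleC_add_right scaleC_add_left
      scaleC_scaleC scaleC_one algebra_simps)+

end


lemma free_induct [case_names zero single add]: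
  fixes p :: "'k \<Rightarrow>\<^sub>0 'c::comm_monoid_add"
  assumes "P 0" "\<And>k c. P (Poly_Mapping.single k c)" "\<And>p q. P p \<Longrightarrow> P q \<Longrightarrow> P (p + q)"
  shows "P p"
proof (induction p rule: Poly_Mapping.update_induct)
  case const
  show ?case by (rule assms(1))
next
  case (update f a b)
  have "Poly_Mapping.update a b f = Poly_Mapping.single a b + f"
    using update(1) by (intro poly_mapping_eqI)
      (auto simp: lookup_update lookup_add lookup_single when_def in_keys_iff)
  then show ?case using assms(2,3) update(3) by simp
qed

lemma scaleC_conv_mult: "c *\<^sub>C (a::'x free_algebra) = Poly_Mapping.single 0 c * a"
proof (induction a rule: free_induct)
  case (single k d)
  show ?case by (simp add: scaleC_single mult_single scaleC_complex_def)
qed (simp_all add: scaleC_add_right distrib_left)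

lemma scaleC_conv_mult_right: "c *\<^sub>C (a::'x free_algebra) = a * Poly_Mapping.single 0 c"
proof (induction a rule: free_induct)
  case (single k d)
  show ?case by (simp add: scaleC_single mult_single scaleC_complex_def mult.commute)
qed (simp_all add: scaleC_add_right distrib_right)

lemma free_mult_scaleC_right: "(a::'x free_algebra) * (c *\<^sub>C b) = c *\<^sub>C (a * b)"
  by (simp add: scaleC_conv_mult_right mult.assoc)

lemma free_mult_scaleC_left: "(c *\<^sub>C a) * (b::'x free_algebra) = c *\<^sub>C (a * b)"
  by (simp add: scaleC_conv_mult mult.assoc)

lemma span_mult_left:
  assumes "\<And>s. s \<in> S \<Longrightarrow> a * s \<in> cvec.span T" "p \<in> cvec.span S"
  shows "(a::'x free_algebra) * p \<in> cvec.span T"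
  using assms(2)
proof (induction rule: cvec.span_induct_alt)
  case base
  show ?case by (simp add: cvec.span_zero)
next
  case (step c x y)
  then show ?case
    by (simp add: distrib_left free_mult_scaleC_right assms(1) cvec.span_add cvec.span_scale)
qed

lemma two_sided_ideal_mult_left:
  assumes "p \<in> two_sided_ideal R" shows "a * p \<in> two_sided_ideal R"
  unfolding two_sided_ideal_def
proof (rule span_mult_left[OF _ assms[unfolded two_sided_ideal_def]])
  fix s assume "s \<in> {a * r * b |a r b. r \<in> R}"
  then obtain b r c where "s = b * r * c" "r \<in> R" by blast
  then have "a * s = (a * b) * r * c" by (simp add: mult.assoc)
  with \<open>r \<in> R\<close> show "a * s \<in> cvec.span {a * r * b |a r b. r \<in> R}"
    by (intro cvec.span_base) blast
qed

lemma left_ideal_mult_left: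
  assumes "p \<in> left_ideal R" shows "a * p \<in> left_ideal R"
  unfolding left_ideal_def
proof (rule span_mult_left[OF _ assms[unfolded left_ideal_def]])
  fix s assume "s \<in> {a * r |a r. r \<in> R}"
  then obtain b r where "s = b * r" "r \<in> R" by blast
  then have "a * s = (a * b) * r" by (simp add: mult.assoc)
  with \<open>r \<in> R\<close> show "a * s \<in> cvec.span {a * r |a r. r \<in> R}"
    by (intro cvec.span_base) blast
qed

lemma ideal_sum_mult_left:
  assumes "p \<in> cvec.span (two_sided_ideal R \<union> left_ideal L)"
  shows "a * p \<in> cvec.span (two_sided_ideal R \<union> left_ideal L)"
  using assms
  by (rule span_mult_left[rotated])
    (auto intro!: cvec.span_base two_sided_ideal_mult_left left_ideal_mult_left)

lemma ideal_sum_diff_mult_left: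
  assumes "p - q \<in> cvec.span (two_sided_ideal R \<union> left_ideal L)"
  shows "a * p - a * q \<in> cvec.span (two_sided_ideal R \<union> left_ideal L)"
  using ideal_sum_mult_left[OF assms, of a] by (simp add: right_diff_distrib)

lifting_forget poly_mapping.lifting
lifting_forget dual.lifting

lift_definition sym_act :: "'g::complex_vector double \<Rightarrow> 'g sym_fock \<Rightarrow> 'g sym_fock"
  is "\<lambda>x p. gen x * p"
  unfolding heisenberg_ideal_def vacuum_ideal_def by (rule ideal_sum_diff_mult_left)

lift_definition ext_act :: "'g::complex_vector double \<Rightarrow> 'g ext_fock \<Rightarrow> 'g ext_fock"
  is "\<lambda>x p. gen x * p"
  unfolding clifford_ideal_def vacuum_ideal_def by (rule ideal_sum_diff_mult_left)

text \<open>The Clifford relations are homogeneous modulo 2 in the word length, so parity of word length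
  grades the exterior Fock space by \<open>\<int>/2\<close>. Parities are booleans, \<^term>\<open>True\<close> meaning odd.\<close>

lift_definition ext_monomial :: "'g::complex_vector double list \<Rightarrow> 'g ext_fock"
  is "\<lambda>xs. Poly_Mapping.single (Word xs) 1" .

type_synonym 'g weil = "('g sym_fock, 'g ext_fock) tensor"

definition weil_part :: "bool \<Rightarrow> 'g::complex_vector weil set" where
  "weil_part p = cvec.span {s \<otimes> ext_monomial xs | s xs. odd (length xs) = p}"

section \<open>Normal ordering\<close>

datatype ('x, 'f) fock_operator = Beta 'x | Gamma 'f | Tau 'x | Eps 'f

type_synonym 'g fock_op = "('g loop, 'g loop_dual) fock_operator"

primrec op_apply :: "'g::complex_vector fock_op \<Rightarrow> 'g weil \<Rightarrow> 'g weil" where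
  "op_apply (Beta x) = on_left (sym_act (x, 0))"
| "op_apply (Gamma f) = on_left (sym_act (0, f))"
| "op_apply (Tau x) = on_right (ext_act (x, 0))"
| "op_apply (Eps f) = on_right (ext_act (0, f))"

primrec op_odd :: "'g::complex_vector fock_op \<Rightarrow> bool" where
  "op_odd (Beta x) = False"
| "op_odd (Gamma f) = False"
| "op_odd (Tau x) = True"
| "op_odd (Eps f) = True"

primrec op_annihilates :: "'g::complex_vector fock_op \<Rightarrow> bool" where
  "op_annihilates (Beta x) \<longleftrightarrow> x \<in> V_plus"
| "op_annihilates (Gamma f) \<longleftrightarrow> f \<in> V_dual_minus"
| "op_annihilates (Tau x) \<longleftrightarrow> x \<in> V_plus"
| "op_annihilates (Eps f) \<longleftrightarrow> f \<in> V_dual_minus"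

text \<open>Normal ordering is the stable permutation moving the annihilation operators to the right.
  Its sign counts the inversions between odd operators. This is used for products in which every
  factor is either an annihilation operator or given by an element of \<open>V\<^sub>- \<oplus> V\<^sub>+'\<close>.\<close>

definition normal_ordered :: "'g::complex_vector fock_op list \<Rightarrow> 'g weil \<Rightarrow> 'g weil" where
  "normal_ordered os w =
     (- 1) ^ card {(i, j). i < j \<and> j < length os \<and> op_odd (os ! i) \<and> op_odd (os ! j)
                     \<and> op_annihilates (os ! i) \<and> \<not> op_annihilates (os ! j)} *\<^sub>C
     foldr op_apply (filter (\<lambda>a. \<not> op_annihilates a) os @ filter op_annihilates os) w"

section \<open>Semi-infinite cohomology of loop algebras\<close>

text \<open>The basis is the arbitrary fixed one over which the sums defining the differential run.\<close>

class fd_complex_lie_algebra = complex_vector +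
  fixes lie_bracket :: "'a \<Rightarrow> 'a \<Rightarrow> 'a"
    and lie_basis :: "'a set"
  assumes lie_bracket_add_left: "lie_bracket (x + y) z = lie_bracket x z + lie_bracket y z"
    and lie_bracket_scale_left: "lie_bracket (c *\<^sub>C x) y = c *\<^sub>C lie_bracket x y"
    and lie_bracket_add_right: "lie_bracket x (y + z) = lie_bracket x y + lie_bracket x z"
    and lie_bracket_scale_right: "lie_bracket x (c *\<^sub>C y) = c *\<^sub>C lie_bracket x y"
    and lie_bracket_self: "lie_bracket x x = 0"
    and lie_jacobi:
      "lie_bracket x (lie_bracket y z) + lie_bracket y (lie_bracket z x)
         + lie_bracket z (lie_bracket x y) = 0"
    and finite_lie_basis: "finite lie_basis"
    and lie_basis_independent: "(\<Sum>b\<in>lie_basis. r b *\<^sub>C b) = 0 \<Longrightarrow> e \<in> lie_basis \<Longrightarrow> r e = 0"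
    and lie_basis_spans: "\<exists>r. x = (\<Sum>b\<in>lie_basis. r b *\<^sub>C b)"

lemma finite_dimensional_lie_basis:
  "finite_dimensional_vector_space scaleC (lie_basis :: 'g::fd_complex_lie_algebra set)"
proof
  show "finite (lie_basis :: 'g set)" by (rule finite_lie_basis)
  show "cvec.independent (lie_basis :: 'g set)"
    using lie_basis_independent by (auto simp: cvec.dependent_finite[OF finite_lie_basis])
  show "cvec.span lie_basis = (UNIV :: 'g set)"
    using lie_basis_spans by (auto simp: cvec.span_finite[OF finite_lie_basis])
qed

definition loop_bracket ::
  "'g::fd_complex_lie_algebra loop \<Rightarrow> 'g loop \<Rightarrow> 'g loop" where
  "loop_bracket x y = (\<Sum>i\<in>Poly_Mapping.keys x. \<Sum>j\<in>Poly_Mapping.keys y.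
     Poly_Mapping.single (i + j)
       (lie_bracket (Poly_Mapping.lookup x i) (Poly_Mapping.lookup y j)))"

definition at_degree :: "'a::zero \<Rightarrow> int \<Rightarrow> int \<Rightarrow>\<^sub>0 'a" where
  "at_degree u i = Poly_Mapping.single i u"

definition dual_basis :: "'g::fd_complex_lie_algebra \<Rightarrow> 'g dual" where
  "dual_basis u = Abs_dual (\<lambda>x. cvec.representation lie_basis x u)"

lemma dual_basis_apply:
  "dual_apply (dual_basis u) x = cvec.representation lie_basis x u"
proof -
  interpret fd: finite_dimensional_vector_space scaleC "lie_basis :: 'a set"
    by (rule finite_dimensional_lie_basis)
  have "clinear (\<lambda>x. cvec.representation lie_basis x u)"
    by (simp add: clinear_iff scaleC_complex_def cvec.representation_add
        cvec.representation_scale fd.independent_Basis fd.span_Basis)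
  then show ?thesis by (simp add: dual_basis_def Abs_dual_inverse)
qed

lemma dual_basis_on_basis:
  assumes "v \<in> lie_basis"
  shows "dual_apply (dual_basis u) v = (if u = v then 1 else 0)"
proof -
  interpret fd: finite_dimensional_vector_space scaleC "lie_basis :: 'a set"
    by (rule finite_dimensional_lie_basis)
  show ?thesis
    using assms by (simp add: dual_basis_apply cvec.representation_basis fd.independent_Basis)
qed

text \<open>On each vector only finitely many terms are nonzero (lemma \<open>finite_terms\<close>), so
  \<^const>\<open>Sum_any\<close> is an honest sum.\<close>

definition semi_inf_d :: "'g::fd_complex_lie_algebra weil \<Rightarrow> 'g weil" where
  "semi_inf_d w =
     (1/2) *\<^sub>C (\<Sum>u\<in>lie_basis. \<Sum>v\<in>lie_basis. \<Sum>(i, j).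
        normal_ordered [Tau (loop_bracket (at_degree u i) (at_degree v j)),
          Eps (at_degree (dual_basis v) j), Eps (at_degree (dual_basis u) i)] w)
     + (\<Sum>u\<in>lie_basis. \<Sum>v\<in>lie_basis. \<Sum>(i, j).
        normal_ordered [Beta (loop_bracket (at_degree u i) (at_degree v j)),
          Gamma (at_degree (dual_basis v) j), Eps (at_degree (dual_basis u) i)] w)"

subsection \<open>Well-definedness of the differential\<close>

lemma clinear_add: "clinear f \<Longrightarrow> f (x + y) = f x + f y"
  and clinear_scale: "clinear f \<Longrightarrow> f (c *\<^sub>C x) = c *\<^sub>C f x"
  by (simp_all add: clinear_iff)

lemma clinear_0: "clinear f \<Longrightarrow> f 0 = 0"
  using clinear_scale[of f 0 0] by simp

lemma clinear_diff: "clinear f \<Longrightarrow> f (x - y) = f x - f y"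
  using clinear_add[of f "x - y" y] by (simp add: algebra_simps)

lemma cbilinear_simps:
  assumes "cbilinear h"
  shows "h (a + a') b = h a b + h a' b" "h a (b + b') = h a b + h a b'"
    "h (c *\<^sub>C a) b = c *\<^sub>C h a b" "h a (c *\<^sub>C b) = c *\<^sub>C h a b"
  using assms by (auto simp: cbilinear_def clinear_iff)

lemma lin_ext_span_tensor_relations:
  assumes "cbilinear h" "p \<in> cvec.span tensor_relations"
  shows "lin_ext (\<lambda>(a, b). h a b) p = 0"
  using assms(2)
proof (induction rule: cvec.span_induct_alt)
  case base
  show ?case by (simp add: lin_ext_def)
next
  case (step c x y)
  have "lin_ext (\<lambda>(a, b). h a b) x = 0"
    using step(1) unfolding tensor_relations_def
    by (auto simp: lin_ext_single lin_ext_scale clinear_diff[OF clinear_lin_ext]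
        cbilinear_simps[OF assms(1)])
  with step show ?case by (simp add: lin_ext_add lin_ext_scale)
qed

lemma tensor_lift_abs:
  assumes "cbilinear h"
  shows "tensor_lift h (abs_tensor p) = lin_ext (\<lambda>(a, b). h a b) p"
proof -
  have "rep_tensor (abs_tensor p) - p \<in> cvec.span tensor_relations"
    using Quotient3_abs_rep[OF Quotient3_tensor, of "abs_tensor p"]
    by (simp only: tensor.abs_eq_iff)
  from lin_ext_span_tensor_relations[OF assms this]
  show ?thesis by (simp add: tensor_lift_def clinear_diff[OF clinear_lin_ext])
qed

lemma tensor_lift_tens: "cbilinear h \<Longrightarrow> tensor_lift h (a \<otimes> b) = h a b"
  by (simp add: tens.abs_eq tensor_lift_abs lin_ext_single)

lemma clinear_tensor_lift:
  assumes "cbilinear h" shows "clinear (tensor_lift h)"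
  unfolding clinear_iff
proof (intro conjI allI)
  fix x y :: "('a, 'b) tensor" and c
  obtain p q where "x = abs_tensor p" "y = abs_tensor q"
    using Quotient3_abs_rep[OF Quotient3_tensor, of x, symmetric]
      Quotient3_abs_rep[OF Quotient3_tensor, of y, symmetric] by blast
  then show "tensor_lift h (x + y) = tensor_lift h x + tensor_lift h y"
    "tensor_lift h (c *\<^sub>C x) = c *\<^sub>C tensor_lift h x"
    by (simp_all add: plus_tensor.abs_eq scaleC_tensor.abs_eq tensor_lift_abs[OF assms]
        lin_ext_add lin_ext_scale)
qed

lemma tens_add_left: "(a + a') \<otimes> b = a \<otimes> b + a' \<otimes> b"
  unfolding tens.abs_eq plus_tensor.abs_eq tensor.abs_eq_iff diff_diff_eq[symmetric]
  by (rule cvec.span_base) (unfold tensor_relations_def, blast)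

lemma tens_add_right: "a \<otimes> (b + b') = a \<otimes> b + a \<otimes> b'"
  unfolding tens.abs_eq plus_tensor.abs_eq tensor.abs_eq_iff diff_diff_eq[symmetric]
  by (rule cvec.span_base) (unfold tensor_relations_def, blast)

lemma tens_scale_left: "(c *\<^sub>C a) \<otimes> b = c *\<^sub>C (a \<otimes> b)"
  unfolding tens.abs_eq scaleC_tensor.abs_eq tensor.abs_eq_iff
  by (rule cvec.span_base) (unfold tensor_relations_def, blast)

lemma tens_scale_right: "a \<otimes> (c *\<^sub>C b) = c *\<^sub>C (a \<otimes> b)"
  unfolding tens.abs_eq scaleC_tensor.abs_eq tensor.abs_eq_iff
  by (rule cvec.span_base) (unfold tensor_relations_def, blast)

lemmas tens_simps = tens_add_left tens_add_right tens_scale_left tens_scale_right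

lemma tens_0_left: "0 \<otimes> b = 0"
  using tens_scale_left[of 0 0 b] by simp

lemma tens_0_right: "a \<otimes> 0 = 0"
  using tens_scale_right[of a 0 0] by simp

lemma tensor_induct [case_names tens add]:
  assumes "\<And>a b. P (a \<otimes> b)" "\<And>s t. P s \<Longrightarrow> P t \<Longrightarrow> P (s + t)"
  shows "P t"
proof -
  have "P (abs_tensor p)" for p
  proof (induction p rule: free_induct)
    case zero
    show ?case using assms(1)[of 0 0] by (simp add: tens_0_left zero_tensor_def)
  next
    case (single k c)
    obtain a b where k: "k = (a, b)" by (cases k)
    have "abs_tensor (Poly_Mapping.single k c) = c *\<^sub>C (a \<otimes> b)"
      by (simp add: k tens.abs_eq scaleC_tensor.abs_eq scaleC_single scaleC_complex_def)
    then show ?case using assms(1) by (simp flip: tens_scale_left)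
  next
    case (add p q)
    then show ?case using assms(2) by (simp flip: plus_tensor.abs_eq)
  qed
  from this[of "rep_tensor t"] show ?thesis
    by (simp only: Quotient3_abs_rep[OF Quotient3_tensor])
qed

lemma cbilinear_on_left: "clinear f \<Longrightarrow> cbilinear (\<lambda>a b. f a \<otimes> b)"
  by (simp add: cbilinear_def clinear_iff tens_simps)

lemma cbilinear_on_right: "clinear f \<Longrightarrow> cbilinear (\<lambda>a b. a \<otimes> f b)"
  by (simp add: cbilinear_def clinear_iff tens_simps)

lemma on_left_tens: "clinear f \<Longrightarrow> on_left f (a \<otimes> b) = f a \<otimes> b"
  by (simp add: on_left_def tensor_lift_tens cbilinear_on_left)

lemma on_right_tens: "clinear f \<Longrightarrow> on_right f (a \<otimes> b) = a \<otimes> f b"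
  by (simp add: on_right_def tensor_lift_tens cbilinear_on_right)

lemma clinear_on_left: "clinear f \<Longrightarrow> clinear (on_left f)"
  by (simp add: on_left_def clinear_tensor_lift cbilinear_on_left)

lemma clinear_on_right: "clinear f \<Longrightarrow> clinear (on_right f)"
  by (simp add: on_right_def clinear_tensor_lift cbilinear_on_right)

lemma clinear_sym_act: "clinear (sym_act x)"
  unfolding clinear_iff
  by (intro conjI allI; transfer)
    (simp_all add: distrib_left free_mult_scaleC_right cvec.span_zero)

lemma clinear_ext_act: "clinear (ext_act x)"
  unfolding clinear_iff
  by (intro conjI allI; transfer)
    (simp_all add: distrib_left free_mult_scaleC_right cvec.span_zero)

lemma sym_act_commutator:
  "sym_act x (sym_act y s) - sym_act y (sym_act x s) = skew_form x y *\<^sub>C s"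
proof transfer
  fix x y :: "'a double" and p :: "'a double free_algebra"
  let ?r = "gen x * gen y - gen y * gen x - skew_form x y *\<^sub>C 1"
  have "1 * ?r * p \<in> heisenberg_ideal"
    unfolding heisenberg_ideal_def two_sided_ideal_def by (rule cvec.span_base) blast
  also have "1 * ?r * p = gen x * (gen y * p) - gen y * (gen x * p) - skew_form x y *\<^sub>C p"
    by (simp add: left_diff_distrib free_mult_scaleC_left mult.assoc)
  finally show "gen x * (gen y * p) - gen y * (gen x * p) - skew_form x y *\<^sub>C p
      \<in> cvec.span (heisenberg_ideal \<union> vacuum_ideal)"
    by (intro cvec.span_base) blast
qed

lemma ext_act_anticommutator:
  "ext_act x (ext_act y s) + ext_act y (ext_act x s) = sym_form x y *\<^sub>C s"
proof transfer
  fix x y :: "'a double" and p :: "'a double free_algebra"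
  let ?r = "gen x * gen y + gen y * gen x - sym_form x y *\<^sub>C 1"
  have "1 * ?r * p \<in> clifford_ideal"
    unfolding clifford_ideal_def two_sided_ideal_def by (rule cvec.span_base) blast
  also have "1 * ?r * p = gen x * (gen y * p) + gen y * (gen x * p) - sym_form x y *\<^sub>C p"
    by (simp add: left_diff_distrib distrib_right free_mult_scaleC_left mult.assoc)
  finally show "gen x * (gen y * p) + gen y * (gen x * p) - sym_form x y *\<^sub>C p
      \<in> cvec.span (clifford_ideal \<union> vacuum_ideal)"
    by (intro cvec.span_base) blast
qed

lift_definition sym_vacuum :: "'g::complex_vector sym_fock" is 1 .
lift_definition ext_vacuum :: "'g::complex_vector ext_fock" is 1 .

lemma gen_mult_in_vacuum_ideal:
  assumes "x \<in> V_plus \<times> V_dual_minus" shows "gen x \<in> vacuum_ideal"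
proof -
  have "1 * gen x \<in> vacuum_ideal"
    using assms unfolding vacuum_ideal_def left_ideal_def
    by (intro cvec.span_base) blast
  then show ?thesis by simp
qed

lemma sym_act_vacuum: "x \<in> V_plus \<times> V_dual_minus \<Longrightarrow> sym_act x sym_vacuum = 0"
  by transfer (simp add: gen_mult_in_vacuum_ideal cvec.span_base)

lemma ext_act_vacuum: "x \<in> V_plus \<times> V_dual_minus \<Longrightarrow> ext_act x ext_vacuum = 0"
  by transfer (simp add: gen_mult_in_vacuum_ideal cvec.span_base)

lemma gen_mult_single:
  "gen y * Poly_Mapping.single (Word w) c = Poly_Mapping.single (Word (y # w)) c"
  by (simp add: gen_def mult_single plus_word_def)

lemma sym_induct [case_names vacuum act add]:
  assumes "\<And>c. P (c *\<^sub>C sym_vacuum)" "\<And>y s. P s \<Longrightarrow> P (sym_act y s)"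
    "\<And>s t. P s \<Longrightarrow> P t \<Longrightarrow> P (s + t)"
  shows "P s"
proof -
  have word: "P (abs_sym_fock (Poly_Mapping.single (Word w) c))" for w c
  proof (induction w)
    case Nil
    have "Poly_Mapping.single (Word []) c = c *\<^sub>C (1 :: 'a double free_algebra)"
      by (simp add: scaleC_single scaleC_complex_def flip: single_one zero_word_def)
    then show ?case using assms(1)[of c] by (simp add: sym_vacuum_def scaleC_sym_fock.abs_eq)
  next
    case (Cons y w)
    then show ?case using assms(2) by (simp flip: gen_mult_single sym_act.abs_eq)
  qed
  have "P (abs_sym_fock p)" for p
  proof (induction p rule: free_induct)
    case zero
    show ?case using assms(1)[of 0] by (simp add: zero_sym_fock_def)
  next
    case (single k c)
    then show ?case using word by (cases k) simp
  next
    case (add p q)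
    then show ?case using assms(3) by (simp flip: plus_sym_fock.abs_eq)
  qed
  from this[of "rep_sym_fock s"] show ?thesis
    by (simp only: Quotient3_abs_rep[OF Quotient3_sym_fock])
qed

lemma ext_induct [case_names vacuum act add]:
  assumes "\<And>c. P (c *\<^sub>C ext_vacuum)" "\<And>y s. P s \<Longrightarrow> P (ext_act y s)"
    "\<And>s t. P s \<Longrightarrow> P t \<Longrightarrow> P (s + t)"
  shows "P s"
proof -
  have word: "P (abs_ext_fock (Poly_Mapping.single (Word w) c))" for w c
  proof (induction w)
    case Nil
    have "Poly_Mapping.single (Word []) c = c *\<^sub>C (1 :: 'a double free_algebra)"
      by (simp add: scaleC_single scaleC_complex_def flip: single_one zero_word_def)
    then show ?case using assms(1)[of c] by (simp add: ext_vacuum_def scaleC_ext_fock.abs_eq)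
  next
    case (Cons y w)
    then show ?case using assms(2) by (simp flip: gen_mult_single ext_act.abs_eq)
  qed
  have "P (abs_ext_fock p)" for p
  proof (induction p rule: free_induct)
    case zero
    show ?case using assms(1)[of 0] by (simp add: zero_ext_fock_def)
  next
    case (single k c)
    then show ?case using word by (cases k) simp
  next
    case (add p q)
    then show ?case using assms(3) by (simp flip: plus_ext_fock.abs_eq)
  qed
  from this[of "rep_ext_fock s"] show ?thesis
    by (simp only: Quotient3_abs_rep[OF Quotient3_ext_fock])
qed

lemma dual_apply_0: "dual_apply f 0 = 0"
  using dual_apply[of f] clinear_0 by auto

lemma zero_dual_apply: "dual_apply 0 x = 0"
  by (simp add: zero_dual.rep_eq)

lemma loop_pair_eq_0:
  assumes "Poly_Mapping.keys f \<inter> Poly_Mapping.keys x = {}" shows "loop_pair f x = 0"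
  unfolding loop_pair_def
proof (rule sum.neutral, rule ballI)
  fix n assume "n \<in> Poly_Mapping.keys f"
  with assms have "n \<notin> Poly_Mapping.keys x" by blast
  then show "dual_apply (Poly_Mapping.lookup f n) (Poly_Mapping.lookup x n) = 0"
    by (simp add: in_keys_iff dual_apply_0)
qed

lemma loop_pair_0: "loop_pair 0 x = 0" "loop_pair f 0 = 0"
  by (simp_all add: loop_pair_eq_0)

definition degree_bound :: "int \<Rightarrow> 'g::complex_vector double \<Rightarrow> bool" where
  "degree_bound N y \<longleftrightarrow>
     (\<forall>k \<in> Poly_Mapping.keys (fst y) \<union> Poly_Mapping.keys (snd y). \<bar>k\<bar> \<le> N)"

lemma degree_bound_exists: "\<exists>N\<ge>0. degree_bound N y"
proof -
  let ?K = "insert 0 (abs ` (Poly_Mapping.keys (fst y) \<union> Poly_Mapping.keys (snd y)))"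
  have "finite ?K" by simp
  then show ?thesis
    by (intro exI[of _ "Max ?K"]) (auto simp: degree_bound_def intro!: Max_ge)
qed

lemma degree_bound_pair:
  assumes "degree_bound N y" "n > N"
  shows "loop_pair (snd y) (Poly_Mapping.single n x) = 0"
    "loop_pair (Poly_Mapping.single (- n) f) (fst y) = 0"
  using assms by (force simp: degree_bound_def split: if_splits intro!: loop_pair_eq_0)+

lemma high_degree_annihilates:
  fixes x :: "'g::complex_vector"
  assumes "n > 0"
  shows "(Poly_Mapping.single n x, 0) \<in> V_plus \<times> (V_dual_minus :: 'g loop_dual set)"
    "(0, Poly_Mapping.single (- n) f) \<in> (V_plus :: 'g loop set) \<times> V_dual_minus"
  using assms by (auto simp: V_plus_def V_dual_minus_def)

lemma sym_locally_finite:
  "\<exists>N\<ge>0. \<forall>n>N. \<forall>x f. sym_act (Poly_Mapping.single n x, 0) s = 0 \<and>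
     sym_act (0, Poly_Mapping.single (- n) f) s = 0"
proof (induction s rule: sym_induct)
  case (vacuum c)
  show ?case
    by (rule exI[of _ 0])
      (simp add: clinear_scale[OF clinear_sym_act] sym_act_vacuum[OF high_degree_annihilates(1)]
        sym_act_vacuum[OF high_degree_annihilates(2)])
next
  case (act y s)
  then obtain N where N: "N \<ge> 0" "\<And>n x f. n > N \<Longrightarrow> sym_act (Poly_Mapping.single n x, 0) s = 0 \<and>
     sym_act (0, Poly_Mapping.single (- n) f) s = 0" by blast
  obtain M where M: "M \<ge> 0" "degree_bound M y" using degree_bound_exists by blast
  show ?case
  proof (intro exI[of _ "N + M"] conjI allI impI)
    show "0 \<le> N + M" using N M by simp
    fix n x f assume n: "N + M < n"
    have swap: "sym_act z (sym_act y s) = 0" if "skew_form z y = 0" "sym_act z s = 0" for z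
      using sym_act_commutator[of z y s] that by (simp add: clinear_0[OF clinear_sym_act])
    show "sym_act (Poly_Mapping.single n x, 0) (sym_act y s) = 0"
      "sym_act (0, Poly_Mapping.single (- n) f) (sym_act y s) = 0"
      using n N M by (auto intro!: swap simp: skew_form_def loop_pair_0 degree_bound_pair[OF M(2)])
  qed
next
  case (add s t)
  then obtain N M where "N \<ge> 0" "M \<ge> 0"
    "\<And>n x f. n > N \<Longrightarrow> sym_act (Poly_Mapping.single n x, 0) s = 0 \<and>
       sym_act (0, Poly_Mapping.single (- n) f) s = 0"
    "\<And>n x f. n > M \<Longrightarrow> sym_act (Poly_Mapping.single n x, 0) t = 0 \<and>
       sym_act (0, Poly_Mapping.single (- n) f) t = 0" by blast
  then show ?case
    by (intro exI[of _ "N + M"]) (simp add: clinear_add[OF clinear_sym_act])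
qed

lemma ext_locally_finite:
  "\<exists>N\<ge>0. \<forall>n>N. \<forall>x f. ext_act (Poly_Mapping.single n x, 0) s = 0 \<and>
     ext_act (0, Poly_Mapping.single (- n) f) s = 0"
proof (induction s rule: ext_induct)
  case (vacuum c)
  show ?case
    by (rule exI[of _ 0])
      (simp add: clinear_scale[OF clinear_ext_act] ext_act_vacuum[OF high_degree_annihilates(1)]
        ext_act_vacuum[OF high_degree_annihilates(2)])
next
  case (act y s)
  then obtain N where N: "N \<ge> 0" "\<And>n x f. n > N \<Longrightarrow> ext_act (Poly_Mapping.single n x, 0) s = 0 \<and>
     ext_act (0, Poly_Mapping.single (- n) f) s = 0" by blast
  obtain M where M: "M \<ge> 0" "degree_bound M y" using degree_bound_exists by blast
  show ?case
  proof (intro exI[of _ "N + M"] conjI allI impI)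
    show "0 \<le> N + M" using N M by simp
    fix n x f assume n: "N + M < n"
    have swap: "ext_act z (ext_act y s) = 0" if "sym_form z y = 0" "ext_act z s = 0" for z
      using ext_act_anticommutator[of z y s] that by (simp add: clinear_0[OF clinear_ext_act])
    show "ext_act (Poly_Mapping.single n x, 0) (ext_act y s) = 0"
      "ext_act (0, Poly_Mapping.single (- n) f) (ext_act y s) = 0"
      using n N M by (auto intro!: swap simp: sym_form_def loop_pair_0 degree_bound_pair[OF M(2)])
  qed
next
  case (add s t)
  then obtain N M where "N \<ge> 0" "M \<ge> 0"
    "\<And>n x f. n > N \<Longrightarrow> ext_act (Poly_Mapping.single n x, 0) s = 0 \<and>
       ext_act (0, Poly_Mapping.single (- n) f) s = 0"
    "\<And>n x f. n > M \<Longrightarrow> ext_act (Poly_Mapping.single n x, 0) t = 0 \<and>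
       ext_act (0, Poly_Mapping.single (- n) f) t = 0" by blast
  then show ?case
    by (intro exI[of _ "N + M"]) (simp add: clinear_add[OF clinear_ext_act])
qed

lemma clinear_op_apply: "clinear (op_apply a)"
  by (cases a) (simp_all add: clinear_on_left clinear_on_right clinear_sym_act clinear_ext_act)

lemma op_locally_finite:
  "\<exists>N\<ge>0. \<forall>n>N. \<forall>x f. op_apply (Beta (Poly_Mapping.single n x)) w = 0 \<and>
     op_apply (Tau (Poly_Mapping.single n x)) w = 0 \<and>
     op_apply (Gamma (Poly_Mapping.single (- n) f)) w = 0 \<and>
     op_apply (Eps (Poly_Mapping.single (- n) f)) w = 0"
proof (induction w rule: tensor_induct)
  case (tens s t)
  obtain N where N: "N \<ge> 0" "\<forall>n>N. \<forall>x f. sym_act (Poly_Mapping.single n x, 0) s = 0 \<and>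
     sym_act (0, Poly_Mapping.single (- n) f) s = 0" using sym_locally_finite by blast
  obtain M where M: "M \<ge> 0" "\<forall>n>M. \<forall>x f. ext_act (Poly_Mapping.single n x, 0) t = 0 \<and>
     ext_act (0, Poly_Mapping.single (- n) f) t = 0" using ext_locally_finite by blast
  from N M show ?case
    by (intro exI[of _ "N + M"]) (simp add: on_left_tens on_right_tens clinear_sym_act
        clinear_ext_act tens_0_left tens_0_right)
next
  case (add s t)
  then obtain N M where "N \<ge> 0" "M \<ge> 0"
    "\<forall>n>N. \<forall>x f. op_apply (Beta (Poly_Mapping.single n x)) s = 0 \<and>
     op_apply (Tau (Poly_Mapping.single n x)) s = 0 \<and>
     op_apply (Gamma (Poly_Mapping.single (- n) f)) s = 0 \<and>
     op_apply (Eps (Poly_Mapping.single (- n) f)) s = 0"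
    "\<forall>n>M. \<forall>x f. op_apply (Beta (Poly_Mapping.single n x)) t = 0 \<and>
     op_apply (Tau (Poly_Mapping.single n x)) t = 0 \<and>
     op_apply (Gamma (Poly_Mapping.single (- n) f)) t = 0 \<and>
     op_apply (Eps (Poly_Mapping.single (- n) f)) t = 0" by blast
  then show ?case
    by (intro exI[of _ "N + M"]) (simp add: clinear_add[OF clinear_op_apply] del: op_apply.simps)
qed

lemma annihilators_pair_0:
  assumes "x \<in> V_plus" "f \<in> V_dual_minus" shows "loop_pair f x = 0"
  using assms by (intro loop_pair_eq_0) (force simp: V_plus_def V_dual_minus_def)

lemma zero_in_V: "0 \<in> V_plus" "0 \<in> V_dual_minus"
  by (simp_all add: V_plus_def V_dual_minus_def)

lemma sym_act_annihilators:
  assumes "x \<in> V_plus \<times> V_dual_minus" "y \<in> V_plus \<times> V_dual_minus"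
  shows "sym_act x (sym_act y s) = sym_act y (sym_act x s)"
  using sym_act_commutator[of x y s] assms
  by (auto simp: skew_form_def annihilators_pair_0)

lemma ext_act_annihilators:
  assumes "x \<in> V_plus \<times> V_dual_minus" "y \<in> V_plus \<times> V_dual_minus"
  shows "ext_act x (ext_act y s) = - ext_act y (ext_act x s)"
  using ext_act_anticommutator[of x y s] assms
  by (auto simp: sym_form_def annihilators_pair_0 eq_neg_iff_add_eq_0)

lemma on_left_commute:
  assumes "clinear f" "clinear g" "\<And>s. f (g s) = g (f s)"
  shows "on_left f (on_left g w) = on_left g (on_left f w)"
  by (induction w rule: tensor_induct)
    (simp_all add: assms on_left_tens clinear_add[OF clinear_on_left])

lemma on_right_anticommute:
  assumes "clinear f" "clinear g" "\<And>s. f (g s) = - g (f s)"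
  shows "on_right f (on_right g w) = - on_right g (on_right f w)"
proof (induction w rule: tensor_induct)
  case (tens a b)
  have "a \<otimes> - c = - (a \<otimes> c)" for c :: 'a
    using tens_scale_right[of a "- 1" c] by simp
  then show ?case by (simp add: assms on_right_tens)
qed (simp add: assms clinear_add[OF clinear_on_right])

lemma on_left_on_right_commute:
  assumes "clinear f" "clinear g"
  shows "on_left f (on_right g w) = on_right g (on_left f w)"
  by (induction w rule: tensor_induct)
    (simp_all add: assms on_left_tens on_right_tens clinear_add[OF clinear_on_right]
      clinear_add[OF clinear_on_left])

lemma op_annihilators_commute:
  assumes "op_annihilates a" "op_annihilates b"
  shows "op_apply a (op_apply b w) =
    (if op_odd a \<and> op_odd b then - 1 else 1) *\<^sub>C op_apply b (op_apply a w)"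
proof -
  note intros = on_left_commute on_right_anticommute clinear_sym_act clinear_ext_act
    sym_act_annihilators ext_act_annihilators
  show ?thesis
    using assms
    by (cases a; cases b)
      (auto intro!: intros simp: on_left_on_right_commute[OF clinear_sym_act clinear_ext_act]
        zero_in_V)
qed

lemma clinear_foldr_op: "clinear (foldr op_apply as)"
  by (induction as) (simp_all add: clinear_iff clinear_add[OF clinear_op_apply]
      clinear_scale[OF clinear_op_apply])

lemma foldr_annihilators_0:
  assumes "\<forall>b\<in>set as. op_annihilates b" "a \<in> set as" "op_apply a w = 0"
  shows "foldr op_apply as w = 0"
proof -
  have a: "op_annihilates a" using assms by blast
  have *: "op_apply a (foldr op_apply bs w) = 0" if "\<forall>b\<in>set bs. op_annihilates b" for bs
    using that
    by (induction bs)
      (simp_all add: assms(3) op_annihilators_commute[OF a] clinear_0[OF clinear_op_apply])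
  show ?thesis
    using assms(1,2)
    by (induction as) (auto simp: * clinear_0[OF clinear_op_apply])
qed

lemma clinear_normal_ordered: "clinear (normal_ordered os)"
  unfolding normal_ordered_def clinear_iff
  by (simp only: clinear_add[OF clinear_foldr_op] clinear_scale[OF clinear_foldr_op]
      scaleC_add_right scaleC_scaleC mult.commute) simp

lemma normal_ordered_0:
  assumes "a \<in> set os" "op_annihilates a" "op_apply a w = 0"
  shows "normal_ordered os w = 0"
proof -
  have "foldr op_apply (filter op_annihilates os) w = 0"
    by (rule foldr_annihilators_0[of _ a]) (use assms in auto)
  then show ?thesis
    by (simp add: normal_ordered_def clinear_0[OF clinear_foldr_op])
qed

lemma lie_bracket_0: "lie_bracket 0 x = 0" "lie_bracket x 0 = 0"
  using lie_bracket_scale_left[of 0 0 x] lie_bracket_scale_right[of x 0 0] by simp_all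

lemma loop_bracket_at_degree:
  "loop_bracket (at_degree u i) (at_degree v j) = at_degree (lie_bracket u v) (i + j)"
  by (simp add: loop_bracket_def at_degree_def lie_bracket_0)

lemma finite_terms:
  assumes "\<psi> = Tau \<and> \<chi> = Eps \<or> \<psi> = Beta \<and> \<chi> = Gamma"
  shows "finite {(i, j). normal_ordered [\<psi> (loop_bracket (at_degree u i) (at_degree v j)),
    \<chi> (at_degree g j), Eps (at_degree h i)] w \<noteq> 0}"
proof -
  obtain N where N: "N \<ge> 0" "\<And>n x f. n > N \<Longrightarrow> op_apply (Beta (Poly_Mapping.single n x)) w = 0 \<and>
     op_apply (Tau (Poly_Mapping.single n x)) w = 0 \<and>
     op_apply (Gamma (Poly_Mapping.single (- n) f)) w = 0 \<and>
     op_apply (Eps (Poly_Mapping.single (- n) f)) w = 0"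
    using op_locally_finite[of w] by blast
  have "normal_ordered [\<psi> (loop_bracket (at_degree u i) (at_degree v j)),
      \<chi> (at_degree g j), Eps (at_degree h i)] w = 0"
    if outside: "\<not> (- N \<le> i \<and> - N \<le> j \<and> i + j \<le> N)" for i j
  proof -
    consider "i < - N" | "j < - N" | "i + j > N" using outside by linarith
    then show ?thesis
    proof cases
      case 1
      then show ?thesis
        using N(1) N(2)[of "- i"]
        by (intro normal_ordered_0[of "Eps (at_degree h i)"])
          (auto simp: at_degree_def V_dual_minus_def simp del: op_apply.simps)
    next
      case 2
      then show ?thesis
        using N(1) N(2)[of "- j"] assms
        by (intro normal_ordered_0[of "\<chi> (at_degree g j)"])
          (auto simp: at_degree_def V_dual_minus_def simp del: op_apply.simps)
    next
      case 3
      then show ?thesis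
        unfolding loop_bracket_at_degree
        using N(1) N(2)[of "i + j"] assms
        by (intro normal_ordered_0[of "\<psi> (at_degree (lie_bracket u v) (i + j))"])
          (auto simp: at_degree_def V_plus_def simp del: op_apply.simps)
    qed
  qed
  then have "{(i, j). normal_ordered [\<psi> (loop_bracket (at_degree u i) (at_degree v j)),
      \<chi> (at_degree g j), Eps (at_degree h i)] w \<noteq> 0} \<subseteq> {- N..2 * N} \<times> {- N..2 * N}"
    by (force simp: not_le)
  then show ?thesis by (rule finite_subset) simp
qed

lemma clinear_Sum_any:
  assumes "\<And>p. clinear (t p)" "\<And>w. finite {p. t p w \<noteq> 0}"
  shows "clinear (\<lambda>w. Sum_any (\<lambda>p. t p w))"
  unfolding clinear_iff
proof (intro conjI allI)
  fix x y c
  show "Sum_any (\<lambda>p. t p (x + y)) = Sum_any (\<lambda>p. t p x) + Sum_any (\<lambda>p. t p y)"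
    by (simp add: clinear_add[OF assms(1)] Sum_any.distrib assms(2))
  have "Sum_any (\<lambda>p. t p (c *\<^sub>C x)) = (\<Sum>p\<in>{p. t p x \<noteq> 0}. t p (c *\<^sub>C x))"
    by (rule Sum_any.expand_superset) (auto simp: assms(2) clinear_scale[OF assms(1)])
  then show "Sum_any (\<lambda>p. t p (c *\<^sub>C x)) = c *\<^sub>C Sum_any (\<lambda>p. t p x)"
    by (simp add: Sum_any.expand_set clinear_scale[OF assms(1)] cvec.scale_sum_right)
qed

lemma clinear_sum: "(\<And>a. a \<in> A \<Longrightarrow> clinear (t a)) \<Longrightarrow> clinear (\<lambda>w. \<Sum>a\<in>A. t a w)"
  by (simp add: clinear_iff sum.distrib cvec.scale_sum_right)

lemma clinear_semi_inf_d: "clinear semi_inf_d"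
proof -
  have *: "clinear (\<lambda>w. \<Sum>u\<in>lie_basis. \<Sum>v\<in>lie_basis. \<Sum>(i, j).
      normal_ordered [\<psi> (loop_bracket (at_degree u i) (at_degree v j)),
        \<chi> (at_degree (dual_basis v) j), Eps (at_degree (dual_basis u) i)] w)"
    if "\<psi> = Tau \<and> \<chi> = Eps \<or> \<psi> = Beta \<and> \<chi> = Gamma"
    for \<psi> :: "'a loop \<Rightarrow> 'a fock_op" and \<chi>
    using finite_terms[OF that]
    by (intro clinear_sum clinear_Sum_any) (auto simp: clinear_normal_ordered split_def)
  show ?thesis
    using *[of Tau Eps] *[of Beta Gamma]
    by (simp add: clinear_iff semi_inf_d_def scaleC_add_right scaleC_scaleC mult.commute
        algebra_simps)
qed

subsection \<open>The cohomology superspace\<close>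

definition cohomologous :: "'g::fd_complex_lie_algebra weil \<Rightarrow> 'g weil \<Rightarrow> bool" where
  "cohomologous x y \<longleftrightarrow>
     semi_inf_d x = 0 \<and> semi_inf_d y = 0 \<and> x - y \<in> range semi_inf_d"

lemma subspace_range_d: "cvec.subspace (range semi_inf_d)"
  by (rule cvec.subspaceI)
    (auto intro: range_eqI clinear_0[OF clinear_semi_inf_d, symmetric]
      clinear_add[OF clinear_semi_inf_d, symmetric] clinear_scale[OF clinear_semi_inf_d, symmetric])

lemma range_d_simps:
  "0 \<in> range semi_inf_d"
  "x \<in> range semi_inf_d \<Longrightarrow> y \<in> range semi_inf_d \<Longrightarrow> x + y \<in> range semi_inf_d"
  "x \<in> range semi_inf_d \<Longrightarrow> c *\<^sub>C x \<in> range semi_inf_d"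
  using subspace_range_d cvec.subspace_0 cvec.subspace_add cvec.subspace_scale by blast+

lemma part_equivp_cohomologous: "part_equivp cohomologous"
proof (rule part_equivpI)
  show "\<exists>x. cohomologous x x"
    by (rule exI[of _ 0])
      (simp add: cohomologous_def clinear_0[OF clinear_semi_inf_d] range_d_simps)
  show "symp cohomologous"
  proof (rule sympI)
    fix x y assume "cohomologous x y"
    then show "cohomologous y x"
      using range_d_simps(3)[of "x - y" "- 1"] by (simp add: cohomologous_def)
  qed
  show "transp cohomologous"
  proof (rule transpI)
    fix x y z assume "cohomologous x y" "cohomologous y z"
    then show "cohomologous x z"
      using range_d_simps(2)[of "x - y" "y - z"] by (simp add: cohomologous_def)
  qed
qed

quotient_type (overloaded) 'g semi_inf_cohomology = "'g::fd_complex_lie_algebra weil" /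
  partial: cohomologous
  by (rule part_equivp_cohomologous)

lemma cohomologous_scale: "cohomologous x y \<Longrightarrow> cohomologous (c *\<^sub>C x) (c *\<^sub>C y)"
  using range_d_simps(3)[of "x - y" c]
  by (simp add: cohomologous_def clinear_scale[OF clinear_semi_inf_d]
      cvec.scale_right_diff_distrib)

lemma cohomologous_add:
  "cohomologous x y \<Longrightarrow> cohomologous x' y' \<Longrightarrow> cohomologous (x + x') (y + y')"
  using range_d_simps(2)[of "x - y" "x' - y'"]
  by (simp add: cohomologous_def clinear_add[OF clinear_semi_inf_d] algebra_simps)

lemma cohomologous_uminus: "cohomologous x y \<Longrightarrow> cohomologous (- x) (- y)"
  using cohomologous_scale[of x y "- 1"] by simp

lemma cohomologous_minus:
  "cohomologous x y \<Longrightarrow> cohomologous x' y' \<Longrightarrow> cohomologous (x - x') (y - y')"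
  using cohomologous_add[OF _ cohomologous_uminus, of x y x' y'] by simp

lemma cohomologous_0: "cohomologous 0 0"
  by (simp add: cohomologous_def clinear_0[OF clinear_semi_inf_d] range_d_simps)

instantiation semi_inf_cohomology :: (fd_complex_lie_algebra) complex_vector
begin

lift_definition zero_semi_inf_cohomology :: "'a semi_inf_cohomology" is 0
  by (rule cohomologous_0)
lift_definition plus_semi_inf_cohomology ::
  "'a semi_inf_cohomology \<Rightarrow> 'a semi_inf_cohomology \<Rightarrow> 'a semi_inf_cohomology" is "(+)"
  by (rule cohomologous_add)
lift_definition minus_semi_inf_cohomology ::
  "'a semi_inf_cohomology \<Rightarrow> 'a semi_inf_cohomology \<Rightarrow> 'a semi_inf_cohomology" is "(-)"
  by (rule cohomologous_minus)
lift_definition uminus_semi_inf_cohomology ::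
  "'a semi_inf_cohomology \<Rightarrow> 'a semi_inf_cohomology" is uminus
  by (rule cohomologous_uminus)
lift_definition scaleC_semi_inf_cohomology ::
  "complex \<Rightarrow> 'a semi_inf_cohomology \<Rightarrow> 'a semi_inf_cohomology" is scaleC
  by (rule cohomologous_scale)

instance
  by standard (transfer, auto simp: scaleC_add_right scaleC_add_left scaleC_scaleC scaleC_one
      algebra_simps cohomologous_def clinear_scale[OF clinear_semi_inf_d]
      clinear_add[OF clinear_semi_inf_d] clinear_diff[OF clinear_semi_inf_d]
      clinear_0[OF clinear_semi_inf_d] intro: range_d_simps)+

end

definition cohomology_part :: "bool \<Rightarrow> 'g::fd_complex_lie_algebra semi_inf_cohomology set" where
  "cohomology_part p = abs_semi_inf_cohomology ` {w \<in> weil_part p. semi_inf_d w = 0}"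

section \<open>The N = 2 superconformal algebra\<close>

text \<open>\<open>Gp_basis k\<close> and \<open>Gm_basis k\<close> stand for \<open>G\<^sup>+\<^sub>r\<close> and \<open>G\<^sup>-\<^sub>r\<close> with \<open>r = k + 1/2\<close>.\<close>

datatype n2_basis =
  L_basis int | H_basis int | Gp_basis int | Gm_basis int | C_basis

type_synonym n2_algebra = "n2_basis \<Rightarrow>\<^sub>0 complex"

abbreviation n2_term :: "n2_basis \<Rightarrow> complex \<Rightarrow> n2_algebra" where
  "n2_term b c \<equiv> Poly_Mapping.single b c"

definition half :: "int \<Rightarrow> complex" where "half k = of_int k + 1/2"

fun n2_basis_bracket :: "n2_basis \<Rightarrow> n2_basis \<Rightarrow> n2_algebra" where
  "n2_basis_bracket (L_basis n) (L_basis m) = n2_term (L_basis (n + m)) (of_int (n - m)) +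
     (if n = - m then n2_term C_basis (of_int (n ^ 3 - n) / 12) else 0)"
| "n2_basis_bracket (L_basis n) (H_basis m) = n2_term (H_basis (n + m)) (- of_int m)"
| "n2_basis_bracket (H_basis m) (L_basis n) = n2_term (H_basis (n + m)) (of_int m)"
| "n2_basis_bracket (L_basis n) (Gp_basis k) = n2_term (Gp_basis (n + k)) (of_int n / 2 - half k)"
| "n2_basis_bracket (Gp_basis k) (L_basis n) = n2_term (Gp_basis (n + k)) (half k - of_int n / 2)"
| "n2_basis_bracket (L_basis n) (Gm_basis k) = n2_term (Gm_basis (n + k)) (of_int n / 2 - half k)"
| "n2_basis_bracket (Gm_basis k) (L_basis n) = n2_term (Gm_basis (n + k)) (half k - of_int n / 2)"
| "n2_basis_bracket (Gp_basis k) (Gm_basis l) = n2_term (L_basis (k + l + 1)) 2 +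
     n2_term (H_basis (k + l + 1)) (half k - half l) +
     (if half k = - half l then n2_term C_basis (((half k)\<^sup>2 - 1/4) / 3) else 0)"
| "n2_basis_bracket (Gm_basis l) (Gp_basis k) = n2_term (L_basis (k + l + 1)) 2 +
     n2_term (H_basis (k + l + 1)) (half k - half l) +
     (if half k = - half l then n2_term C_basis (((half k)\<^sup>2 - 1/4) / 3) else 0)"
| "n2_basis_bracket (H_basis n) (H_basis m) =
     (if n = - m then n2_term C_basis (of_int n / 3) else 0)"
| "n2_basis_bracket (H_basis n) (Gp_basis k) = n2_term (Gp_basis (n + k)) 1"
| "n2_basis_bracket (Gp_basis k) (H_basis n) = n2_term (Gp_basis (n + k)) (- 1)"
| "n2_basis_bracket (H_basis n) (Gm_basis k) = n2_term (Gm_basis (n + k)) (- 1)"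
| "n2_basis_bracket (Gm_basis k) (H_basis n) = n2_term (Gm_basis (n + k)) 1"
| "n2_basis_bracket (Gp_basis k) (Gp_basis l) = 0"
| "n2_basis_bracket (Gm_basis k) (Gm_basis l) = 0"
| "n2_basis_bracket C_basis b = 0"
| "n2_basis_bracket b C_basis = 0"

definition n2_bracket :: "n2_algebra \<Rightarrow> n2_algebra \<Rightarrow> n2_algebra" where
  "n2_bracket x y = lin_ext (\<lambda>a. lin_ext (n2_basis_bracket a) y) x"

fun n2_basis_odd :: "n2_basis \<Rightarrow> bool" where
  "n2_basis_odd (Gp_basis k) = True"
| "n2_basis_odd (Gm_basis k) = True"
| "n2_basis_odd b = False"

definition n2_part :: "bool \<Rightarrow> n2_algebra set" where
  "n2_part p = {x. \<forall>b \<in> Poly_Mapping.keys x. n2_basis_odd b = p}"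

text \<open>A representation in a superspace whose homogeneous parts are \<open>part False\<close> (even) and
  \<open>part True\<close> (odd).\<close>

definition n2_representation ::
  "(bool \<Rightarrow> 'm::complex_vector set) \<Rightarrow> (n2_algebra \<Rightarrow> 'm \<Rightarrow> 'm) \<Rightarrow> bool" where
  "n2_representation part \<rho> \<longleftrightarrow>
     (\<forall>x. clinear (\<rho> x)) \<and>
     (\<forall>m. clinear (\<lambda>x. \<rho> x m)) \<and>
     (\<forall>p q. \<forall>x \<in> n2_part p. \<forall>m \<in> part q. \<rho> x m \<in> part (p \<noteq> q)) \<and>
     (\<forall>p q. \<forall>x \<in> n2_part p. \<forall>y \<in> n2_part q. \<forall>m.
        \<rho> (n2_bracket x y) m =
        \<rho> x (\<rho> y m) - (if p \<and> q then - 1 else 1) *\<^sub>C \<rho> y (\<rho> x m))"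

definition has_central_charge ::
  "(n2_algebra \<Rightarrow> 'm::complex_vector \<Rightarrow> 'm) \<Rightarrow> complex \<Rightarrow> bool" where
  "has_central_charge \<rho> c \<longleftrightarrow> (\<forall>m. \<rho> (n2_term C_basis 1) m = c *\<^sub>C m)"

end

theory Submission
  imports Defs "HOL-Library.Countable_Set"
begin

text \<open>The \<open>N = 2\<close> algebra acts on the Weil complex by quadratic operators, with supercharges
  \<open>\<Sum> \<gamma> \<tau>\<close> and \<open>\<Sum> \<beta> \<partial>\<epsilon>\<close>. An operator on the Fock space that supercommutes with all generators is a
  scalar, read off from its vacuum expectation value; so identities between quadratic and cubic
  operators reduce to their iterated commutators with generators, which are linear, and to finitely
  many vacuum expectation values, which give the central terms. In this way the supercharges
  supercommute with \<open>d\<close> up to an anomaly proportional to \<open>trace (ad x)\<close>.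

  If \<open>\<gg>\<close> is unimodular the anomaly vanishes and the action descends to cohomology. Otherwise it does
  not descend, but then the linear form \<open>trace \<circ> ad\<close> kills \<open>[\<gg>, \<gg>]\<close> and takes the value 1 at some
      \<open>e\<close>.
  The cycles \<open>\<beta>(e\<^sub>0)\<^sup>k vacuum\<close> and \<open>\<tau>(e\<^sub>0) \<beta>(e\<^sub>0)\<^sup>k vacuum\<close> are detected
      by cocycles built from this form,
  so the even and odd parts of the cohomology both have countably infinite dimension, as do those of
  the complex itself, and the action on the complex is transported along a parity-preserving linear
  isomorphism.\<close>

section \<open>Generators of the Fock space\<close>

text \<open>A quadratic operator acts on the generators by a matrix that does not depend on the
  ordering of its factors; ordering enters only through the scalar \<open>kappa\<close>. The
  expectation value is a linear functional with value 1 on the vacuum that kills every vector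
  beginning with a creation operator. It exists when the vacuum is nonzero, because the number
  operator separates the vacuum from all longer monomials; if the vacuum is 0, so is the whole Fock
  space, and that case is split off. The differential is a cubic expression whose normal ordering
  adds terms linear in the generators, so it is studied through double commutators with generators,
  where these terms vanish. In the test whether a supercharge supercommutes with d, the trace of ad
  x can arise only from a mode of \<open>G\<^sup>+\<close> against \<beta>(x): there the sum over
  the basis closes up into a trace. \<open>L\<close> and \<open>H\<close> inherit compatibility with
  d from the anticommutators of the supercharges.\<close>

definition sg :: "bool \<Rightarrow> bool \<Rightarrow> complex" where
  "sg p q = (if p \<and> q then - 1 else 1)"

lemma sg_commute: "sg p q = sg q p"
  by (auto simp: sg_def)

lemma sg_simps [simp]: "sg False q = 1" "sg p False = 1" "sg True True = - 1"
  by (auto simp: sg_def)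

lemma sg_square [simp]: "sg p q * sg p q = 1" "sg p q * (sg p q * c) = c"
  by (auto simp: sg_def)

lemma scaleC_simps [simp]:
  "(0::complex) *\<^sub>C (x::'a::complex_vector) = 0" "1 *\<^sub>C x = x" "c *\<^sub>C (0::'a) = 0"
  "(- c) *\<^sub>C x = - (c *\<^sub>C x)" "c *\<^sub>C (- x) = - (c *\<^sub>C x)"
  by simp_all

text \<open>The parity \<open>s\<close> selects \<beta> or \<tau> here, and \<gamma> or \<epsilon>
  in \<open>chi\<close>, so that one statement with the Koszul sign \<open>sg\<close> covers bosons
  and fermions. \<open>psi\<close> annihilates the vacuum in degrees n > 0, \<open>chi\<close> in
  degrees n \<le> 0.\<close>

definition psi :: "bool \<Rightarrow> 'g::complex_vector \<Rightarrow> int \<Rightarrow> 'g weil \<Rightarrow> 'g weil" where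
  "psi s x n = op_apply (if s then Tau (at_degree x n) else Beta (at_degree x n))"

definition chi :: "bool \<Rightarrow> 'g::complex_vector dual \<Rightarrow> int \<Rightarrow> 'g weil \<Rightarrow> 'g weil" where
  "chi s f n = op_apply (if s then Eps (at_degree f n) else Gamma (at_degree f n))"

definition vacuum :: "'g::complex_vector weil" where
  "vacuum = sym_vacuum \<otimes> ext_vacuum"

lemma clinear_psi: "clinear (psi s x n)" and clinear_chi: "clinear (chi s f n)"
  by (simp_all only: psi_def chi_def clinear_op_apply)

lemma clinear_uminus: "clinear f \<Longrightarrow> f (- x) = - f x"
  using clinear_scale[of f "- 1" x] by simp

lemma clinear_sum': "clinear f \<Longrightarrow> f (\<Sum>i\<in>A. g i) = (\<Sum>i\<in>A. f (g i))"
  by (induction A rule: infinite_finite_induct) (simp_all add: clinear_0 clinear_add)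

lemmas clinear_simps = clinear_add clinear_diff clinear_scale clinear_0 clinear_uminus clinear_sum'

lemmas psi_simps = clinear_simps[OF clinear_psi]
lemmas chi_simps = clinear_simps[OF clinear_chi]

lemma gen_add_mult:
  assumes "linearity_relations \<subseteq> R"
  shows "gen (x + y) * p - (gen x * p + gen y * p) \<in> two_sided_ideal R"
    "gen (c *\<^sub>C x) * p - c *\<^sub>C (gen x * p) \<in> two_sided_ideal R"
proof -
  have "1 * (gen (x + y) - gen x - gen y) * p \<in> two_sided_ideal R"
    unfolding two_sided_ideal_def
    by (rule cvec.span_base) (use assms in \<open>unfold linearity_relations_def, blast\<close>)
  then show "gen (x + y) * p - (gen x * p + gen y * p) \<in> two_sided_ideal R"
    by (simp add: algebra_simps)
  have "1 * (gen (c *\<^sub>C x) - c *\<^sub>C gen x) * p \<in> two_sided_ideal R"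
    unfolding two_sided_ideal_def
    by (rule cvec.span_base) (use assms in \<open>unfold linearity_relations_def, blast\<close>)
  then show "gen (c *\<^sub>C x) * p - c *\<^sub>C (gen x * p) \<in> two_sided_ideal R"
    by (simp add: left_diff_distrib free_mult_scaleC_left)
qed

lemma sym_act_add: "sym_act (x + y) s = sym_act x s + sym_act y s"
  and sym_act_scale: "sym_act (c *\<^sub>C x) s = c *\<^sub>C sym_act x s"
  by (transfer, rule cvec.span_base, unfold heisenberg_ideal_def,
      rule UnI1, rule gen_add_mult, simp)+

lemma ext_act_add: "ext_act (x + y) s = ext_act x s + ext_act y s"
  and ext_act_scale: "ext_act (c *\<^sub>C x) s = c *\<^sub>C ext_act x s"
  by (transfer, rule cvec.span_base, unfold clifford_ideal_def,
      rule UnI1, rule gen_add_mult, simp)+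

lemma on_left_add:
  assumes "clinear f" "clinear g" "clinear h" "\<And>s. h s = f s + g s"
  shows "on_left h w = on_left f w + on_left g w"
proof (induction w rule: tensor_induct)
  case (tens a b)
  show ?case by (simp only: on_left_tens assms(1-3) assms(4)[of a] tens_add_left)
qed (simp add: assms(1-3) clinear_add[OF clinear_on_left])

lemma on_right_add:
  assumes "clinear f" "clinear g" "clinear h" "\<And>s. h s = f s + g s"
  shows "on_right h w = on_right f w + on_right g w"
proof (induction w rule: tensor_induct)
  case (tens a b)
  show ?case by (simp only: on_right_tens assms(1-3) assms(4)[of b] tens_add_right)
qed (simp add: assms(1-3) clinear_add[OF clinear_on_right])

lemma on_left_scale:
  assumes "clinear f" "clinear h" "\<And>s. h s = c *\<^sub>C f s"
  shows "on_left h w = c *\<^sub>C on_left f w"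
proof (induction w rule: tensor_induct)
  case (tens a b)
  show ?case by (simp only: on_left_tens assms(1-2) assms(3)[of a] tens_scale_left)
qed (simp add: assms(1-2) clinear_add[OF clinear_on_left] scaleC_add_right)

lemma on_right_scale:
  assumes "clinear f" "clinear h" "\<And>s. h s = c *\<^sub>C f s"
  shows "on_right h w = c *\<^sub>C on_right f w"
proof (induction w rule: tensor_induct)
  case (tens a b)
  show ?case by (simp only: on_right_tens assms(1-2) assms(3)[of b] tens_scale_right)
qed (simp add: assms(1-2) clinear_add[OF clinear_on_right] scaleC_add_right)

lemma op_apply_add:
  "op_apply (Beta (x + y)) w = op_apply (Beta x) w + op_apply (Beta y) w"
  "op_apply (Tau (x + y)) w = op_apply (Tau x) w + op_apply (Tau y) w"
  "op_apply (Gamma (f + g)) w = op_apply (Gamma f) w + op_apply (Gamma g) w"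
  "op_apply (Eps (f + g)) w = op_apply (Eps f) w + op_apply (Eps g) w"
  unfolding op_apply.simps
  by (rule on_left_add on_right_add; simp add: clinear_sym_act clinear_ext_act
      flip: sym_act_add ext_act_add)+

lemma op_apply_scale:
  "op_apply (Beta (c *\<^sub>C x)) w = c *\<^sub>C op_apply (Beta x) w"
  "op_apply (Tau (c *\<^sub>C x)) w = c *\<^sub>C op_apply (Tau x) w"
  "op_apply (Gamma (c *\<^sub>C f)) w = c *\<^sub>C op_apply (Gamma f) w"
  "op_apply (Eps (c *\<^sub>C f)) w = c *\<^sub>C op_apply (Eps f) w"
  unfolding op_apply.simps
  by (rule on_left_scale on_right_scale; simp add: clinear_sym_act clinear_ext_act scaleC_prod_def
      flip: sym_act_scale ext_act_scale)+

lemma op_apply_0: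
  "op_apply (Beta 0) w = 0" "op_apply (Tau 0) w = 0" "op_apply (Gamma 0) w = 0"
  "op_apply (Eps 0) w = 0"
  using op_apply_scale[of 0 0 w] by simp_all

lemma at_degree_add: "at_degree (x + y) n = at_degree x n + at_degree y n"
  by (simp add: at_degree_def single_add)

lemma at_degree_scale: "at_degree (c *\<^sub>C x) n = c *\<^sub>C at_degree x n"
  by (simp add: at_degree_def scaleC_single)

lemma psi_clinear: "clinear (\<lambda>x. psi s x n w)"
  unfolding clinear_iff psi_def
  by (simp add: at_degree_add at_degree_scale op_apply_add op_apply_scale del: op_apply.simps)

lemma chi_clinear: "clinear (\<lambda>f. chi s f n w)"
  unfolding clinear_iff chi_def
  by (simp add: at_degree_add at_degree_scale op_apply_add op_apply_scale del: op_apply.simps)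

lemmas psi_arg_simps = clinear_simps[OF psi_clinear]
lemmas chi_arg_simps = clinear_simps[OF chi_clinear]

section \<open>Supercommutation relations of the generators\<close>

lemma on_left_commutator:
  assumes "clinear f" "clinear g" "\<And>s. f (g s) - g (f s) = c *\<^sub>C s"
  shows "on_left f (on_left g w) = on_left g (on_left f w) + c *\<^sub>C w"
proof (induction w rule: tensor_induct)
  case (tens a b)
  have "f (g a) = g (f a) + c *\<^sub>C a" using assms(3)[of a] by (simp add: algebra_simps)
  then show ?case by (simp add: on_left_tens assms(1,2) tens_add_left tens_scale_left)
qed (simp add: clinear_add[OF clinear_on_left] assms(1,2) scaleC_add_right)

lemma on_right_anticommutator:
  assumes "clinear f" "clinear g" "\<And>s. f (g s) + g (f s) = c *\<^sub>C s"
  shows "on_right f (on_right g w) = - on_right g (on_right f w) + c *\<^sub>C w"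
proof (induction w rule: tensor_induct)
  case (tens a b)
  have "f (g b) = (- 1) *\<^sub>C g (f b) + c *\<^sub>C b"
    using assms(3)[of b] by (simp add: algebra_simps)
  then show ?case
    unfolding on_right_tens[OF assms(1)] on_right_tens[OF assms(2)]
    by (simp only: tens_add_right tens_scale_right) simp
qed (simp add: clinear_add[OF clinear_on_right] assms(1,2) scaleC_add_right)

lemma loop_pair_at_degree:
  "loop_pair (at_degree f i) (at_degree x j) = (if i = j then dual_apply f x else 0)"
proof (cases "f = 0")
  case True
  then show ?thesis by (simp add: at_degree_def loop_pair_0 zero_dual_apply)
next
  case False
  then show ?thesis
    by (simp add: at_degree_def loop_pair_def lookup_single when_def dual_apply_0)
qed

lemmas on_left_sym_act = on_left_commutator[OF clinear_sym_act clinear_sym_act sym_act_commutator]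
lemmas on_right_ext_act = on_right_anticommutator[OF clinear_ext_act clinear_ext_act
    ext_act_anticommutator]

lemma chi_psi:
  "chi s f i (psi t x j w) = sg s t *\<^sub>C psi t x j (chi s f i w)
     + (if s = t \<and> i = j then dual_apply f x else 0) *\<^sub>C w"
proof (cases s; cases t)
  assume "s" "t"
  then show ?thesis
    using on_right_ext_act[of "(0, at_degree f i)" "(at_degree x j, 0)" w]
    by (simp add: psi_def chi_def sym_form_def loop_pair_0 loop_pair_at_degree)
next
  assume "\<not> s" "\<not> t"
  then show ?thesis
    using on_left_sym_act[of "(0, at_degree f i)" "(at_degree x j, 0)" w]
    by (simp add: psi_def chi_def skew_form_def loop_pair_0 loop_pair_at_degree)
qed (simp_all add: psi_def chi_def on_left_on_right_commute clinear_sym_act clinear_ext_act)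

lemma psi_psi: "psi s x i (psi t y j w) = sg s t *\<^sub>C psi t y j (psi s x i w)"
proof (cases s; cases t)
  assume "s" "t"
  then show ?thesis
    using on_right_ext_act[of "(at_degree x i, 0)" "(at_degree y j, 0)" w]
    by (simp add: psi_def sym_form_def loop_pair_0)
next
  assume "\<not> s" "\<not> t"
  then show ?thesis
    using on_left_sym_act[of "(at_degree x i, 0)" "(at_degree y j, 0)" w]
    by (simp add: psi_def skew_form_def loop_pair_0)
qed (simp_all add: psi_def on_left_on_right_commute clinear_sym_act clinear_ext_act)

lemma chi_chi: "chi s f i (chi t g j w) = sg s t *\<^sub>C chi t g j (chi s f i w)"
proof (cases s; cases t)
  assume "s" "t"
  then show ?thesis
    using on_right_ext_act[of "(0, at_degree f i)" "(0, at_degree g j)" w]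
    by (simp add: chi_def sym_form_def loop_pair_0)
next
  assume "\<not> s" "\<not> t"
  then show ?thesis
    using on_left_sym_act[of "(0, at_degree f i)" "(0, at_degree g j)" w]
    by (simp add: chi_def skew_form_def loop_pair_0)
qed (simp_all add: chi_def on_left_on_right_commute clinear_sym_act clinear_ext_act)

text \<open>This is \<open>chi_psi\<close> read backwards. The factor \<open>- sg s s\<close>
  records that the contraction is skew for bosons and symmetric for fermions.\<close>

lemma psi_chi:
  "psi s x i (chi t f j w) = sg s t *\<^sub>C chi t f j (psi s x i w)
     - (if s = t \<and> i = j then sg s s * dual_apply f x else 0) *\<^sub>C w"
  unfolding chi_psi by (auto simp: sg_commute[of t s] scaleC_add_right scaleC_scaleC)

lemma psi_vacuum: "n > 0 \<Longrightarrow> psi s x n vacuum = 0"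
  by (simp add: psi_def vacuum_def at_degree_def on_left_tens on_right_tens clinear_sym_act
      clinear_ext_act sym_act_vacuum[OF high_degree_annihilates(1)]
      ext_act_vacuum[OF high_degree_annihilates(1)] tens_0_left tens_0_right)

lemma chi_vacuum: "n \<le> 0 \<Longrightarrow> chi s f n vacuum = 0"
proof -
  assume "n \<le> 0"
  then have "(0, at_degree f n) \<in> V_plus \<times> V_dual_minus"
    by (auto simp: V_plus_def V_dual_minus_def at_degree_def)
  note vac = sym_act_vacuum[OF this] ext_act_vacuum[OF this]
  show ?thesis
    by (simp add: chi_def vacuum_def on_left_tens on_right_tens clinear_sym_act
      clinear_ext_act vac tens_0_left tens_0_right)
qed

section \<open>Generation of the Fock space from the vacuum\<close>

text \<open>A loop element is a finite sum of homogeneous ones, so closure under \<open>psi\<close>,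
  \<open>chi\<close> and sums gives closure under all generators.\<close>

lemma op_apply_closed:
  assumes "\<And>s x n w. P w \<Longrightarrow> P (psi s x n w)" "\<And>s f n w. P w \<Longrightarrow> P (chi s f n w)"
    "\<And>v w. P v \<Longrightarrow> P w \<Longrightarrow> P (v + w)" "P 0" "P w"
  shows "P (op_apply a w)"
proof (cases a)
  case (Beta x)
  have "P (op_apply (Beta x) w)"
  proof (induction x rule: free_induct)
    case (single k c)
    show ?case using assms(1)[OF assms(5), of False c k] by (simp add: psi_def at_degree_def)
  qed (simp_all only: op_apply_add op_apply_0 assms(3,4))
  with Beta show ?thesis by simp
next
  case (Tau x)
  have "P (op_apply (Tau x) w)"
  proof (induction x rule: free_induct)
    case (single k c)
    show ?case using assms(1)[OF assms(5), of True c k] by (simp add: psi_def at_degree_def)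
  qed (simp_all only: op_apply_add op_apply_0 assms(3,4))
  with Tau show ?thesis by simp
next
  case (Gamma x)
  have "P (op_apply (Gamma x) w)"
  proof (induction x rule: free_induct)
    case (single k c)
    show ?case using assms(2)[OF assms(5), of False c k] by (simp add: chi_def at_degree_def)
  qed (simp_all only: op_apply_add op_apply_0 assms(3,4))
  with Gamma show ?thesis by simp
next
  case (Eps x)
  have "P (op_apply (Eps x) w)"
  proof (induction x rule: free_induct)
    case (single k c)
    show ?case using assms(2)[OF assms(5), of True c k] by (simp add: chi_def at_degree_def)
  qed (simp_all only: op_apply_add op_apply_0 assms(3,4))
  with Eps show ?thesis by simp
qed

lemma weil_induct [case_names vacuum psi chi add]:
  assumes "\<And>c. P (c *\<^sub>C vacuum)" "\<And>s x n w. P w \<Longrightarrow> P (psi s x n w)"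
    "\<And>s f n w. P w \<Longrightarrow> P (chi s f n w)" "\<And>v w. P v \<Longrightarrow> P w \<Longrightarrow> P (v + w)"
  shows "P w"
proof (induction w rule: tensor_induct)
  case (tens a b)
  have 0: "P 0" using assms(1)[of 0] by simp
  note closed = op_apply_closed[of P, OF assms(2-4) 0]
  show ?case
  proof (induction b rule: ext_induct)
    case (vacuum c)
    show ?case
    proof (induction a rule: sym_induct)
      case (vacuum b)
      show ?case using assms(1)[of "c * b"]
        by (simp add: vacuum_def tens_scale_left tens_scale_right scaleC_scaleC)
    next
      case (act y s)
      have "P (op_apply (Beta (fst y)) (s \<otimes> c *\<^sub>C ext_vacuum)
          + op_apply (Gamma (snd y)) (s \<otimes> c *\<^sub>C ext_vacuum))"
        by (intro assms(4) closed act)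
      then show ?case
        by (simp add: on_left_tens clinear_sym_act flip: tens_add_left sym_act_add)
    qed (simp add: tens_add_left assms(4))
  next
    case (act y t)
    have "P (op_apply (Tau (fst y)) (a \<otimes> t) + op_apply (Eps (snd y)) (a \<otimes> t))"
      by (intro assms(4) closed act)
    then show ?case
      by (simp add: on_right_tens clinear_ext_act flip: tens_add_right ext_act_add)
  qed (simp add: tens_add_right assms(4))
qed (rule assms(4))

text \<open>Settles the degenerate case of later identities: the vacuum generates the space.\<close>

lemma weil_trivial: "vacuum = (0 :: 'g::complex_vector weil) \<Longrightarrow> (w :: 'g weil) = 0"
  by (induction w rule: weil_induct) (simp_all add: psi_simps chi_simps)

lemma locally_finite:
  "\<exists>N\<ge>0. \<forall>n>N. \<forall>s x f. psi s x n w = 0 \<and> chi s f (- n) w = 0"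
  using op_locally_finite[of w] unfolding psi_def chi_def at_degree_def by fastforce

section \<open>Quadratic operators\<close>

lemma basis_expansion: "(\<Sum>v\<in>lie_basis. dual_apply (dual_basis v) x *\<^sub>C v) = x"
proof -
  interpret fd: finite_dimensional_vector_space scaleC "lie_basis :: 'a set"
    by (rule finite_dimensional_lie_basis)
  show ?thesis
    using cvec.sum_representation_eq[of lie_basis x lie_basis]
    by (simp add: dual_basis_apply fd.independent_Basis fd.span_Basis finite_lie_basis)
qed

lemma dual_apply_clinear: "clinear (dual_apply f)"
  using dual_apply[of f] by simp

lemmas dual_apply_simps = clinear_simps[OF dual_apply_clinear]

lemma dual_apply_arith:
  "dual_apply (f + g) x = dual_apply f x + dual_apply g x"
  "dual_apply (c *\<^sub>C f) x = c * dual_apply f x"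
  by (simp_all add: plus_dual.rep_eq scaleC_dual.rep_eq scaleC_complex_def)

lemma dual_apply_sum: "dual_apply (\<Sum>i\<in>A. f i) x = (\<Sum>i\<in>A. dual_apply (f i) x)"
  by (induction A rule: infinite_finite_induct)
    (simp_all add: zero_dual_apply dual_apply_arith)

lemma dual_expansion: "(\<Sum>v\<in>lie_basis. dual_apply f v *\<^sub>C dual_basis v) = f"
proof -
  have "dual_apply (\<Sum>v\<in>lie_basis. dual_apply f v *\<^sub>C dual_basis v) x = dual_apply f x" for x
  proof -
    have "dual_apply f x = dual_apply f (\<Sum>v\<in>lie_basis. dual_apply (dual_basis v) x *\<^sub>C v)"
      by (simp add: basis_expansion)
    then show ?thesis
      by (simp add: dual_apply_sum dual_apply_arith dual_apply_simps scaleC_complex_def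
          mult.commute)
  qed
  then show ?thesis by (simp add: dual_apply_inject[symmetric] fun_eq_iff)
qed

lemma psi_expansion:
  "(\<Sum>v\<in>lie_basis. dual_apply (dual_basis v) x *\<^sub>C psi s v n w) = psi s x n w"
  by (subst (2) basis_expansion[of x, symmetric]) (simp add: psi_arg_simps del: cvec.scale_scale)

lemma chi_expansion:
  "(\<Sum>v\<in>lie_basis. dual_apply f v *\<^sub>C chi s (dual_basis v) n w) = chi s f n w"
  by (subst (2) dual_expansion[of f, symmetric]) (simp add: chi_arg_simps del: cvec.scale_scale)

text \<open>If exactly one of the two factors annihilates the vacuum, it stands on the right, so that
  \<open>quad\<close> below is a locally finite sum; otherwise \<open>m \<noteq> 0\<close> and the factors supercommute.\<close>

definition qterm :: "bool \<Rightarrow> bool \<Rightarrow> int \<Rightarrow> 'g::fd_complex_lie_algebra \<Rightarrow> int \<Rightarrow> 'g weil \<Rightarrow> 'g weil" where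
  "qterm s t m v j w = (if j \<le> 0 then psi s v (j + m) (chi t (dual_basis v) j w)
      else sg s t *\<^sub>C chi t (dual_basis v) j (psi s v (j + m) w))"

definition quad ::
  "bool \<Rightarrow> bool \<Rightarrow> int \<Rightarrow> (int \<Rightarrow> complex) \<Rightarrow> 'g::fd_complex_lie_algebra weil \<Rightarrow> 'g weil" where
  "quad s t m p w = Sum_any (\<lambda>j. p j *\<^sub>C (\<Sum>v\<in>lie_basis. qterm s t m v j w))"

lemma clinear_qterm: "clinear (qterm s t m v j)"
  unfolding clinear_iff qterm_def
  by (auto simp: psi_simps chi_simps scaleC_add_right scaleC_scaleC mult.commute)

text \<open>The right-hand factor kills \<open>w\<close> at both ends: \<open>chi\<close> for j far
  below 0, and \<open>psi\<close> in degree j + m for j far above 0.\<close>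

lemma qterm_support: "\<exists>N\<ge>0. \<forall>j v. \<bar>j\<bar> > N \<longrightarrow> qterm s t m v j w = 0"
proof -
  obtain N where N: "N \<ge> 0" "\<And>n s x f. n > N \<Longrightarrow> psi s x n w = 0 \<and> chi s f (- n) w = 0"
    using locally_finite[of w] by blast
  have "qterm s t m v j w = 0" if "\<bar>j\<bar> > N + \<bar>m\<bar>" for j v
  proof (cases "j \<le> 0")
    case True
    with that have "chi t (dual_basis v) j w = 0" using N(2)[of "- j"] by auto
    with True show ?thesis by (simp add: qterm_def psi_simps)
  next
    case False
    with that have "psi s v (j + m) w = 0" using N(2)[of "j + m"] by auto
    with False show ?thesis by (simp add: qterm_def chi_simps)
  qed
  then show ?thesis using N(1) by (intro exI[of _ "N + \<bar>m\<bar>"]) auto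
qed

lemma finite_qterm: "finite {j. p j *\<^sub>C (\<Sum>v\<in>lie_basis. qterm s t m v j w) \<noteq> 0}"
proof -
  obtain N where N: "\<And>j v. \<bar>j\<bar> > N \<Longrightarrow> qterm s t m v j w = 0"
    using qterm_support[of s t m w] by blast
  have "{j. p j *\<^sub>C (\<Sum>v\<in>lie_basis. qterm s t m v j w) \<noteq> 0} \<subseteq> {- N..N}"
  proof
    fix j assume "j \<in> {j. p j *\<^sub>C (\<Sum>v\<in>lie_basis. qterm s t m v j w) \<noteq> 0}"
    then have "\<not> \<bar>j\<bar> > N" using N[of j] by auto
    then show "j \<in> {- N..N}" by auto
  qed
  then show ?thesis by (rule finite_subset) simp
qed

lemma clinear_quad: "clinear (quad s t m p)"
  unfolding quad_def
  by (rule clinear_Sum_any)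
    (rule finite_qterm | simp add: clinear_iff clinear_simps[OF clinear_qterm] sum.distrib
      scaleC_add_right cvec.scale_sum_right scaleC_scaleC mult.commute)+

lemmas quad_simps = clinear_simps[OF clinear_quad]

lemma quad_eq_sum:
  assumes "finite A" "\<And>j v. j \<notin> A \<Longrightarrow> p j \<noteq> 0 \<Longrightarrow> qterm s t m v j w = 0"
  shows "quad s t m p w = (\<Sum>j\<in>A. p j *\<^sub>C (\<Sum>v\<in>lie_basis. qterm s t m v j w))"
  unfolding quad_def
  by (rule Sum_any.expand_superset) (use assms in \<open>auto intro!: sum.neutral\<close>)

lemma quad_add: "quad s t m (\<lambda>j. p j + q j) w = quad s t m p w + quad s t m q w"
  unfolding quad_def scaleC_add_left by (rule Sum_any.distrib) (rule finite_qterm)+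

lemma quad_scale: "quad s t m (\<lambda>j. c * p j) w = c *\<^sub>C quad s t m p w"
proof -
  obtain N where N: "\<And>j v. \<bar>j\<bar> > N \<Longrightarrow> qterm s t m v j w = 0"
    using qterm_support[of s t m w] by blast
  have *: "quad s t m q w = (\<Sum>j\<in>{-N..N}. q j *\<^sub>C (\<Sum>v\<in>lie_basis. qterm s t m v j w))" for q
    by (rule quad_eq_sum) (auto intro!: N)
  show ?thesis by (simp add: * cvec.scale_sum_right scaleC_scaleC)
qed

section \<open>Commutators of quadratic operators with generators\<close>

text \<open>The two orderings in \<open>qterm\<close> differ by a scalar, which drops out of the
  commutator with a generator. What remains is the contraction of the factor \<open>chi\<close> with
  the given \<open>psi\<close>.\<close>

lemma qterm_psi:
  "qterm s t m v j (psi r x l w) = sg (s \<noteq> t) r *\<^sub>C psi r x l (qterm s t m v j w)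
     + (if r = t \<and> j = l then dual_apply (dual_basis v) x else 0) *\<^sub>C psi s v (j + m) w"
  unfolding qterm_def
  by (cases s; cases t; cases r)
    (simp_all add: chi_psi psi_psi[of _ v "j + m" _ x l] psi_simps chi_simps scaleC_add_right
        scaleC_scaleC)

lemma qterm_chi:
  "qterm s t m v j (chi r f l w) = sg (s \<noteq> t) r *\<^sub>C chi r f l (qterm s t m v j w)
     - (if r = s \<and> j + m = l then sg s t * sg s s * dual_apply f v else 0)
         *\<^sub>C chi t (dual_basis v) j w"
  unfolding qterm_def
  by (cases s; cases t; cases r)
    (simp_all add: psi_chi chi_chi[of _ "dual_basis v" j _ f l] psi_simps chi_simps scaleC_add_right
      cvec.scale_right_diff_distrib scaleC_scaleC)

text \<open>The contraction selects j = l, and the sum over the basis collapses by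
  \<open>psi_expansion\<close>. So the operator acts on the \<open>psi\<close> as a matrix, changing
  the family from t to s and the degree by m.\<close>

lemma quad_psi:
  "quad s t m p (psi r x l w) = sg (s \<noteq> t) r *\<^sub>C psi r x l (quad s t m p w)
     + (if r = t then p l else 0) *\<^sub>C psi s x (l + m) w"
proof -
  obtain N M where N: "\<And>j v. \<bar>j\<bar> > N \<Longrightarrow> qterm s t m v j w = 0"
    and M: "\<And>j v. \<bar>j\<bar> > M \<Longrightarrow> qterm s t m v j (psi r x l w) = 0"
    using qterm_support[of s t m w] qterm_support[of s t m "psi r x l w"] by metis
  define A where "A = {- (max \<bar>l\<bar> (max N M))..max \<bar>l\<bar> (max N M)}"
  have A: "finite A" "l \<in> A" by (auto simp: A_def)
  have 1: "quad s t m p w = (\<Sum>j\<in>A. p j *\<^sub>C (\<Sum>v\<in>lie_basis. qterm s t m v j w))"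
    by (rule quad_eq_sum) (auto simp: A_def intro!: N)
  have 2: "quad s t m p (psi r x l w)
      = (\<Sum>j\<in>A. p j *\<^sub>C (\<Sum>v\<in>lie_basis. qterm s t m v j (psi r x l w)))"
    by (rule quad_eq_sum) (auto simp: A_def intro!: M)
  have 3: "(\<Sum>j\<in>A. p j *\<^sub>C (\<Sum>v\<in>lie_basis. (if r = t \<and> j = l then dual_apply (dual_basis v) x else 0)
      *\<^sub>C psi s v (j + m) w)) = (\<Sum>j\<in>A. if j = l then (if r = t then p l else 0) *\<^sub>C psi s x (l
          + m) w else 0)"
    by (rule sum.cong) (auto simp: psi_expansion)
  show ?thesis
    unfolding 1 2 qterm_psi sum.distrib scaleC_add_right 3
    by (simp add: A psi_simps cvec.scale_sum_right scaleC_scaleC mult.commute)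
qed

text \<open>The contragredient of the action in \<open>quad_psi\<close>: now the factor
  \<open>psi\<close> is contracted, which selects j = l - m.\<close>

lemma quad_chi:
  "quad s t m p (chi r f l w) = sg (s \<noteq> t) r *\<^sub>C chi r f l (quad s t m p w)
     - (if r = s then sg s t * sg s s * p (l - m) else 0) *\<^sub>C chi t f (l - m) w"
proof -
  obtain N M where N: "\<And>j v. \<bar>j\<bar> > N \<Longrightarrow> qterm s t m v j w = 0"
    and M: "\<And>j v. \<bar>j\<bar> > M \<Longrightarrow> qterm s t m v j (chi r f l w) = 0"
    using qterm_support[of s t m w] qterm_support[of s t m "chi r f l w"] by metis
  define A where "A = {- (max \<bar>l - m\<bar> (max N M))..max \<bar>l - m\<bar> (max N M)}"
  have A: "finite A" "l - m \<in> A" by (auto simp: A_def)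
  have 1: "quad s t m p w = (\<Sum>j\<in>A. p j *\<^sub>C (\<Sum>v\<in>lie_basis. qterm s t m v j w))"
    by (rule quad_eq_sum) (auto simp: A_def intro!: N)
  have 2: "quad s t m p (chi r f l w)
      = (\<Sum>j\<in>A. p j *\<^sub>C (\<Sum>v\<in>lie_basis. qterm s t m v j (chi r f l w)))"
    by (rule quad_eq_sum) (auto simp: A_def intro!: M)
  have 3: "(\<Sum>j\<in>A. p j *\<^sub>C (\<Sum>v\<in>lie_basis. (if r = s \<and> j + m
      = l then sg s t * sg s s * dual_apply f v else 0)
      *\<^sub>C chi t (dual_basis v) j w))
      = (\<Sum>j\<in>A. if j = l - m then (if r = s then sg s t * sg s s * p (l - m) else 0) *\<^sub>C chi t f (l
          - m) w else 0)"
  proof (rule sum.cong, rule refl)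
    fix j
    show "p j *\<^sub>C (\<Sum>v\<in>lie_basis. (if r = s \<and> j + m = l then sg s t * sg s s * dual_apply f v else 0)
      *\<^sub>C chi t (dual_basis v) j w)
      = (if j = l - m then (if r = s then sg s t * sg s s * p (l - m) else 0) *\<^sub>C chi t f (l
          - m) w else 0)"
      by (subst chi_expansion[of f, symmetric])
        (auto simp: cvec.scale_sum_right scaleC_scaleC mult_ac)
  qed
  show ?thesis
    unfolding 1 2 qterm_chi sum_subtractf cvec.scale_right_diff_distrib 3
    by (simp add: A chi_simps cvec.scale_sum_right scaleC_scaleC mult.commute)
qed

section \<open>Vacuum expectation values\<close>

text \<open>Apply \<open>N - a x\<close> to remove the eigenvector with eigenvalue \<open>a x\<close>.\<close>

lemma eigenvectors_independent:
  fixes f :: "'k \<Rightarrow> 'a::complex_vector"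
  assumes "clinear N" "finite A"
  shows "inj_on a A \<Longrightarrow> (\<And>k. k \<in> A \<Longrightarrow> N (f k) = a k *\<^sub>C f k) \<Longrightarrow> (\<Sum>k\<in>A. f k) = 0 \<Longrightarrow> k \<in> A
    \<Longrightarrow> f k = 0"
  using assms(2)
proof (induction A arbitrary: f k rule: finite_induct)
  case (insert x A)
  define g where "g k = (a k - a x) *\<^sub>C f k" for k
  have "(\<Sum>k\<in>insert x A. g k) = N (\<Sum>k\<in>insert x A. f k) - a x *\<^sub>C (\<Sum>k\<in>insert x A. f k)"
    unfolding clinear_sum'[OF assms(1)] cvec.scale_sum_right sum_subtractf[symmetric] g_def
    by (rule sum.cong) (simp_all add: insert.prems(2) cvec.scale_left_diff_distrib)
  also have "\<dots> = 0" using insert.prems(3) by (simp only: clinear_0[OF assms(1)] scaleC_simps) simp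
  finally have "(\<Sum>k\<in>A. g k) = 0" using insert.hyps by (simp add: g_def)
  moreover have "N (g k) = a k *\<^sub>C g k" if "k \<in> A" for k
    using that by (simp add: g_def clinear_scale[OF assms(1)] insert.prems(2) scaleC_scaleC
        mult.commute)
  ultimately have g: "g k = 0" if "k \<in> A" for k
    using insert.IH[of g] insert.prems(1) that by (auto simp: inj_on_def)
  have f: "f k = 0" if "k \<in> A" for k
    using g[OF that] insert.prems(1) insert.hyps that by (auto simp: g_def inj_on_def)
  with insert.prems(3) insert.hyps have "f x = 0" by simp
  with f insert.prems(4) show ?case by blast
qed simp

text \<open>For m \<ge> 0 the right-hand factor of \<open>qterm\<close> always annihilates the
  vacuum: \<open>chi\<close> in degree j \<le> 0, or \<open>psi\<close> in degree j + m > 0.\<close>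

lemma quad_vacuum: "m \<ge> 0 \<Longrightarrow> quad s t m p vacuum = 0"
  by (subst quad_eq_sum[of "{}"]) (auto simp: qterm_def chi_vacuum psi_vacuum psi_simps chi_simps)

text \<open>The weights make each creation operator (\<open>psi\<close> with n \<le> 0,
  \<open>chi\<close> with n > 0) raise the eigenvalue by 1 and each annihilation operator lower it
  by 1.\<close>

definition number :: "'g::fd_complex_lie_algebra weil \<Rightarrow> 'g weil" where
  "number w = quad False False 0 (\<lambda>j. if j \<le> 0 then 1 else - 1) w
     + quad True True 0 (\<lambda>j. if j \<le> 0 then 1 else - 1) w"

lemma clinear_number: "clinear number"
  by (simp add: clinear_iff number_def quad_simps scaleC_add_right)

lemmas number_simps = clinear_simps[OF clinear_number]

lemma number_psi: "number (psi s x n w) = psi s x n (number w) + (if n \<le> 0 then 1 else - 1)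
    *\<^sub>C psi s x n w"
  by (cases s) (simp_all add: number_def quad_psi psi_simps)

lemma number_chi: "number (chi s f n w) = chi s f n (number w) + (if n \<le> 0 then - 1 else 1)
    *\<^sub>C chi s f n w"
  by (cases s) (simp_all add: number_def quad_chi chi_simps)

lemma number_vacuum: "number vacuum = 0"
  by (simp add: number_def quad_vacuum)

inductive monomial :: "nat \<Rightarrow> 'g::fd_complex_lie_algebra weil \<Rightarrow> bool" where
  monomial_vacuum: "monomial 0 vacuum"
| monomial_psi: "monomial k w \<Longrightarrow> n \<le> 0 \<Longrightarrow> monomial (Suc k) (psi s x n w)"
| monomial_chi: "monomial k w \<Longrightarrow> n > 0 \<Longrightarrow> monomial (Suc k) (chi s f n w)"

lemma number_monomial: "monomial k w \<Longrightarrow> number w = of_nat k *\<^sub>C w"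
  by (induction rule: monomial.induct)
    (simp_all add: number_vacuum number_psi number_chi psi_simps chi_simps scaleC_add_left
        add.commute)

lemma clinear_span_closed:
  assumes "clinear f" "\<And>v. v \<in> S \<Longrightarrow> f v \<in> cvec.span T" "w \<in> cvec.span S"
  shows "f w \<in> cvec.span T"
  using assms(3)
  by (induction rule: cvec.span_induct_alt)
    (simp_all add: clinear_simps[OF assms(1)] assms(2) cvec.span_zero cvec.span_add cvec.span_scale)

lemma creation_span_monomial:
  assumes "w \<in> cvec.span {v. \<exists>k. monomial k v}"
  shows "n \<le> 0 \<Longrightarrow> psi s x n w \<in> cvec.span {v. \<exists>k\<ge>1. monomial k v}"
    "n > 0 \<Longrightarrow> chi s f n w \<in> cvec.span {v. \<exists>k\<ge>1. monomial k v}"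
proof -
  assume "n \<le> 0"
  then have "psi s x n v \<in> cvec.span {v. \<exists>k\<ge>1. monomial k v}" if "\<exists>k. monomial k v" for v
    using that by (force intro: cvec.span_base monomial_psi)
  then show "psi s x n w \<in> cvec.span {v. \<exists>k\<ge>1. monomial k v}"
    by (intro clinear_span_closed[OF clinear_psi _ assms]) auto
next
  assume "n > 0"
  then have "chi s f n v \<in> cvec.span {v. \<exists>k\<ge>1. monomial k v}" if "\<exists>k. monomial k v" for v
    using that by (force intro: cvec.span_base monomial_chi)
  then show "chi s f n w \<in> cvec.span {v. \<exists>k\<ge>1. monomial k v}"
    by (intro clinear_span_closed[OF clinear_chi _ assms]) auto
qed

lemma span_monomial_mono:
  "w \<in> cvec.span {v. \<exists>k\<ge>1. monomial k v} \<Longrightarrow> w \<in> cvec.span {v. \<exists>k. monomial k v}"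
  by (rule subsetD[OF cvec.span_mono]) auto

lemmas creation_span = creation_span_monomial[THEN span_monomial_mono]

text \<open>Moving an annihilation operator to the right leaves only contractions, which are scalar
  multiples of shorter monomials. Hence monomials in creation operators already span.\<close>

lemma annihilation_monomial:
  assumes "monomial k w"
  shows "n > 0 \<Longrightarrow> psi s x n w \<in> cvec.span {v. \<exists>k. monomial k v}"
    "n \<le> 0 \<Longrightarrow> chi s f n w \<in> cvec.span {v. \<exists>k. monomial k v}"
proof -
  assume "n > 0"
  with assms show "psi s x n w \<in> cvec.span {v. \<exists>k. monomial k v}"
  proof (induction rule: monomial.induct)
    case monomial_vacuum
    then show ?case by (simp add: psi_vacuum cvec.span_zero)
  next
    case (monomial_psi k w l t y)
    then show ?case
      unfolding psi_psi[of s x n] by - (rule cvec.span_scale, rule creation_span(1), simp_all)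
  next
    case (monomial_chi k w l t f)
    then show ?case
      unfolding psi_chi
      by (intro cvec.span_diff cvec.span_scale creation_span(2) cvec.span_base[of w]) auto
  qed
next
  assume "n \<le> 0"
  with assms show "chi s f n w \<in> cvec.span {v. \<exists>k. monomial k v}"
  proof (induction rule: monomial.induct)
    case monomial_vacuum
    then show ?case by (simp add: chi_vacuum cvec.span_zero)
  next
    case (monomial_psi k w l t y)
    then show ?case
      unfolding chi_psi
      by (intro cvec.span_add cvec.span_scale creation_span(1) cvec.span_base[of w]) auto
  next
    case (monomial_chi k w l t g)
    then show ?case
      unfolding chi_chi[of s f n] by - (rule cvec.span_scale, rule creation_span(2), simp_all)
  qed
qed

lemma span_monomial: "w \<in> cvec.span {v. \<exists>k. monomial k v}"
proof (induction w rule: weil_induct)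
  case (vacuum c)
  show ?case by (intro cvec.span_scale cvec.span_base) (auto intro: monomial_vacuum)
next
  case (psi s x n w)
  then show ?case
  proof (cases "n \<le> 0")
    case False
    then have "psi s x n v \<in> cvec.span {v. \<exists>k. monomial k v}" if "\<exists>k. monomial k v" for v
      using annihilation_monomial(1)[of _ v n] that by auto
    then show ?thesis
      by (intro clinear_span_closed[OF clinear_psi _ psi]) auto
  qed (rule creation_span)
next
  case (chi s f n w)
  then show ?case
  proof (cases "n > 0")
    case False
    then have "chi s f n v \<in> cvec.span {v. \<exists>k. monomial k v}" if "\<exists>k. monomial k v" for v
      using annihilation_monomial(2)[of _ v n] that by auto
    then show ?thesis
      by (intro clinear_span_closed[OF clinear_chi _ chi]) auto
  qed (rule creation_span)
qed (rule cvec.span_add)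

lemma monomial_decomposition:
  assumes "w \<in> cvec.span {v. \<exists>k\<ge>a. monomial k v}"
  shows "\<exists>K f. w = (\<Sum>k\<in>{a..K}. f k) \<and> (\<forall>k. f k \<in> cvec.span {v. monomial k v})"
  using assms
proof (induction rule: cvec.span_induct_alt)
  case base
  show ?case by (intro exI[of _ a] exI[of _ "\<lambda>_. 0"]) (simp add: cvec.span_zero)
next
  case (step c x y)
  then obtain k K f where k: "k \<ge> a" "monomial k x" and y: "y = (\<Sum>k\<in>{a..K}. f k)"
    and f: "\<And>k. f k \<in> cvec.span {v. monomial k v}" by blast
  define g where "g j = (if j = k then c *\<^sub>C x else 0) + (if j \<le> K then f j else 0)" for j
  have "(\<Sum>j\<in>{a..max k K}. if j \<le> K then f j else 0) = (\<Sum>j\<in>{a..K}. f j)"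
    by (rule sum.mono_neutral_cong_right) auto
  then have "c *\<^sub>C x + y = (\<Sum>j\<in>{a..max k K}. g j)"
    using k(1) by (simp add: g_def sum.distrib y)
  moreover have "g j \<in> cvec.span {v. monomial j v}" for j
    using k(2) f by (auto simp: g_def intro!: cvec.span_add cvec.span_scale cvec.span_zero intro:
        cvec.span_base)
  ultimately show ?case by blast
qed

lemma number_span_monomial:
  assumes "w \<in> cvec.span {v. monomial k v}"
  shows "number w = of_nat k *\<^sub>C w"
  using assms
proof (induction rule: cvec.span_induct_alt)
  case (step c x y)
  then show ?case by (auto simp: number_simps number_monomial scaleC_add_right scaleC_scaleC
      mult.commute)
qed (simp add: number_simps)

text \<open>The left vacuum: a functional that vanishes on every vector of the form creation
  operator applied to something.\<close>

definition is_vev :: "('g::fd_complex_lie_algebra weil \<Rightarrow> complex) \<Rightarrow> bool" where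
  "is_vev \<phi> \<longleftrightarrow> clinear \<phi> \<and> \<phi> vacuum = 1 \<and> (\<forall>s x n w. n \<le> 0 \<longrightarrow> \<phi> (psi s x n w) = 0)
     \<and> (\<forall>s f n w. n > 0 \<longrightarrow> \<phi> (chi s f n w) = 0)"

lemma functional_separating:
  assumes "(v::'a::complex_vector) \<notin> cvec.span S"
  shows "\<exists>\<phi>::'a \<Rightarrow> complex. clinear \<phi> \<and> \<phi> v = 1 \<and> (\<forall>w\<in>cvec.span S. \<phi> w = 0)"
proof -
  interpret pair: vector_space_pair "scaleC :: complex \<Rightarrow> 'a \<Rightarrow> 'a"
      "scaleC :: complex \<Rightarrow> complex \<Rightarrow> complex"
    by unfold_locales
  obtain B where B: "B \<subseteq> S" "cvec.independent B" "S \<subseteq> cvec.span B"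
    using cvec.maximal_independent_subset[of S] by metis
  then have span: "cvec.span B = cvec.span S"
    by (metis cvec.span_eq cvec.span_superset subset_trans)
  with assms B(2) have "cvec.independent (insert v B)"
    by (simp add: cvec.independent_insertI)
  from pair.linear_independent_extend[OF this, of "\<lambda>b. if b = v then 1 else 0"]
  obtain \<phi> :: "'a \<Rightarrow> complex" where \<phi>: "clinear \<phi>" "\<And>b. b \<in> insert v B \<Longrightarrow> \<phi> b = (if b
      = v then 1 else 0)" by metis
  have "v \<notin> B" using assms B(1) cvec.span_base by blast
  then have \<phi>0: "\<phi> b = 0" if "b \<in> B" for b using \<phi>(2)[of b] that by auto
  have "\<phi> w = 0" if "w \<in> cvec.span B" for w
    using that by (induction rule: cvec.span_induct_alt) (simp_all add: clinear_simps[OF \<phi>(1)] \<phi>0)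
  with \<phi> show ?thesis by (intro exI[of _ \<phi>]) (auto simp: span)
qed

text \<open>The vacuum has number eigenvalue 0, and monomials with k \<ge> 1 creation operators have
  eigenvalue k. So a nonzero vacuum is outside their span, and a functional separates it from
  them.\<close>

lemma vev_exists:
  assumes "vacuum \<noteq> (0 :: 'g::fd_complex_lie_algebra weil)"
  shows "\<exists>\<phi> :: 'g weil \<Rightarrow> complex. is_vev \<phi>"
proof -
  have "(vacuum :: 'g weil) \<notin> cvec.span {v. \<exists>k\<ge>1. monomial k v}"
  proof
    assume "(vacuum :: 'g weil) \<in> cvec.span {v. \<exists>k\<ge>1. monomial k v}"
    then obtain K f where w: "(vacuum :: 'g weil) = (\<Sum>k\<in>{1..K}. f k)"
      and f: "\<And>k. f k \<in> cvec.span {v. monomial k v}"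
      using monomial_decomposition[of _ 1] by blast
    \<comment> \<open>Moving the vacuum to the other side gives a vanishing sum of eigenvectors with
      distinct eigenvalues 0, 1, ..., K.\<close>
    define g where "g k = (if k = 0 then - vacuum else f k)" for k
    have "{0..K} = insert 0 {1..K}" by auto
    then have "(\<Sum>k\<in>{0..K}. g k) = - vacuum + (\<Sum>k\<in>{1..K}. f k)"
      by (simp add: g_def)
    then have "(\<Sum>k\<in>{0..K}. g k) = 0" using w by simp
    moreover have "number (g k) = of_nat k *\<^sub>C g k" for k
      by (simp add: g_def number_simps number_vacuum number_span_monomial[OF f])
    ultimately have "g 0 = 0"
      by (intro eigenvectors_independent[OF clinear_number, of "{0..K}" of_nat g 0])
        (auto simp: inj_on_def)
    then show False using assms by (simp add: g_def)
  qed
  from functional_separating[OF this] show ?thesis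
    unfolding is_vev_def using creation_span_monomial[OF span_monomial] by blast
qed

locale vev =
  fixes \<phi> :: "'g::fd_complex_lie_algebra weil \<Rightarrow> complex"
  assumes is_vev: "is_vev \<phi>"
begin

lemma clinear_phi: "clinear \<phi>"
  and phi_vacuum [simp]: "\<phi> vacuum = 1"
  and phi_psi: "n \<le> 0 \<Longrightarrow> \<phi> (psi s x n w) = 0"
  and phi_chi: "n > 0 \<Longrightarrow> \<phi> (chi s f n w) = 0"
  using is_vev by (auto simp: is_vev_def)

lemmas phi_simps = clinear_simps[OF clinear_phi]

text \<open>All terms of the number operator end in an annihilation operator, so
  \<open>number w = 0\<close> and only the component without creation operators survives, which is a
  multiple of the vacuum.\<close>

lemma vacuum_unique:
  assumes "\<And>s x n. n > 0 \<Longrightarrow> psi s x n w = 0" "\<And>s f n. n \<le> 0 \<Longrightarrow> chi s f n w = 0"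
  shows "w = \<phi> w *\<^sub>C vacuum"
proof -
  obtain K f where w: "w = (\<Sum>k\<in>{0..K}. f k)" and f: "\<And>k. f k \<in> cvec.span {v. monomial k v}"
    using monomial_decomposition[of w 0] span_monomial[of w] by auto
  have "number w = 0"
    unfolding number_def
    by (subst (1 2) quad_eq_sum[of "{}"]) (auto simp: qterm_def assms psi_simps chi_simps)
  then have "(\<Sum>k\<in>{0..K}. of_nat k *\<^sub>C f k) = 0"
    unfolding w number_simps(6) by (simp only: number_span_monomial[OF f])
  then have "of_nat k *\<^sub>C f k = 0" if "k \<in> {0..K}" for k
    using that
    by (intro eigenvectors_independent[OF clinear_number, of "{0..K}" of_nat "\<lambda>k. of_nat k
        *\<^sub>C f k" k])
      (auto simp: inj_on_def number_simps number_span_monomial[OF f])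
  then have "f k = 0" if "k \<in> {0..K} - {0}" for k using that by auto
  then have "w = f 0" unfolding w by (subst sum.remove[of _ 0]) auto
  moreover have "monomial 0 v \<Longrightarrow> v = vacuum" for v :: "'g weil" by (auto elim: monomial.cases)
  then have "cvec.span {v :: 'g weil. monomial 0 v} \<subseteq> cvec.span {vacuum}"
    by (intro cvec.span_mono) auto
  then have "f 0 \<in> cvec.span {vacuum}" using f by blast
  then obtain c where "f 0 = c *\<^sub>C vacuum" by (auto simp: cvec.span_singleton)
  ultimately show ?thesis by (simp add: phi_simps scaleC_complex_def)
qed

text \<open>An operator supercommuting with all generators is determined by the image of the vacuum,
  which all annihilation operators kill.\<close>

lemma supercommuting_zero:
  assumes "clinear X"
    and psi: "\<And>s x n w. X (psi s x n w) = sg p s *\<^sub>C psi s x n (X w)"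
    and chi: "\<And>s f n w. X (chi s f n w) = sg p s *\<^sub>C chi s f n (X w)"
    and "\<phi> (X vacuum) = 0"
  shows "X w = 0"
proof -
  have "psi s x n (X vacuum) = 0" if "n > 0" for s x n
    using psi[of s x n vacuum] that
    by (simp add: psi_vacuum clinear_simps[OF assms(1)] sg_def split: if_splits)
  moreover have "chi s f n (X vacuum) = 0" if "n \<le> 0" for s f n
    using chi[of s f n vacuum] that
    by (simp add: chi_vacuum clinear_simps[OF assms(1)] sg_def split: if_splits)
  ultimately have "X vacuum = \<phi> (X vacuum) *\<^sub>C vacuum" by (rule vacuum_unique)
  then have "X vacuum = 0" using assms(4) by simp
  then show ?thesis
    by (induction w rule: weil_induct)
      (simp_all add: clinear_simps[OF assms(1)] psi chi psi_simps chi_simps)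
qed

text \<open>For m \<le> 0 every term begins with a creation operator: \<open>psi\<close> in degree j
  + m \<le> 0, or \<open>chi\<close> in degree j > 0.\<close>

lemma phi_quad: "m \<le> 0 \<Longrightarrow> \<phi> (quad s t m p w) = 0"
proof -
  assume m: "m \<le> 0"
  obtain N where "\<And>j v. \<bar>j\<bar> > N \<Longrightarrow> qterm s t m v j w = 0"
    using qterm_support[of s t m w] by blast
  then have "quad s t m p w = (\<Sum>j\<in>{-N..N}. p j *\<^sub>C (\<Sum>v\<in>lie_basis. qterm s t m v j w))"
    by (intro quad_eq_sum) auto
  moreover have "\<phi> (qterm s t m v j w) = 0" for v j
    using m by (auto simp: qterm_def phi_simps phi_psi phi_chi)
  ultimately show ?thesis by (simp add: phi_simps)
qed

end

section \<open>Central terms of quadratic operators\<close>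

text \<open>The range 1 \<le> j \<le> - n consists of the indices for which both factors are
  creation operators.\<close>

lemma quad_vacuum_expand:
  "quad s t n q vacuum = (\<Sum>j\<in>{1..-n}. q j *\<^sub>C (\<Sum>v\<in>lie_basis. qterm s t n v j vacuum))"
  by (rule quad_eq_sum) (auto simp: qterm_def chi_vacuum psi_vacuum psi_simps chi_simps)

text \<open>The Schwinger term of two normally ordered bilinears of degrees m and - m. The dimension
  of the Lie algebra is the trace over its basis. For m > 0 the sum is the double contraction in the
  product itself; for m < 0 it comes, with the sign of the exchange, from the product in the
  opposite order.\<close>

definition kappa :: "bool \<Rightarrow> 'g::fd_complex_lie_algebra itself \<Rightarrow> int \<Rightarrow> (int \<Rightarrow> complex) \<Rightarrow> (int \<Rightarrow>
    complex) \<Rightarrow> complex" where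
  "kappa s g m p q = sg s s * of_nat (card (lie_basis :: 'g set)) *
     (if m > 0 then - (\<Sum>j\<in>{1..m}. p (j - m) * q j) else (\<Sum>j\<in>{1..-m}. p j * q (j + m)))"

context vev
begin

text \<open>Both factors created by the second operator must be contracted with the first. This
  forces the families to match crosswise and the degrees to cancel.\<close>

lemma phi_quad_quad:
  assumes "m > 0" "n < 0"
  shows "\<phi> (quad s t m p (quad s' t' n q vacuum)) =
    (if s = t' \<and> t = s' \<and> m + n = 0 then kappa s TYPE('g) m p q else 0)"
proof -
  have *: "\<phi> (quad s t m p (qterm s' t' n v j vacuum)) =
      (if s = t' \<and> t = s' \<and> m + n = 0 then - sg s s * p (j - m) else 0)"
    if "j \<in> {1..-n}" "v \<in> lie_basis" for v j
  proof -
    have "\<phi> (quad s t m p (qterm s' t' n v j vacuum)) =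
        - sg s' t' * (if t' = s then sg s t * sg s s * p (j - m) else 0)
          * \<phi> (chi t (dual_basis v) (j - m) (psi s' v (j + n) vacuum))"
      using that by (simp add: qterm_def quad_simps quad_chi phi_simps phi_chi scaleC_complex_def)
    also have "\<phi> (chi t (dual_basis v) (j - m) (psi s' v (j + n) vacuum)) =
        (if s' = t \<and> m + n = 0 then 1 else 0)"
    proof (cases "j - m > 0")
      case True
      then show ?thesis using that by (auto simp: phi_chi)
    next
      case False
      then show ?thesis
        using that by (auto simp: chi_psi chi_vacuum psi_simps phi_simps dual_basis_on_basis
            scaleC_complex_def)
    qed
    finally show ?thesis by (auto simp: sg_commute[of s' t'])
  qed
  have "\<phi> (quad s t m p (quad s' t' n q vacuum)) =
      (\<Sum>j\<in>{1..-n}. q j * (\<Sum>v\<in>(lie_basis :: 'g set).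
        (if s = t' \<and> t = s' \<and> m + n = 0 then - sg s s * p (j - m) else 0)))"
    unfolding quad_vacuum_expand quad_simps phi_simps scaleC_complex_def
    by (intro sum.cong refl arg_cong2[of _ _ _ _ "(*)"]) (rule *)
  also have "\<dots> = (if s = t' \<and> t = s' \<and> m + n = 0 then kappa s TYPE('g) m p q else 0)"
  proof (cases "s = t' \<and> t = s' \<and> m + n = 0")
    case True
    then have "- n = m" by simp
    with True assms show ?thesis
      by (auto simp: kappa_def sum_distrib_left sum_negf mult_ac)
  qed auto
  finally show ?thesis .
qed

end

text \<open>The matrix supercommutator of the actions on generators plus a Schwinger term. The
  difference of the two sides supercommutes with all generators by \<open>quad_psi\<close> and
  \<open>quad_chi\<close>, so only its vacuum expectation value has to be compared.\<close>

lemma quad_commutator: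
  fixes w :: "'g::fd_complex_lie_algebra weil"
  shows "quad s t m p (quad s' t' n q w) =
    sg (s \<noteq> t) (s' \<noteq> t') *\<^sub>C quad s' t' n q (quad s t m p w)
    + (if s' = t then quad s t' (m + n) (\<lambda>l. q l * p (l + n)) w else 0)
    - sg (s \<noteq> t) (s' \<noteq> t') *\<^sub>C (if s = t' then quad s' t (m + n) (\<lambda>l. p l * q (l + m)) w else 0)
    + (if s = t' \<and> t = s' \<and> m + n = 0 then kappa s TYPE('g) m p q else 0) *\<^sub>C w"
proof (cases "vacuum = (0 :: 'g weil)")
  case True
  show ?thesis by (rule trans[OF weil_trivial[OF True] weil_trivial[OF True, symmetric]])
next
  case False
  then obtain \<phi> :: "'g weil \<Rightarrow> complex" where "is_vev \<phi>" using vev_exists by blast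
  then interpret vev \<phi> by unfold_locales
  define X where "X w = quad s t m p (quad s' t' n q w)
    - sg (s \<noteq> t) (s' \<noteq> t') *\<^sub>C quad s' t' n q (quad s t m p w)
    - (if s' = t then quad s t' (m + n) (\<lambda>l. q l * p (l + n)) w else 0)
    + sg (s \<noteq> t) (s' \<noteq> t') *\<^sub>C (if s = t' then quad s' t (m + n) (\<lambda>l. p l * q (l + m)) w else 0)
    - (if s = t' \<and> t = s' \<and> m + n = 0 then kappa s TYPE('g) m p q else 0) *\<^sub>C w" for w :: "'g weil"
  have "clinear X"
    unfolding clinear_iff X_def
    by (auto simp add: quad_simps algebra_simps scaleC_add_right cvec.scale_right_diff_distrib
        scaleC_scaleC)
  moreover have "X (psi r x l w) = sg ((s \<noteq> t) \<noteq> (s' \<noteq> t')) r *\<^sub>C psi r x l (X w)" for r x l w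
    unfolding X_def
    by (cases s; cases t; cases s'; cases t'; cases r)
      (simp_all add: quad_psi psi_simps quad_simps algebra_simps cvec.scale_right_diff_distrib
        scaleC_add_right scaleC_scaleC)
  moreover have "X (chi r f l w) = sg ((s \<noteq> t) \<noteq> (s' \<noteq> t')) r *\<^sub>C chi r f l (X w)" for r f l w
    unfolding X_def
    by (cases s; cases t; cases s'; cases t'; cases r)
      (simp_all add: quad_chi chi_simps quad_simps algebra_simps cvec.scale_right_diff_distrib
        scaleC_add_right scaleC_scaleC)
  moreover have "\<phi> (X vacuum) = 0"
  proof -
    have 1: "\<phi> (quad s t m p (quad s' t' n q vacuum)) =
      (if m > 0 \<and> n < 0 \<and> s = t' \<and> t = s' \<and> m + n = 0 then kappa s TYPE('g) m p q else 0)"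
      using phi_quad_quad[of m n s t p s' t' q]
      by (cases "m > 0"; cases "n < 0") (auto simp: phi_quad quad_vacuum quad_simps phi_simps)
    have 2: "\<phi> (quad s' t' n q (quad s t m p vacuum)) =
      (if n > 0 \<and> m < 0 \<and> s = t' \<and> t = s' \<and> m + n = 0 then kappa s' TYPE('g) n q p else 0)"
      using phi_quad_quad[of n m s' t' q s t p]
      by (cases "n > 0"; cases "m < 0") (auto simp: phi_quad quad_vacuum quad_simps phi_simps)
    have 3: "\<phi> (quad s t k p vacuum) = 0" for s t k p
      by (cases "k \<ge> 0") (auto simp: phi_quad quad_vacuum phi_simps)
    have 4: "kappa s TYPE('g) 0 p q = 0" by (simp add: kappa_def)
    \<comment> \<open>Exchanging the two operators interchanges the two branches of
      \<open>kappa\<close> up to the sign of the exchange.\<close>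
    have 5: "sg (s \<noteq> t) (t \<noteq> s) * kappa t TYPE('g) (- m) q p = - kappa s TYPE('g) m p q" if "m < 0"
    proof -
      have "(\<Sum>j\<in>{1..-m}. q (j - (-m)) * p j) = (\<Sum>j\<in>{1..-m}. p j * q (j + m))"
        by (simp add: mult.commute)
      with that show ?thesis
        by (cases s; cases t) (simp_all add: kappa_def mult.commute)
    qed
    show ?thesis
    proof (cases "s = t' \<and> t = s' \<and> m + n = 0")
      case True
      then have n: "n = - m" and st: "t' = s" "s' = t" by simp_all
      consider "m > 0" | "m = 0" | "m < 0" by linarith
      then show ?thesis
        unfolding X_def phi_simps 1 2
        by cases (use 3 4 5 in \<open>auto simp: n st phi_simps scaleC_complex_def\<close>)
    next
      case False
      then show ?thesis
        unfolding X_def phi_simps 1 2 by (auto simp: 3 phi_simps)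
    qed
  qed
  ultimately have "X w = 0" by (intro supercommuting_zero)
  then show ?thesis unfolding X_def by (simp add: algebra_simps)
qed

section \<open>The N = 2 superconformal algebra on the Fock space\<close>

text \<open>The modes with index \<open>n\<close> lower the degree by \<open>n\<close>; with the opposite orientation the same
  operators would have central charge \<open>- 3 dim \<gg>\<close>. The shift \<open>- k - 1\<close> for \<open>G\<^sup>+\<close> is forced by
  \<open>r = k + 1/2\<close> and the form \<open>r\<^sup>2 - 1/4\<close> of the central term.\<close>

primrec n2_op :: "n2_basis \<Rightarrow> 'g::fd_complex_lie_algebra weil \<Rightarrow> 'g weil" where
  "n2_op (L_basis n) w = quad False False (- n) (\<lambda>l. of_int l - (of_int n + 1) / 2) w
     + quad True True (- n) of_int w"
| "n2_op (H_basis n) w = quad False False (- n) (\<lambda>l. - 1) w"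
| "n2_op (Gp_basis k) w = quad True False (- k - 1) (\<lambda>l. 1) w"
| "n2_op (Gm_basis k) w = quad False True (- k) (\<lambda>l. 2 * of_int l) w"
| "n2_op C_basis w = (3 * of_nat (card (lie_basis :: 'g set))) *\<^sub>C w"

lemma clinear_n2_op: "clinear (n2_op b)"
  by (cases b) (auto simp: clinear_iff quad_simps scaleC_add_right scaleC_scaleC mult.commute)

section \<open>Evaluation of the central terms\<close>

lemma sum_int_powers:
  assumes "(m::int) \<ge> 0"
  shows "(\<Sum>j\<in>{1..m}. of_int j :: complex) = of_int m * (of_int m + 1) / 2"
    "(\<Sum>j\<in>{1..m}. (of_int j :: complex)\<^sup>2) = of_int m * (of_int m + 1) * (2 * of_int m + 1) / 6"
proof -
  have ins: "{1..int (Suc k)} = insert (int (Suc k)) {1..int k}" for k by auto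
  have "(\<Sum>j\<in>{1..int k}. of_int j :: complex) = of_nat k * (of_nat k + 1) / 2
    \<and> (\<Sum>j\<in>{1..int k}. (of_int j :: complex)\<^sup>2) = of_nat k * (of_nat k + 1) * (2 * of_nat k
        + 1) / 6" for k
  proof (induction k)
    case (Suc k)
    then show ?case
      unfolding ins by (simp add: field_simps power2_eq_square)
  qed simp
  from this[of "nat m"] show "(\<Sum>j\<in>{1..m}. of_int j :: complex) = of_int m * (of_int m + 1) / 2"
    "(\<Sum>j\<in>{1..m}. (of_int j :: complex)\<^sup>2) = of_int m * (of_int m + 1) * (2 * of_int m + 1) / 6"
    using assms by simp_all
qed

lemma sum_int_quadratic:
  assumes "(m::int) \<ge> 0" "\<And>j. f j = a * (of_int j)\<^sup>2 + b * of_int j + (c :: complex)"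
  shows "(\<Sum>j\<in>{1..m}. f j) = a * (of_int m * (of_int m + 1) * (2 * of_int m + 1) / 6)
    + b * (of_int m * (of_int m + 1) / 2) + c * of_int m"
  unfolding assms(2) sum.distrib sum_distrib_left[symmetric] sum_int_powers[OF assms(1)]
  using assms(1) by (simp add: mult.commute)

text \<open>All coefficients below are at most linear in the mode index, so their products are at
  most quadratic. The second branch is the power sum with upper limit - m, rewritten in m.\<close>

lemma kappa_quadratic:
  assumes "\<And>j. p j * q (j + m) = a * (of_int j)\<^sup>2 + b * of_int j + c"
    and "\<And>j. p (j - m) * q j = a' * (of_int j)\<^sup>2 + b' * of_int j + c'"
  shows "kappa s TYPE('g::fd_complex_lie_algebra) m p q
      = sg s s * of_nat (card (lie_basis :: 'g set)) *
    (if m > 0 then - (a' * (of_int m * (of_int m + 1) * (2 * of_int m + 1) / 6)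
        + b' * (of_int m * (of_int m + 1) / 2) + c' * of_int m)
     else - (a * (of_int m * (1 - of_int m) * (1 - 2 * of_int m) / 6)
        + b * (of_int m * (1 - of_int m) / 2) + c * of_int m))"
proof (cases "m > 0")
  case True
  then show ?thesis by (simp add: kappa_def sum_int_quadratic[OF _ assms(2)])
next
  case False
  then show ?thesis
    by (simp add: kappa_def sum_int_quadratic[OF _ assms(1)])
qed

text \<open>Per dimension of the Lie algebra the bosons contribute (n^3 - n)/12 and the fermions
  (n^3 - n)/6, that is, central charges 1 and 2: the origin of the factor 3.\<close>

lemma kappa_LL:
  "kappa False TYPE('g::fd_complex_lie_algebra) (- n) (\<lambda>l. of_int l - (of_int n + 1) / 2)
      (\<lambda>l. of_int l - (of_int (- n) + 1) / 2) + kappa True TYPE('g) (- n) of_int of_int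
    = of_nat (card (lie_basis :: 'g set)) * (of_int (n ^ 3 - n) / 4)"
  \<comment> \<open>For the bosons both products of coefficients are perfect squares, (j -
    (n+1)/2)^2 and (j + (n-1)/2)^2; for the fermions they are j (j - n) and (j + n) j.\<close>
  apply (subst kappa_quadratic[where a = 1 and b = "- (of_int n + 1)" and c = "((of_int n
      + 1) / 2)\<^sup>2"
      and a' = 1 and b' = "of_int n - 1" and c' = "((of_int n - 1) / 2)\<^sup>2"])
    apply (simp add: field_simps power2_eq_square)
   apply (simp add: field_simps power2_eq_square)
  apply (subst kappa_quadratic[where a = 1 and b = "- of_int n" and c = 0
      and a' = 1 and b' = "of_int n" and c' = 0])
    apply (simp add: field_simps power2_eq_square)
   apply (simp add: field_simps power2_eq_square)
  apply (simp add: field_simps power2_eq_square power3_eq_cube)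
  done

text \<open>This cancellation determines the shift (n + 1)/2 in the bosonic part of
  \<open>L_basis n\<close>.\<close>

lemma kappa_LH:
  "kappa False TYPE('g::fd_complex_lie_algebra) (- n) (\<lambda>l. of_int l - (of_int n + 1) / 2) (\<lambda>l.
      - 1) = 0"
  apply (subst kappa_quadratic[where a = 0 and b = "- 1" and c = "(of_int n + 1) / 2"
      and a' = 0 and b' = "- 1" and c' = "(1 - of_int n) / 2"])
    apply (simp add: field_simps power2_eq_square)
   apply (simp add: field_simps power2_eq_square)
  apply (simp add: field_simps power2_eq_square)
  done

lemma kappa_HH:
  "kappa False TYPE('g::fd_complex_lie_algebra) (- n) (\<lambda>l. - 1) (\<lambda>l. - 1)
    = of_nat (card (lie_basis :: 'g set)) * of_int n"
  by (subst kappa_quadratic[where a = 0 and b = 0 and c = 1 and a' = 0 and b' = 0 and c' = 1]) auto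

text \<open>With r = k + 1/2 the factor k (k + 1) is r^2 - 1/4, and the dimension is one third of
  the central charge.\<close>

lemma kappa_GG:
  "kappa True TYPE('g::fd_complex_lie_algebra) (- k - 1) (\<lambda>l. 1) (\<lambda>l. 2 * of_int l)
    = of_nat (card (lie_basis :: 'g set)) * (of_int k * (of_int k + 1))"
  apply (subst kappa_quadratic[where a = 0 and b = 2 and c = "- 2 * (of_int k + 1)"
      and a' = 0 and b' = 2 and c' = 0])
    apply (simp add: field_simps)
   apply (simp add: field_simps)
  apply (simp add: field_simps power2_eq_square)
  done

lemma quad_combine:
  "quad s t m p w + quad s t m q w = quad s t m (\<lambda>l. p l + q l) w"
  "quad s t m p w - quad s t m q w = quad s t m (\<lambda>l. p l - q l) w"
  "- quad s t m p w = quad s t m (\<lambda>l. - p l) w"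
  "c *\<^sub>C quad s t m p w = quad s t m (\<lambda>l. c * p l) w"
  using quad_scale[of s t m "- 1" q w] quad_scale[of s t m "- 1" p w]
    quad_add[of s t m p "\<lambda>l. - q l" w]
  by (simp_all add: quad_add quad_scale)


lemma quad_cong: "(\<And>l. p l = q l) \<Longrightarrow> m = n \<Longrightarrow> quad s t m p w = quad s t n q w"
  by (metis ext)

section \<open>Relations of the N = 2 algebra\<close>

lemma quad_supercommutator:
  fixes w :: "'g::fd_complex_lie_algebra weil"
  shows "quad s t m p (quad s' t' n q w) - sg (s \<noteq> t) (s' \<noteq> t') *\<^sub>C quad s' t' n q (quad s t m p w) =
    (if s' = t then quad s t' (m + n) (\<lambda>l. q l * p (l + n)) w else 0)
    - sg (s \<noteq> t) (s' \<noteq> t') *\<^sub>C (if s = t' then quad s' t (m + n) (\<lambda>l. p l * q (l + m)) w else 0)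
    + (if s = t' \<and> t = s' \<and> m + n = 0 then kappa s TYPE('g) m p q else 0) *\<^sub>C w"
  unfolding quad_commutator[of s t m p s' t' n q w] by simp

lemma quad_commutator_even:
  fixes w :: "'g::fd_complex_lie_algebra weil"
  shows "quad s s m p (quad s s n q w) - quad s s n q (quad s s m p w) =
    quad s s (m + n) (\<lambda>l. q l * p (l + n) - p l * q (l + m)) w
    + (if m + n = 0 then kappa s TYPE('g) m p q else 0) *\<^sub>C w"
  using quad_supercommutator[of s s m p s s n q w] by (simp add: quad_combine)

lemma quad_commute_even:
  "s \<noteq> t \<Longrightarrow> quad s s m p (quad t t n q w) = quad t t n q (quad s s m p w)"
  using quad_supercommutator[of s s m p t t n q w] by simp

lemma n2_op_LL:
  fixes w :: "'g::fd_complex_lie_algebra weil"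
  shows "n2_op (L_basis n) (n2_op (L_basis m) w) - n2_op (L_basis m) (n2_op (L_basis n) w) =
    of_int (n - m) *\<^sub>C n2_op (L_basis (n + m)) w
    + (if n = - m then of_int (n ^ 3 - n) / 12 else 0) *\<^sub>C n2_op C_basis w"
proof -
  let ?p = "\<lambda>n l. of_int l - (of_int n + 1) / 2 :: complex"
  let ?A = "\<lambda>n. quad False False (- n) (?p n) :: 'g weil \<Rightarrow> _"
  let ?B = "\<lambda>n. quad True True (- n) of_int :: 'g weil \<Rightarrow> _"
  have "n2_op (L_basis n) (n2_op (L_basis m) w) - n2_op (L_basis m) (n2_op (L_basis n) w)
    = (?A n (?A m w) - ?A m (?A n w)) + (?B n (?B m w) - ?B m (?B n w))
      + (?A n (?B m w) - ?B m (?A n w)) - (?A m (?B n w) - ?B n (?A m w))"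
    by (simp add: quad_simps)
  also have "?A n (?B m w) - ?B m (?A n w) = 0" by (simp add: quad_commute_even)
  also have "?A m (?B n w) - ?B n (?A m w) = 0" by (simp add: quad_commute_even)
  also have "?A n (?A m w) - ?A m (?A n w) = of_int (n - m) *\<^sub>C ?A (n + m) w
      + (if n = - m then kappa False TYPE('g) (- n) (?p n) (?p m) else 0) *\<^sub>C w"
    unfolding quad_commutator_even quad_combine
    by (intro arg_cong2[of _ _ _ _ "(+)"] quad_cong) (simp_all add: field_simps)
  also have "?B n (?B m w) - ?B m (?B n w) = of_int (n - m) *\<^sub>C ?B (n + m) w
      + (if n = - m then kappa True TYPE('g) (- n) of_int of_int else 0) *\<^sub>C w"
    unfolding quad_commutator_even quad_combine
    by (intro arg_cong2[of _ _ _ _ "(+)"] quad_cong) (simp_all add: field_simps)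
  finally show ?thesis
    using kappa_LL[of n, where 'g = 'g]
    by (cases "m = - n") (auto simp: scaleC_add_right scaleC_scaleC simp flip: scaleC_add_left)
qed

lemma n2_op_LH:
  "n2_op (L_basis n) (n2_op (H_basis m) w) - n2_op (H_basis m) (n2_op (L_basis n) w) =
    (- of_int m) *\<^sub>C n2_op (H_basis (n + m)) w"
proof -
  have "n2_op (L_basis n) (n2_op (H_basis m) w) - n2_op (H_basis m) (n2_op (L_basis n) w)
    = (quad False False (- n) (\<lambda>l. of_int l - (of_int n + 1) / 2) (quad False False (- m) (\<lambda>l.
        - 1) w)
      - quad False False (- m) (\<lambda>l. - 1) (quad False False (- n) (\<lambda>l. of_int l - (of_int n
          + 1) / 2) w))"
    by (simp add: quad_simps quad_commute_even[of True False])
  also have "\<dots> = (- of_int m) *\<^sub>C n2_op (H_basis (n + m)) w"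
    unfolding quad_commutator_even kappa_LH n2_op.simps quad_combine(4)
    by (simp only: if_cancel scaleC_simps add_0_right, intro quad_cong) (simp_all add: field_simps)
  finally show ?thesis .
qed

lemma n2_op_HH:
  "n2_op (H_basis n) (n2_op (H_basis m) w) - n2_op (H_basis m) (n2_op (H_basis n) w) =
    (if n = - m then of_int n / 3 else 0) *\<^sub>C n2_op C_basis w"
  unfolding n2_op.simps quad_commutator_even kappa_HH
  by (auto simp: scaleC_scaleC quad_scale[of _ _ _ 0, simplified])

lemma n2_op_LGp:
  "n2_op (L_basis n) (n2_op (Gp_basis k) w) - n2_op (Gp_basis k) (n2_op (L_basis n) w) =
    (of_int n / 2 - half k) *\<^sub>C n2_op (Gp_basis (n + k)) w"
proof -
  let ?A = "quad False False (- n) (\<lambda>l. of_int l - (of_int n + 1) / 2)"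
  let ?B = "quad True True (- n) of_int"
  let ?G = "quad True False (- k - 1) (\<lambda>l. 1)"
  have "n2_op (L_basis n) (n2_op (Gp_basis k) w) - n2_op (Gp_basis k) (n2_op (L_basis n) w)
    = (?A (?G w) - ?G (?A w)) + (?B (?G w) - ?G (?B w))"
    by (simp add: quad_simps)
  also have "\<dots> = (of_int n / 2 - half k) *\<^sub>C n2_op (Gp_basis (n + k)) w"
    using quad_supercommutator[of False False "- n" "\<lambda>l. of_int l - (of_int n + 1) / 2" True False
        "- k - 1" "\<lambda>l. 1" w]
      quad_supercommutator[of True True "- n" of_int True False "- k - 1" "\<lambda>l. 1" w]
    by (simp add: quad_combine) (rule quad_cong, simp_all add: half_def field_simps)
  finally show ?thesis .
qed

lemma n2_op_LGm:
  "n2_op (L_basis n) (n2_op (Gm_basis k) w) - n2_op (Gm_basis k) (n2_op (L_basis n) w) =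
    (of_int n / 2 - half k) *\<^sub>C n2_op (Gm_basis (n + k)) w"
proof -
  let ?A = "quad False False (- n) (\<lambda>l. of_int l - (of_int n + 1) / 2)"
  let ?B = "quad True True (- n) of_int"
  let ?G = "quad False True (- k) (\<lambda>l. 2 * of_int l)"
  have "n2_op (L_basis n) (n2_op (Gm_basis k) w) - n2_op (Gm_basis k) (n2_op (L_basis n) w)
    = (?A (?G w) - ?G (?A w)) + (?B (?G w) - ?G (?B w))"
    by (simp add: quad_simps)
  also have "\<dots> = (of_int n / 2 - half k) *\<^sub>C n2_op (Gm_basis (n + k)) w"
    using quad_supercommutator[of False False "- n" "\<lambda>l. of_int l - (of_int n + 1) / 2" False True
        "- k" "\<lambda>l. 2 * of_int l" w]
      quad_supercommutator[of True True "- n" of_int False True "- k" "\<lambda>l. 2 * of_int l" w]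
    by (simp add: quad_combine) (rule quad_cong, simp_all add: half_def field_simps)
  finally show ?thesis .
qed

lemma n2_op_HGp:
  "n2_op (H_basis n) (n2_op (Gp_basis k) w) - n2_op (Gp_basis k) (n2_op (H_basis n) w) =
    n2_op (Gp_basis (n + k)) w"
  using quad_supercommutator[of False False "- n" "\<lambda>l. - 1" True False "- k - 1" "\<lambda>l. 1" w]
  by (simp add: quad_combine algebra_simps)

lemma n2_op_HGm:
  "n2_op (H_basis n) (n2_op (Gm_basis k) w) - n2_op (Gm_basis k) (n2_op (H_basis n) w) =
    - n2_op (Gm_basis (n + k)) w"
  using quad_supercommutator[of False False "- n" "\<lambda>l. - 1" False True "- k" "\<lambda>l. 2 * of_int l" w]
  by (simp add: quad_combine algebra_simps)

lemma n2_op_GpGp: "n2_op (Gp_basis k) (n2_op (Gp_basis l) w)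
    + n2_op (Gp_basis l) (n2_op (Gp_basis k) w) = 0"
  using quad_supercommutator[of True False "- k - 1" "\<lambda>l. 1" True False "- l - 1" "\<lambda>l. 1" w] by simp

lemma n2_op_GmGm: "n2_op (Gm_basis k) (n2_op (Gm_basis l) w)
    + n2_op (Gm_basis l) (n2_op (Gm_basis k) w) = 0"
  using quad_supercommutator[of False True "- k" "\<lambda>l. 2 * of_int l" False True "- l"
      "\<lambda>l. 2 * of_int l" w]
  by simp

lemma n2_op_GpGm:
  fixes w :: "'g::fd_complex_lie_algebra weil"
  shows "n2_op (Gp_basis k) (n2_op (Gm_basis l) w) + n2_op (Gm_basis l) (n2_op (Gp_basis k) w) =
    2 *\<^sub>C n2_op (L_basis (k + l + 1)) w + (half k - half l) *\<^sub>C n2_op (H_basis (k + l + 1)) w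
    + (if half k = - half l then ((half k)\<^sup>2 - 1/4) / 3 else 0) *\<^sub>C n2_op C_basis w"
proof -
  have h: "half k = - half l \<longleftrightarrow> - k - 1 + - l = 0"
  proof -
    have "half k + half l = of_int (k + l + 1)" by (simp add: half_def)
    then show ?thesis unfolding eq_neg_iff_add_eq_0 by (simp only: of_int_eq_0_iff) auto
  qed
  have "n2_op (Gp_basis k) (n2_op (Gm_basis l) w) + n2_op (Gm_basis l) (n2_op (Gp_basis k) w) =
    quad True True (- k - 1 + - l) (\<lambda>j. 2 * of_int j) w
    + quad False False (- k - 1 + - l) (\<lambda>j. 2 * of_int j + (- (2 * of_int k) - 2)) w
    + (if - k - 1 + - l = 0 then of_nat (card (lie_basis :: 'g set)) * (of_int k * (of_int k
        + 1)) else 0) *\<^sub>C w"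
    using quad_supercommutator[of True False "- k - 1" "\<lambda>l. 1" False True "- l"
        "\<lambda>l. 2 * of_int l" w]
      kappa_GG[of k, where 'g = 'g]
    by (cases "l = - k - 1") auto
  also have "quad True True (- k - 1 + - l) (\<lambda>j. 2 * of_int j) w
      = 2 *\<^sub>C quad True True (- (k + l + 1)) of_int w"
    unfolding quad_combine by (rule quad_cong) simp_all
  \<comment> \<open>The coefficient 2 j - 2 k - 2 splits as 2 (j - (k + l + 2)/2) - (k - l): a
    multiple of the bosonic part of \<open>L\<close> plus a multiple of \<open>H\<close>.\<close>
  also have "quad False False (- k - 1 + - l) (\<lambda>j. 2 * of_int j + (- (2 * of_int k) - 2)) w
      = 2 *\<^sub>C quad False False (- (k + l + 1)) (\<lambda>j. of_int j - (of_int (k + l + 1) + 1) / 2) w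
        + (half k - half l) *\<^sub>C quad False False (- (k + l + 1)) (\<lambda>j. - 1) w"
    unfolding quad_combine by (rule quad_cong) (simp_all add: half_def field_simps)
  finally show ?thesis
    unfolding h by (auto simp: scaleC_add_right scaleC_scaleC half_def field_simps power2_eq_square)
qed

lemma lin_ext_0: "lin_ext f 0 = 0"
  by (simp add: lin_ext_def)

text \<open>\<open>n2_basis_bracket\<close> lists each mixed pair in both orders, so each of these
  relations is also required with its arguments exchanged.\<close>

lemma n2_op_reversed:
  "n2_op (H_basis m) (n2_op (L_basis n) w) - n2_op (L_basis n) (n2_op (H_basis m) w) =
    of_int m *\<^sub>C n2_op (H_basis (n + m)) w"
  "n2_op (Gp_basis k) (n2_op (L_basis n) w) - n2_op (L_basis n) (n2_op (Gp_basis k) w) =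
    (half k - of_int n / 2) *\<^sub>C n2_op (Gp_basis (n + k)) w"
  "n2_op (Gm_basis k) (n2_op (L_basis n) w) - n2_op (L_basis n) (n2_op (Gm_basis k) w) =
    (half k - of_int n / 2) *\<^sub>C n2_op (Gm_basis (n + k)) w"
  "n2_op (Gp_basis k) (n2_op (H_basis n) w) - n2_op (H_basis n) (n2_op (Gp_basis k) w) =
    - n2_op (Gp_basis (n + k)) w"
  "n2_op (Gm_basis k) (n2_op (H_basis n) w) - n2_op (H_basis n) (n2_op (Gm_basis k) w) =
    n2_op (Gm_basis (n + k)) w"
  "n2_op (Gm_basis l) (n2_op (Gp_basis k) w) + n2_op (Gp_basis k) (n2_op (Gm_basis l) w) =
    2 *\<^sub>C n2_op (L_basis (k + l + 1)) w + (half k - half l) *\<^sub>C n2_op (H_basis (k + l + 1)) w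
    + (if half k = - half l then ((half k)\<^sup>2 - 1/4) / 3 else 0) *\<^sub>C n2_op C_basis w"
  using n2_op_LH[of n m w] n2_op_LGp[of n k w] n2_op_LGm[of n k w] n2_op_HGp[of n k w]
    n2_op_HGm[of n k w] n2_op_GpGm[of k l w]
  by (simp_all add: algebra_simps cvec.scale_left_diff_distrib del: n2_op.simps)

lemmas n2_op_relations = n2_op_LL n2_op_LH n2_op_HH n2_op_LGp n2_op_LGm n2_op_HGp n2_op_HGm
  n2_op_GpGp n2_op_GmGm n2_op_GpGm n2_op_reversed

lemma lin_ext_n2_term: "lin_ext f (n2_term b c) = c *\<^sub>C f b"
  by (rule lin_ext_single)

lemma n2_op_bracket:
  "lin_ext (\<lambda>c. n2_op c w) (n2_basis_bracket a b) =
    n2_op a (n2_op b w) - sg (n2_basis_odd a) (n2_basis_odd b) *\<^sub>C n2_op b (n2_op a w)"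
proof -
  have minus: "x - (- y) = x + y" for x y :: "'a weil" by simp
  have iff: "lin_ext f (if P then n2_term c r else 0) = (if P then r else 0) *\<^sub>C f c"
    for f :: "_ \<Rightarrow> 'a weil" and P c r
    by (simp add: lin_ext_n2_term lin_ext_0)
  show ?thesis
    by (cases a; cases b)
      (simp_all only: n2_basis_bracket.simps n2_basis_odd.simps sg_simps scaleC_simps minus
          lin_ext_add
        lin_ext_n2_term iff n2_op_relations lin_ext_0 n2_op.simps(5) clinear_scale[OF
            clinear_n2_op] diff_self)
qed

section \<open>From relations on the basis to a representation\<close>

lemma clinear_lin_ext_comp:
  assumes "clinear f" shows "f (lin_ext g x) = lin_ext (\<lambda>k. f (g k)) x"
  by (simp add: lin_ext_def clinear_sum'[OF assms] clinear_scale[OF assms])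

text \<open>All basis elements occurring in a homogeneous element have its parity, so one Koszul
  sign factors out of the double sum.\<close>

lemma n2_representationI:
  fixes R :: "n2_basis \<Rightarrow> 'm::complex_vector \<Rightarrow> 'm"
  assumes lin: "\<And>b. clinear (R b)"
    and sub: "\<And>q. cvec.subspace (part q)"
    and part: "\<And>b q m. m \<in> part q \<Longrightarrow> R b m \<in> part (n2_basis_odd b \<noteq> q)"
    and bracket: "\<And>a b m. lin_ext (\<lambda>c. R c m) (n2_basis_bracket a b) =
      R a (R b m) - sg (n2_basis_odd a) (n2_basis_odd b) *\<^sub>C R b (R a m)"
  shows "n2_representation part (\<lambda>x m. lin_ext (\<lambda>b. R b m) x)"
  unfolding n2_representation_def
proof (intro conjI allI ballI)
  fix x :: n2_algebra
  show "clinear (\<lambda>m. lin_ext (\<lambda>b. R b m) x)"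
    by (simp add: clinear_iff lin_ext_def clinear_simps[OF lin] scaleC_add_right sum.distrib
        cvec.scale_sum_right scaleC_scaleC mult.commute)
next
  fix m
  show "clinear (\<lambda>x. lin_ext (\<lambda>b. R b m) x)" by (rule clinear_lin_ext)
next
  fix p q m and x :: n2_algebra
  assume "x \<in> n2_part p" "m \<in> part q"
  then show "lin_ext (\<lambda>b. R b m) x \<in> part (p \<noteq> q)"
    unfolding lin_ext_def
    by (intro cvec.subspace_sum cvec.subspace_scale sub) (use part[of m q] in \<open>force simp:
        n2_part_def\<close>)
next
  fix p q m and x y :: n2_algebra
  assume x: "x \<in> n2_part p" and y: "y \<in> n2_part q"
  let ?s = "if p \<and> q then - 1 else 1 :: complex"
  let ?x = "Poly_Mapping.lookup x" and ?y = "Poly_Mapping.lookup y"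
  have "lin_ext (\<lambda>b. R b m) (n2_bracket x y)
      = (\<Sum>a\<in>Poly_Mapping.keys x. \<Sum>b\<in>Poly_Mapping.keys y.
          ?x a *\<^sub>C ?y b *\<^sub>C lin_ext (\<lambda>b. R b m) (n2_basis_bracket a b))"
    unfolding n2_bracket_def clinear_lin_ext_comp[OF clinear_lin_ext]
    by (simp add: lin_ext_def[of _ x] lin_ext_def[of _ y] cvec.scale_sum_right)
  also have "\<dots> = (\<Sum>a\<in>Poly_Mapping.keys x. \<Sum>b\<in>Poly_Mapping.keys y.
          ?x a *\<^sub>C ?y b *\<^sub>C R a (R b m) - ?s *\<^sub>C ?x a *\<^sub>C ?y b *\<^sub>C R b (R a m))"
  proof (intro sum.cong refl)
    fix a b assume "a \<in> Poly_Mapping.keys x" "b \<in> Poly_Mapping.keys y"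
    with x y have "sg (n2_basis_odd a) (n2_basis_odd b) = ?s" by (auto simp: n2_part_def sg_def)
    then show "?x a *\<^sub>C ?y b *\<^sub>C lin_ext (\<lambda>b. R b m) (n2_basis_bracket a b)
      = ?x a *\<^sub>C ?y b *\<^sub>C R a (R b m) - ?s *\<^sub>C ?x a *\<^sub>C ?y b *\<^sub>C R b (R a m)"
      unfolding bracket by (simp only: cvec.scale_right_diff_distrib scaleC_scaleC mult_ac)
  qed
  also have "\<dots> = (\<Sum>a\<in>Poly_Mapping.keys x. \<Sum>b\<in>Poly_Mapping.keys y. ?x a *\<^sub>C ?y b *\<^sub>C R a (R b m))
      - ?s *\<^sub>C (\<Sum>b\<in>Poly_Mapping.keys y. \<Sum>a\<in>Poly_Mapping.keys x. ?x a *\<^sub>C ?y b *\<^sub>C R b (R a m))"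
    unfolding sum_subtractf cvec.scale_sum_right by (subst (2) sum.swap) (rule refl)
  also have "\<dots> = lin_ext (\<lambda>b. R b (lin_ext (\<lambda>b. R b m) y)) x
      - ?s *\<^sub>C lin_ext (\<lambda>b. R b (lin_ext (\<lambda>b. R b m) x)) y"
    unfolding lin_ext_def clinear_simps[OF lin] cvec.scale_sum_right scaleC_scaleC
    by (simp only: mult.commute)
  finally show "lin_ext (\<lambda>b. R b m) (n2_bracket x y) = lin_ext (\<lambda>b. R b (lin_ext (\<lambda>b. R b m) y)) x
      - ?s *\<^sub>C lin_ext (\<lambda>b. R b (lin_ext (\<lambda>b. R b m) x)) y" .
qed

section \<open>The differential\<close>

lemma card_inversions_3:
  "card {(i, j). i < j \<and> j < (3::nat) \<and> Q i j} =
    (if Q 0 1 then 1 else 0) + (if Q 0 2 then 1 else 0) + (if Q 1 2 then 1 else 0)"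
proof -
  have "i < j \<and> j < (3::nat) \<longleftrightarrow> i = 0 \<and> j = 1 \<or> i = 0 \<and> j = 2 \<or> i = 1 \<and> j = 2" for i j
    by presburger
  then have "{(i, j). i < j \<and> j < (3::nat) \<and> Q i j} =
    (if Q 0 1 then {(0, 1)} else {}) \<union> (if Q 0 2 then {(0, 2)} else {}) \<union> (if Q 1 2 then {(1,
        2)} else {})"
    unfolding conj_assoc[symmetric] by auto
  then show ?thesis by simp
qed

lemma normal_ordered_3:
  "normal_ordered [a, b, c] w =
    (- 1) ^ ((if op_odd a \<and> op_odd b \<and> op_annihilates a \<and> \<not> op_annihilates b then 1 else 0)
      + (if op_odd a \<and> op_odd c \<and> op_annihilates a \<and> \<not> op_annihilates c then 1 else 0)
      + (if op_odd b \<and> op_odd c \<and> op_annihilates b \<and> \<not> op_annihilates c then 1 else 0)) *\<^sub>C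
    foldr op_apply (filter (\<lambda>a. \<not> op_annihilates a) [a, b, c] @ filter op_annihilates [a, b, c]) w"
proof -
  have len: "length [a, b, c] = 3" by simp
  show ?thesis
    unfolding normal_ordered_def len card_inversions_3 by (simp add: numeral_2_eq_2)
qed

definition dterm :: "bool \<Rightarrow> 'g::fd_complex_lie_algebra \<Rightarrow> 'g \<Rightarrow> int \<times> int \<Rightarrow> 'g weil \<Rightarrow> 'g weil" where
  "dterm q u v = (\<lambda>(i, j). normal_ordered
     [if q then Tau (loop_bracket (at_degree u i) (at_degree v j))
       else Beta (loop_bracket (at_degree u i) (at_degree v j)),
      if q then Eps (at_degree (dual_basis v) j) else Gamma (at_degree (dual_basis v) j),
      Eps (at_degree (dual_basis u) i)])"

lemma semi_inf_d_dterm: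
  "semi_inf_d w =
    (1/2) *\<^sub>C (\<Sum>u\<in>lie_basis. \<Sum>v\<in>lie_basis. Sum_any (\<lambda>p. dterm True u v p w))
    + (\<Sum>u\<in>lie_basis. \<Sum>v\<in>lie_basis. Sum_any (\<lambda>p. dterm False u v p w))"
  by (simp add: semi_inf_d_def dterm_def split_def)

lemma finite_dterm: "finite {p. dterm q u v p w \<noteq> 0}"
  using finite_terms[of Tau Eps u v "dual_basis v" "dual_basis u" w]
    finite_terms[of Beta Gamma u v "dual_basis v" "dual_basis u" w]
  by (cases q) (simp_all add: dterm_def split_def)

lemma clinear_dterm: "clinear (dterm q u v p)"
  by (simp add: dterm_def split_def clinear_normal_ordered)

lemma op_annihilates_at_degree:
  "op_annihilates (Tau (at_degree z n)) \<longleftrightarrow> z = 0 \<or> n > 0"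
  "op_annihilates (Beta (at_degree z n)) \<longleftrightarrow> z = 0 \<or> n > 0"
  "op_annihilates (Eps (at_degree f n)) \<longleftrightarrow> f = 0 \<or> n \<le> 0"
  "op_annihilates (Gamma (at_degree f n)) \<longleftrightarrow> f = 0 \<or> n \<le> 0"
  by (auto simp: at_degree_def V_plus_def V_dual_minus_def)

lemma op_apply_at_degree:
  "op_apply (Tau (at_degree z n)) = psi True z n"
  "op_apply (Beta (at_degree z n)) = psi False z n"
  "op_apply (Eps (at_degree f n)) = chi True f n"
  "op_apply (Gamma (at_degree f n)) = chi False f n"
  by (simp_all add: psi_def chi_def)

text \<open>Moving \<open>psi\<close> to the right past a \<open>chi\<close> leaves a contraction,
  that is, a multiple of the other \<open>chi\<close>. A boson \<open>psi\<close> does not contract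
  with \<epsilon>, hence \<open>k2 = 0\<close> unless \<open>q\<close>.\<close>

lemma dterm_product:
  "\<exists>k1 k2. (\<not> q \<longrightarrow> k2 = 0) \<and> (\<forall>w. dterm q u v (i, j) w =
     psi q (lie_bracket u v) (i + j) (chi q (dual_basis v) j (chi True (dual_basis u) i w))
     + k1 *\<^sub>C chi True (dual_basis u) i w + k2 *\<^sub>C chi q (dual_basis v) j w)"
proof -
  let ?z = "lie_bracket u v"
  \<comment> \<open>These flags are the tests made by normal ordering. A zero argument counts as an
    annihilation operator in any degree, since 0 lies in both \<open>V_plus\<close> and
    \<open>V_dual_minus\<close>.\<close>
  define a where "a \<longleftrightarrow> ?z = 0 \<or> i + j > 0"
  define b where "b \<longleftrightarrow> dual_basis v = 0 \<or> j \<le> 0"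
  define c where "c \<longleftrightarrow> dual_basis u = 0 \<or> i \<le> 0"
  define k where "k q' s f l = (if q' = s \<and> i + j = l then sg s s * dual_apply f ?z else 0)"
      for q' s f l
  have swap: "chi s f l (psi q ?z (i + j) w) = sg s q *\<^sub>C (psi q ?z (i + j) (chi s f l w)
      + k q s f l *\<^sub>C w)" for s f l w
    unfolding psi_chi k_def by (simp add: sg_commute[of s q] cvec.scale_right_diff_distrib)
  have swap': "chi q (dual_basis v) j (chi True (dual_basis u) i w)
      = sg q True *\<^sub>C chi True (dual_basis u) i (chi q (dual_basis v) j w)" for w
    by (rule chi_chi)
  let ?k1 = "if a \<and> \<not> b then k q q (dual_basis v) j else 0"
  let ?k2 = "if a \<and> \<not> c then sg q True * k q True (dual_basis u) i else 0"
  have "dterm q u v (i, j) w =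
     psi q ?z (i + j) (chi q (dual_basis v) j (chi True (dual_basis u) i w))
     + ?k1 *\<^sub>C chi True (dual_basis u) i w + ?k2 *\<^sub>C chi q (dual_basis v) j w" for w
    unfolding dterm_def prod.case normal_ordered_3 loop_bracket_at_degree
    using swap chi_chi[of True "dual_basis u" i q "dual_basis v" j]
    by (cases q; cases a; cases b; cases c)
      (simp_all add: op_annihilates_at_degree op_apply_at_degree chi_simps psi_simps
        flip: a_def b_def c_def del: op_apply.simps op_annihilates.simps)
  moreover have "\<not> q \<longrightarrow> ?k2 = 0" by (auto simp: k_def)
  ultimately show ?thesis by blast
qed


text \<open>This is \<open>[[T, g], h]\<close> for \<open>T\<close> odd and \<open>g\<close>, \<open>h\<close> of parities \<open>r\<close>, \<open>s\<close>. It annihilates the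
  corrections to \<open>d\<close> coming from normal ordering, which are linear in the generators.\<close>

definition double_comm ::
  "('w \<Rightarrow> 'w::complex_vector) \<Rightarrow> bool \<Rightarrow> ('w \<Rightarrow> 'w) \<Rightarrow> bool \<Rightarrow> ('w \<Rightarrow> 'w) \<Rightarrow> 'w \<Rightarrow> 'w" where
  "double_comm T r g s h w = T (g (h w)) - sg True r *\<^sub>C g (T (h w))
     - sg (\<not> r) s *\<^sub>C h (T (g w)) + (sg (\<not> r) s * sg True r) *\<^sub>C h (g (T w))"

text \<open>By the super Jacobi identity the two sides differ by the commutator of T with the scalar
  [g, h], which is 0. For generators of different parity that scalar must vanish.\<close>

lemma double_comm_symmetric:
  assumes "clinear T" "clinear g" "clinear h" "\<And>w. g (h w) = sg r s *\<^sub>C h (g w) + c *\<^sub>C w"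
      "r \<noteq> s \<Longrightarrow> c = 0"
  shows "double_comm T r g s h w = sg r s *\<^sub>C double_comm T s h r g w"
  unfolding double_comm_def assms(4)
  using assms(5)
  by (cases r; cases s) (simp_all add: clinear_simps[OF assms(1)] algebra_simps scaleC_add_right
      cvec.scale_right_diff_distrib)

lemma double_comm_sum:
  assumes "clinear g" "clinear h"
  shows "double_comm (\<lambda>w. \<Sum>u\<in>A. T u w) r g s h w = (\<Sum>u\<in>A. double_comm (T u) r g s h w)"
  by (simp add: double_comm_def clinear_simps[OF assms(1)] clinear_simps[OF assms(2)] sum.distrib
      sum_subtractf cvec.scale_sum_right)

lemma double_comm_add:
  assumes "clinear g" "clinear h"
  shows "double_comm (\<lambda>w. T w + T' w) r g s h w = double_comm T r g s h w
      + double_comm T' r g s h w"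
  by (simp add: double_comm_def clinear_simps[OF assms(1)] clinear_simps[OF assms(2)]
      scaleC_add_right)

lemma double_comm_scale:
  assumes "clinear g" "clinear h"
  shows "double_comm (\<lambda>w. c *\<^sub>C T w) r g s h w = c *\<^sub>C double_comm T r g s h w"
  by (simp add: double_comm_def clinear_simps[OF assms(1)] clinear_simps[OF assms(2)] scaleC_scaleC
      scaleC_add_right cvec.scale_right_diff_distrib mult_ac)

lemma Sum_any_clinear:
  assumes "clinear g" "finite {p. f p \<noteq> 0}"
  shows "Sum_any (\<lambda>p. g (f p)) = g (Sum_any f)" "finite {p. g (f p) \<noteq> 0}"
proof -
  have "{p. g (f p) \<noteq> 0} \<subseteq> {p. f p \<noteq> 0}" by (auto simp: clinear_0[OF assms(1)])
  then show "Sum_any (\<lambda>p. g (f p)) = g (Sum_any f)" "finite {p. g (f p) \<noteq> 0}"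
    using assms(2) by (auto simp: Sum_any.expand_superset[of
        "{p. f p \<noteq> 0}"] clinear_sum'[OF assms(1)]
        intro: finite_subset)
qed

lemma finite_nonzero_add:
  "finite {p. f p \<noteq> 0} \<Longrightarrow> finite {p. g p \<noteq> 0} \<Longrightarrow> finite {p. f p + g p \<noteq> (0 :: 'a::complex_vector)}"
  by (rule finite_subset[of _ "{p. f p \<noteq> 0} \<union> {p. g p \<noteq> 0}"]) auto

lemma double_comm_Sum_any:
  assumes "clinear g" "clinear h" "\<And>p. clinear (T p)" "\<And>w. finite {p. T p w \<noteq> 0}"
  shows "double_comm (\<lambda>w. Sum_any (\<lambda>p. T p w)) r g s h w
      = Sum_any (\<lambda>p. double_comm (T p) r g s h w)"
proof -
  let ?a = "- sg True r" and ?b = "- sg (\<not> r) s" and ?c = "sg (\<not> r) s * sg True r"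
  have comp: "clinear (\<lambda>w. c *\<^sub>C g w)" "clinear (\<lambda>w. c *\<^sub>C h w)" "clinear (\<lambda>w. c *\<^sub>C h (g w))" for c
    by (simp_all add: clinear_iff clinear_simps[OF assms(1)] clinear_simps[OF assms(2)]
        scaleC_add_right scaleC_scaleC mult.commute)
  note 1 = Sum_any_clinear[OF comp(1)[of ?a] assms(4)[of "h w"]]
  note 2 = Sum_any_clinear[OF comp(2)[of ?b] assms(4)[of "g w"]]
  note 3 = Sum_any_clinear[OF comp(3)[of ?c] assms(4)[of w]]
  have "Sum_any (\<lambda>p. double_comm (T p) r g s h w) =
    Sum_any (\<lambda>p. (T p (g (h w)) + ?a *\<^sub>C g (T p (h w)))
      + (?b *\<^sub>C h (T p (g w)) + ?c *\<^sub>C h (g (T p w))))"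
    by (simp add: double_comm_def algebra_simps)
  also have "\<dots> = (Sum_any (\<lambda>p. T p (g (h w))) + ?a *\<^sub>C g (Sum_any (\<lambda>p. T p (h w))))
      + (?b *\<^sub>C h (Sum_any (\<lambda>p. T p (g w))) + ?c *\<^sub>C h (g (Sum_any (\<lambda>p. T p w))))"
    using 1 2 3 assms(4) by (simp only: Sum_any.distrib finite_nonzero_add)
  finally show ?thesis by (simp add: double_comm_def algebra_simps)
qed

lemma double_comm_dterm:
  assumes g: "g = psi r x k \<or> g = chi r f k" and h: "h = psi s y l \<or> h = chi s f' l"
  shows "double_comm (dterm q u v (i, j)) r g s h w =
    double_comm (\<lambda>w. psi q (lie_bracket u v) (i + j)
      (chi q (dual_basis v) j (chi True (dual_basis u) i w))) r g s h w"
proof -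
  obtain k1 k2 where k2: "\<not> q \<longrightarrow> k2 = 0" and T: "\<And>w. dterm q u v (i, j) w =
     psi q (lie_bracket u v) (i + j) (chi q (dual_basis v) j (chi True (dual_basis u) i w))
     + k1 *\<^sub>C chi True (dual_basis u) i w + k2 *\<^sub>C chi q (dual_basis v) j w"
    using dterm_product[of q u v i j] by blast
  have lin: "clinear g" "clinear h" using g h clinear_psi clinear_chi by auto
  have 0: "double_comm (chi True f n) r g s h w = 0" for f n w
    using g h unfolding double_comm_def
    by (cases r; cases s; auto simp: chi_psi chi_chi[of True f n] psi_simps chi_simps)
  have "dterm q u v (i, j) = (\<lambda>w. (psi q (lie_bracket u v) (i + j)
       (chi q (dual_basis v) j (chi True (dual_basis u) i w)) + k1 *\<^sub>C chi True (dual_basis u) i w)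
       + k2 *\<^sub>C chi q (dual_basis v) j w)"
    using T by blast
  then show ?thesis
    using k2 by (cases q) (simp_all add: double_comm_add[OF lin] double_comm_scale[OF lin] 0
      double_comm_scale[OF lin, of 0, simplified])
qed

section \<open>Double commutators of the differential with generators\<close>

definition delta :: "'g::fd_complex_lie_algebra \<Rightarrow> 'g \<Rightarrow> int \<Rightarrow> int \<Rightarrow> complex" where
  "delta u x i k = (if i = k then dual_apply (dual_basis u) x else 0)"

lemma chi_psi_delta: "chi t (dual_basis u) i (psi r x k w) = sg t r
    *\<^sub>C psi r x k (chi t (dual_basis u) i w)
    + (if t = r then delta u x i k else 0) *\<^sub>C w"
  by (simp add: chi_psi delta_def)

text \<open>Both \<open>chi\<close> factors are contracted and \<open>psi\<close> of the bracket
  remains. For \<open>q\<close> either \<epsilon> may meet either \<tau>, whence the antisymmetrized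
  coefficient.\<close>

lemma double_comm_dterm_psi_psi:
  "double_comm (dterm q u v (i, j)) r (psi r x k) s (psi s y l) w =
    (if q \<and> r \<and> s then delta u x i k * delta v y j l - delta v x j k * delta u y i l
     else if \<not> q \<and> r \<and> \<not> s then delta u x i k * delta v y j l
     else if \<not> q \<and> \<not> r \<and> s then delta v x j k * delta u y i l else 0)
    *\<^sub>C psi q (lie_bracket u v) (i + j) w"
proof -
  let ?z = "lie_bracket u v"
  have 1: "psi q ?z n (psi r x k w) = sg q r *\<^sub>C psi r x k (psi q ?z n w)"
    "psi q ?z n (psi s y l w) = sg q s *\<^sub>C psi s y l (psi q ?z n w)"
    "psi s y l (psi r x k w) = sg s r *\<^sub>C psi r x k (psi s y l w)" for n w
    by (rule psi_psi)+
  show ?thesis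
    unfolding double_comm_dterm[of "psi r x k" r x k _
        "psi s y l" s y l, OF disjI1[OF refl] disjI1[OF refl]]
    unfolding double_comm_def using 1
    by (cases q; cases r; cases s)
      (simp_all add: chi_psi_delta psi_simps chi_simps scaleC_add_left cvec.scale_left_diff_distrib
        scaleC_scaleC scaleC_add_right cvec.scale_right_diff_distrib mult.commute)
qed

lemma double_comm_dterm_psi_chi:
  "double_comm (dterm q u v (i, j)) r (psi r x k) s (chi s f l) w =
    - (if i + j = l then dual_apply f (lie_bracket u v) else 0) *\<^sub>C
    (if q \<and> r \<and> s then delta u x i k *\<^sub>C chi True (dual_basis v) j w - delta v x j k
        *\<^sub>C chi True (dual_basis u) i w
     else if \<not> q \<and> r \<and> \<not> s then delta u x i k *\<^sub>C chi False (dual_basis v) j w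
     else if \<not> q \<and> \<not> r \<and> \<not> s then delta v x j k *\<^sub>C chi True (dual_basis u) i w else 0)"
proof -
  let ?z = "lie_bracket u v"
  have 1: "psi q ?z n (psi r x k w) = sg q r *\<^sub>C psi r x k (psi q ?z n w)"
    "chi q (dual_basis v) j (chi s f l w) = sg q s *\<^sub>C chi s f l (chi q (dual_basis v) j w)"
    "chi True (dual_basis u) i (chi s f l w) = sg True s *\<^sub>C chi s f l (chi True (dual_basis u) i w)"
    "psi q ?z n (chi s f l w) = sg q s *\<^sub>C chi s f l (psi q ?z n w)
     - (if q = s \<and> n = l then sg q q * dual_apply f ?z else 0) *\<^sub>C w"
    "psi r x k (chi s f l w) = sg r s *\<^sub>C chi s f l (psi r x k w)
     - (if r = s \<and> k = l then sg r r * dual_apply f x else 0) *\<^sub>C w" for n w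
    by (rule psi_psi chi_chi psi_chi)+
  show ?thesis
    unfolding double_comm_dterm[of "psi r x k" r x k _
        "chi s f l" s _ l f, OF disjI1[OF refl] disjI2[OF refl]]
    unfolding double_comm_def using 1
    by (cases q; cases r; cases s; cases "i + j = l"; cases "k = l")
      (simp_all add: chi_psi_delta psi_simps chi_simps scaleC_add_left cvec.scale_left_diff_distrib
        scaleC_scaleC scaleC_add_right cvec.scale_right_diff_distrib mult.commute)
qed

text \<open>Two \<open>chi\<close> would have to be contracted with two factors \<open>psi\<close>,
  but the product contains only one.\<close>

lemma double_comm_dterm_chi_chi:
  "double_comm (dterm q u v (i, j)) r (chi r f' k) s (chi s f l) w = 0"
proof -
  let ?z = "lie_bracket u v"
  have 1: "chi q (dual_basis v) j (chi s f l w) = sg q s *\<^sub>C chi s f l (chi q (dual_basis v) j w)"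
    "chi True (dual_basis u) i (chi s f l w) = sg True s *\<^sub>C chi s f l (chi True (dual_basis u) i w)"
    "chi q (dual_basis v) j (chi r f' k w) = sg q r *\<^sub>C chi r f' k (chi q (dual_basis v) j w)"
    "chi True (dual_basis u) i (chi r f' k w) = sg True r
        *\<^sub>C chi r f' k (chi True (dual_basis u) i w)"
    "psi q ?z n (chi s f l w) = sg q s *\<^sub>C chi s f l (psi q ?z n w)
     - (if q = s \<and> n = l then sg q q * dual_apply f ?z else 0) *\<^sub>C w"
    "psi q ?z n (chi r f' k w) = sg q r *\<^sub>C chi r f' k (psi q ?z n w)
     - (if q = r \<and> n = k then sg q q * dual_apply f' ?z else 0) *\<^sub>C w"
    "chi s f l (chi r f' k w) = sg s r *\<^sub>C chi r f' k (chi s f l w)" for n w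
    by (rule chi_chi psi_chi)+
  show ?thesis
    unfolding double_comm_dterm[of "chi r f' k" r _ k f'
        "chi s f l" s _ l f, OF disjI2[OF refl] disjI2[OF refl]]
    unfolding double_comm_def using 1
    by (cases q; cases r; cases s; cases "i + j = l"; cases "i + j = k")
      (simp_all add: psi_simps chi_simps)
qed

lemma Sum_any_point:
  assumes "\<And>p. p \<noteq> a \<Longrightarrow> f p = (0 :: 'b::comm_monoid_add)"
  shows "Sum_any f = f a" "finite {p. f p \<noteq> 0}"
proof -
  have "{p. f p \<noteq> 0} \<subseteq> {a}" using assms by auto
  then show "Sum_any f = f a" "finite {p. f p \<noteq> 0}"
    by (auto simp: Sum_any.expand_superset[of "{a}"] intro: finite_subset)
qed

lemma Sum_any_points:
  assumes "\<And>p. p \<noteq> a \<Longrightarrow> f p = 0" "\<And>p. p \<noteq> b \<Longrightarrow> g p = (0 :: 'b::complex_vector)"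
  shows "Sum_any (\<lambda>p. f p - g p) = f a - g b"
proof -
  have "Sum_any (\<lambda>p. f p + - g p) = Sum_any f + Sum_any (\<lambda>p. - g p)"
    by (rule Sum_any.distrib) (rule Sum_any_point(2)[of a] Sum_any_point(2)[of b]; simp add: assms)+
  also have "Sum_any f = f a" by (rule Sum_any_point(1)) (simp add: assms)
  also have "Sum_any (\<lambda>p. - g p) = - g b" by (rule Sum_any_point(1)) (simp add: assms)
  finally show ?thesis by simp
qed

lemma clinear_lie_bracket: "clinear (lie_bracket x)" "clinear (\<lambda>x. lie_bracket x y)"
  by (simp_all add: clinear_iff lie_bracket_add_left lie_bracket_add_right lie_bracket_scale_left
      lie_bracket_scale_right)

lemma lie_bracket_swap: "lie_bracket y x = - lie_bracket x y"
proof -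
  have "lie_bracket (x + y) (x + y) = 0" by (rule lie_bracket_self)
  then have "lie_bracket x y + lie_bracket y x = 0"
    unfolding lie_bracket_add_left lie_bracket_add_right by (simp add: lie_bracket_self add.commute)
  then show ?thesis by (metis eq_neg_iff_add_eq_0 add.commute)
qed

lemma bracket_expansion:
  assumes "clinear F"
  shows "(\<Sum>u\<in>lie_basis. \<Sum>v\<in>lie_basis. (dual_apply (dual_basis u) x * dual_apply (dual_basis v) y)
    *\<^sub>C F (lie_bracket u v)) = F (lie_bracket x y)"
proof -
  have "F (lie_bracket x y) = F (lie_bracket (\<Sum>u\<in>lie_basis. dual_apply (dual_basis u) x *\<^sub>C u)
      (\<Sum>v\<in>lie_basis. dual_apply (dual_basis v) y *\<^sub>C v))"
    by (simp add: basis_expansion)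
  then show ?thesis
    by (subst sum.swap) (simp add: clinear_simps[OF clinear_lie_bracket(1)]
        clinear_simps[OF clinear_lie_bracket(2)] clinear_simps[OF assms] cvec.scale_sum_right
        scaleC_scaleC mult.commute)
qed

text \<open>The coadjoint action up to the customary minus sign, which appears explicitly in the
  formulas instead.\<close>

definition coad :: "'g::fd_complex_lie_algebra dual \<Rightarrow> 'g \<Rightarrow> 'g dual" where
  "coad f x = Abs_dual (\<lambda>y. dual_apply f (lie_bracket x y))"

lemma coad_apply: "dual_apply (coad f x) y = dual_apply f (lie_bracket x y)"
proof -
  have "clinear (\<lambda>y. dual_apply f (lie_bracket x y))"
    by (simp add: clinear_iff lie_bracket_add_right lie_bracket_scale_right dual_apply_simps)
  then show ?thesis by (simp add: coad_def Abs_dual_inverse)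
qed

lemma coad_expansion:
  "(\<Sum>u\<in>lie_basis. \<Sum>v\<in>lie_basis. (dual_apply f (lie_bracket u v) * dual_apply (dual_basis u) x)
    *\<^sub>C chi s (dual_basis v) n w) = chi s (coad f x) n w"
  "(\<Sum>u\<in>lie_basis. \<Sum>v\<in>lie_basis. (dual_apply f (lie_bracket u v) * dual_apply (dual_basis v) x)
    *\<^sub>C chi s (dual_basis u) n w) = - chi s (coad f x) n w"
proof -
  have *: "(\<Sum>u\<in>lie_basis. dual_apply f (lie_bracket u v) * dual_apply (dual_basis u) x)
      = dual_apply (coad f x) v" for v
  proof -
    have "dual_apply (coad f x) v = dual_apply f (lie_bracket (\<Sum>u\<in>lie_basis. dual_apply
        (dual_basis u) x *\<^sub>C u) v)"
      by (simp add: basis_expansion coad_apply)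
    then show ?thesis
      by (simp add: clinear_simps[OF clinear_lie_bracket(2)] dual_apply_simps scaleC_complex_def
          mult.commute)
  qed
  show 1: "(\<Sum>u\<in>lie_basis. \<Sum>v\<in>lie_basis. (dual_apply f (lie_bracket u v) * dual_apply (dual_basis
      u) x)
    *\<^sub>C chi s (dual_basis v) n w) = chi s (coad f x) n w"
    by (subst sum.swap) (simp add: * chi_expansion flip: cvec.scale_sum_left)
  have "(\<Sum>u\<in>lie_basis. \<Sum>v\<in>lie_basis. (dual_apply f (lie_bracket u v) * dual_apply (dual_basis v) x)
    *\<^sub>C chi s (dual_basis u) n w) = - (\<Sum>v\<in>lie_basis. \<Sum>u\<in>lie_basis. (dual_apply f (lie_bracket v u)
        * dual_apply (dual_basis v) x)
    *\<^sub>C chi s (dual_basis u) n w)"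
    by (subst sum.swap, subst lie_bracket_swap) (simp add: dual_apply_simps sum_negf)
  then show "(\<Sum>u\<in>lie_basis. \<Sum>v\<in>lie_basis. (dual_apply f (lie_bracket u v) * dual_apply (dual_basis
      v) x)
    *\<^sub>C chi s (dual_basis u) n w) = - chi s (coad f x) n w"
    by (simp only: 1)
qed

lemma double_comm_d:
  assumes "clinear g" "clinear h"
  shows "double_comm semi_inf_d r g s h w =
    (1/2) *\<^sub>C (\<Sum>u\<in>lie_basis. \<Sum>v\<in>lie_basis. Sum_any (\<lambda>p. double_comm (dterm True u v p) r g s h w))
    + (\<Sum>u\<in>lie_basis. \<Sum>v\<in>lie_basis. Sum_any (\<lambda>p. double_comm (dterm False u v p) r g s h w))"
proof -
  have *: "semi_inf_d = (\<lambda>w. (1/2) *\<^sub>C (\<Sum>u\<in>lie_basis. \<Sum>v\<in>lie_basis. Sum_any (\<lambda>p. dterm True u v p w))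
    + (\<Sum>u\<in>lie_basis. \<Sum>v\<in>lie_basis. Sum_any (\<lambda>p. dterm False u v p w)))"
    by (rule ext) (rule semi_inf_d_dterm)
  show ?thesis
    unfolding * double_comm_add[OF assms] double_comm_scale[OF assms] double_comm_sum[OF assms]
      double_comm_Sum_any[OF assms clinear_dterm finite_dterm] ..
qed

lemma scaleC_half_double: "(1/2) *\<^sub>C (a + a) = (a :: 'a::complex_vector)"
  by (simp flip: scaleC_add_left scaleC_add_right add: scaleC_add_right)

text \<open>For odd r this is Cartan's formula: the anticommutator of d with \<tau>(x) acts on
  \<open>psi\<close> by the adjoint action of x. The antisymmetrization over the two \<epsilon>
  gives a factor 2, which cancels the 1/2 in d.\<close>

lemma d_psi_psi:
  "double_comm semi_inf_d r (psi r x k) s (psi s y l) w =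
    (if r then psi s (lie_bracket x y) (k + l) w
     else if s then psi r (lie_bracket y x) (k + l) w else 0)"
proof -
  have pt: "Sum_any (\<lambda>p. (delta u x (fst p) k * delta v y (snd p) l)
      *\<^sub>C psi q (lie_bracket u v) (fst p + snd p) w)
      = (dual_apply (dual_basis u) x * dual_apply (dual_basis v) y) *\<^sub>C psi q (lie_bracket u v) (k
          + l) w" for u v x k y l q
    by (subst Sum_any_point(1)[of "(k, l)"]) (auto simp: delta_def prod_eq_iff)
  have pt': "Sum_any (\<lambda>p. (delta u x (fst p) k * delta v y (snd p) l
      - delta v x (snd p) k * delta u y (fst p) l)
        *\<^sub>C psi q (lie_bracket u v) (fst p + snd p) w)
      = (dual_apply (dual_basis u) x * dual_apply (dual_basis v) y) *\<^sub>C psi q (lie_bracket u v) (k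
          + l) w
        - (dual_apply (dual_basis u) y * dual_apply (dual_basis v) x)
            *\<^sub>C psi q (lie_bracket u v) (k + l) w" for u v q
    unfolding cvec.scale_left_diff_distrib
    by (subst Sum_any_points[of "(k, l)" _ "(l, k)"])
      (auto simp: delta_def prod_eq_iff add.commute mult.commute)
  have dc: "double_comm (dterm q u v p) r (psi r x k) s (psi s y l) w =
    (if q \<and> r \<and> s then delta u x (fst p) k * delta v y (snd p) l
        - delta v x (snd p) k * delta u y (fst p) l
     else if \<not> q \<and> r \<and> \<not> s then delta u x (fst p) k * delta v y (snd p) l
     else if \<not> q \<and> \<not> r \<and> s then delta u y (fst p) l * delta v x (snd p) k else 0)
    *\<^sub>C psi q (lie_bracket u v) (fst p + snd p) w" for q u v p
    using double_comm_dterm_psi_psi[of q u v "fst p" "snd p" r x k s y l w]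
        by (simp add: mult.commute)
  have ex: "(\<Sum>u\<in>lie_basis. \<Sum>v\<in>lie_basis. (dual_apply (dual_basis u) x * dual_apply (dual_basis v) y)
    *\<^sub>C psi q (lie_bracket u v) n w) = psi q (lie_bracket x y) n w" for q n x y
    by (rule bracket_expansion[OF psi_clinear])
  show ?thesis
    unfolding double_comm_d[OF clinear_psi clinear_psi] dc
    by (cases r; cases s)
      (simp_all add: pt pt' ex sum_subtractf lie_bracket_swap[of y x] psi_arg_simps add.commute[of
          l k]
        scaleC_half_double)
qed

text \<open>For odd r this is the coadjoint half of Cartan's formula. For even r, \<gamma> is turned
  into \<epsilon>, since only the \<beta>\<gamma>\<epsilon> term of d contributes.\<close>

lemma d_psi_chi:
  "double_comm semi_inf_d r (psi r x k) s (chi s f l) w =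
    (if r then - chi s (coad f x) (l - k) w
     else if \<not> s then chi True (coad f x) (l - k) w else 0)"
proof -
  have pt1: "Sum_any (\<lambda>p. (- (if fst p + snd p = l then dual_apply f (lie_bracket u v) else 0) *
      delta u x (fst p) k)
       *\<^sub>C chi q (dual_basis v) (snd p) w)
      = - ((dual_apply f (lie_bracket u v) * dual_apply (dual_basis u) x)
          *\<^sub>C chi q (dual_basis v) (l - k) w)" for u v q
    by (subst Sum_any_point(1)[of "(k, l - k)"]) (auto simp: delta_def prod_eq_iff)
  have pt2: "Sum_any (\<lambda>p. (- (if fst p + snd p = l then dual_apply f (lie_bracket u v) else 0) *
      delta v x (snd p) k)
       *\<^sub>C chi q (dual_basis u) (fst p) w)
      = - ((dual_apply f (lie_bracket u v) * dual_apply (dual_basis v) x)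
          *\<^sub>C chi q (dual_basis u) (l - k) w)" for u v q
    by (subst Sum_any_point(1)[of "(l - k, k)"]) (auto simp: delta_def prod_eq_iff)
  have pt': "Sum_any (\<lambda>p. (- (if fst p + snd p = l then dual_apply f (lie_bracket u v) else 0) *
      delta u x (fst p) k)
       *\<^sub>C chi q (dual_basis v) (snd p) w
       - (- (if fst p + snd p = l then dual_apply f (lie_bracket u v) else 0) * delta v x (snd p) k)
       *\<^sub>C chi q (dual_basis u) (fst p) w)
      = - ((dual_apply f (lie_bracket u v) * dual_apply (dual_basis u) x)
          *\<^sub>C chi q (dual_basis v) (l - k) w)
       + (dual_apply f (lie_bracket u v) * dual_apply (dual_basis v) x) *\<^sub>C chi q (dual_basis u) (l
           - k) w" for u v q
    by (subst Sum_any_points[of "(k, l - k)" _ "(l - k, k)"]) (auto simp: delta_def prod_eq_iff)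
  have dc: "double_comm (dterm q u v p) r (psi r x k) s (chi s f l) w =
    (if q \<and> r \<and> s then (- (if fst p + snd p = l then dual_apply f (lie_bracket u v) else 0) *
        delta u x (fst p) k)
         *\<^sub>C chi True (dual_basis v) (snd p) w
       - (- (if fst p + snd p = l then dual_apply f (lie_bracket u v) else 0) * delta v x (snd p) k)
         *\<^sub>C chi True (dual_basis u) (fst p) w
     else if \<not> q \<and> r \<and> \<not> s then (- (if fst p + snd p = l then dual_apply f (lie_bracket u v) else
         0) * delta u x (fst p) k)
         *\<^sub>C chi False (dual_basis v) (snd p) w
     else if \<not> q \<and> \<not> r \<and> \<not> s then (- (if fst p + snd p
         = l then dual_apply f (lie_bracket u v) else 0) * delta v x (snd p) k)
         *\<^sub>C chi True (dual_basis u) (fst p) w else 0)" for q u v p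
    using double_comm_dterm_psi_chi[of q u v "fst p" "snd p" r x k s f l w]
    by (cases q; cases r; cases s; cases "fst p + snd p = l")
      (simp_all add: cvec.scale_right_diff_distrib scaleC_scaleC)
  show ?thesis
    unfolding double_comm_d[OF clinear_psi clinear_chi] dc
    by (cases r; cases s; simp only: simp_thms if_True if_False pt1 pt2 pt' scaleC_simps)
      (simp_all add: sum.distrib sum_subtractf sum_negf coad_expansion
        scaleC_half_double[of "- _", simplified])
qed

lemma d_chi_chi: "double_comm semi_inf_d r (chi r f k) s (chi s f' l) w = 0"
proof -
  have "double_comm (dterm q u v p) r (chi r f k) s (chi s f' l) w = 0" for q u v p
    using double_comm_dterm_chi_chi[of q u v "fst p" "snd p" r f k s f' l w] by simp
  then show ?thesis
    unfolding double_comm_d[OF clinear_chi clinear_chi] by simp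
qed

lemma d_chi_psi:
  "double_comm semi_inf_d r (chi r f l) s (psi s x k) w =
    (if s then - sg r s *\<^sub>C chi r (coad f x) (l - k) w
     else if \<not> r then chi True (coad f x) (l - k) w else 0)"
proof -
  have "double_comm semi_inf_d r (chi r f l) s (psi s x k) w =
      sg r s *\<^sub>C double_comm semi_inf_d s (psi s x k) r (chi r f l) w"
    by (rule double_comm_symmetric[OF clinear_semi_inf_d clinear_chi clinear_psi chi_psi]) auto
  then show ?thesis by (cases s; cases r) (simp_all add: d_psi_chi)
qed

text \<open>One of i \<le> 0, j \<le> 0, i + j > 0 always holds, so each normally ordered term
  contains an annihilation operator.\<close>

lemma d_vacuum: "semi_inf_d vacuum = 0"
proof -
  have "dterm q u v (i, j) vacuum = 0" for q and u v :: 'a and i j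
  proof -
    consider "i \<le> 0" | "j \<le> 0" | "i + j > 0" by linarith
    then show ?thesis
    proof cases
      case 1
      then show ?thesis unfolding dterm_def prod.case
        by (intro normal_ordered_0[of "Eps (at_degree (dual_basis u) i)"])
          (auto simp: op_annihilates_at_degree op_apply_at_degree chi_vacuum
            simp del: op_apply.simps op_annihilates.simps)
    next
      case 2
      then show ?thesis unfolding dterm_def prod.case
        by (intro normal_ordered_0[of "if q then Eps (at_degree (dual_basis v) j) else Gamma
            (at_degree (dual_basis v) j)"])
          (auto simp: op_annihilates_at_degree op_apply_at_degree chi_vacuum
            simp del: op_apply.simps op_annihilates.simps)
    next
      case 3
      then show ?thesis unfolding dterm_def prod.case loop_bracket_at_degree
        by (intro normal_ordered_0[of "if q then Tau (at_degree (lie_bracket u v) (i + j))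
            else Beta (at_degree (lie_bracket u v) (i + j))"])
          (auto simp: op_annihilates_at_degree op_apply_at_degree psi_vacuum
            simp del: op_apply.simps op_annihilates.simps)
    qed
  qed
  then have "dterm q u v p vacuum = 0" for q and u v :: 'a and p by (cases p) simp
  then show ?thesis by (simp add: semi_inf_d_dterm)
qed

text \<open>Three nonzero factors cannot all be annihilation operators, as i \<le> 0 and j \<le> 0
  exclude i + j > 0. So each normally ordered term begins with a creation operator.\<close>

lemma (in vev) phi_d: "\<phi> (semi_inf_d w) = 0"
proof -
  have "\<phi> (dterm q u v (i, j) w) = 0" for q u v i j w
  proof -
    let ?z = "lie_bracket u v"
    \<comment> \<open>A zero factor counts as an annihilation operator, so the count of annihilators
      applies only to nonzero factors; with a zero factor the term itself vanishes.\<close>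
    consider "?z = 0" | "dual_basis u = 0" | "dual_basis v = 0" | "?z \<noteq> 0" "dual_basis u \<noteq> 0"
        "dual_basis v \<noteq> 0"
      by blast
    then show ?thesis
    proof cases
      case 1
      have "dterm q u v (i, j) w = 0" unfolding dterm_def prod.case loop_bracket_at_degree
        by (intro normal_ordered_0[of "if q then Tau (at_degree ?z (i
            + j)) else Beta (at_degree ?z (i + j))"])
          (auto simp: op_annihilates_at_degree op_apply_at_degree psi_arg_simps 1
            simp del: op_apply.simps op_annihilates.simps)
      then show ?thesis by (simp add: phi_simps)
    next
      case 2
      have "dterm q u v (i, j) w = 0" unfolding dterm_def prod.case loop_bracket_at_degree
        by (intro normal_ordered_0[of "Eps (at_degree (dual_basis u) i)"])
          (auto simp: op_annihilates_at_degree op_apply_at_degree chi_arg_simps 2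
            simp del: op_apply.simps op_annihilates.simps)
      then show ?thesis by (simp add: phi_simps)
    next
      case 3
      have "dterm q u v (i, j) w = 0" unfolding dterm_def prod.case loop_bracket_at_degree
        by (intro normal_ordered_0[of "if q then Eps (at_degree (dual_basis v) j) else Gamma
            (at_degree (dual_basis v) j)"])
          (auto simp: op_annihilates_at_degree op_apply_at_degree chi_arg_simps 3
            simp del: op_apply.simps op_annihilates.simps)
      then show ?thesis by (simp add: phi_simps)
    next
      case 4
      have "i + j > 0 \<Longrightarrow> \<not> (i \<le> 0 \<and> j \<le> 0)" by simp
      with 4 show ?thesis
        unfolding dterm_def prod.case normal_ordered_3 loop_bracket_at_degree phi_simps
        by (cases q; cases "i + j > 0"; cases "j > 0"; cases "i > 0")
          (simp_all add: op_annihilates_at_degree op_apply_at_degree phi_psi phi_chi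
            del: op_apply.simps op_annihilates.simps)
    qed
  qed
  then have *: "\<phi> (dterm q u v p w) = 0" for q u v p w by (cases p) simp
  have "\<phi> (Sum_any (\<lambda>p. dterm q u v p w)) = 0" for q u v
    using Sum_any_clinear(1)[OF clinear_phi finite_dterm, of q u v w] by (simp add: *)
  then show ?thesis by (simp add: semi_inf_d_dterm phi_simps)
qed

section \<open>The unimodular case\<close>

text \<open>The infinitesimal modular character; it is identically 0 exactly for unimodular Lie
  algebras.\<close>

definition trace_ad :: "'g::fd_complex_lie_algebra \<Rightarrow> complex" where
  "trace_ad x = (\<Sum>v\<in>lie_basis. dual_apply (dual_basis v) (lie_bracket x v))"

lemma trace_ad_coad: "trace_ad x = (\<Sum>v\<in>lie_basis. dual_apply (coad (dual_basis v) x) v)"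
  by (simp add: trace_ad_def coad_apply)

text \<open>The super Jacobi identity for \<open>[[{d, G}, g], h]\<close> with \<open>d\<close> and \<open>G\<close> odd.\<close>

lemma anticommutator_double_comm:
  assumes "clinear d" "clinear G" "clinear g" "clinear h"
    and "\<And>w. G (g w) = sg True r *\<^sub>C g (G w) + g' w"
    and "\<And>w. G (h w) = sg True s *\<^sub>C h (G w) + h' w"
  defines "X \<equiv> \<lambda>w. d (G w) + G (d w)"
  shows "(X (g (h w)) - g (X (h w))) - sg r s *\<^sub>C h (X (g w) - g (X w)) =
    double_comm d (\<not> r) g' s h w
    + (G (double_comm d r g s h w) - sg True (r = s) *\<^sub>C double_comm d r g s h (G w))
    + sg True r *\<^sub>C double_comm d r g (\<not> s) h' w"
  unfolding X_def double_comm_def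
  by (cases r; cases s)
    (simp_all add: assms(5,6) clinear_simps[OF assms(1)] clinear_simps[OF assms(2)]
      clinear_simps[OF assms(3)] clinear_simps[OF assms(4)])

lemma double_comm_scale_left:
  assumes "clinear T" "clinear h"
  shows "double_comm T r (\<lambda>w. c *\<^sub>C g w) s h w = c *\<^sub>C double_comm T r g s h w"
  by (simp add: double_comm_def clinear_simps[OF assms(1)] clinear_simps[OF assms(2)] scaleC_scaleC
      scaleC_add_right cvec.scale_right_diff_distrib mult_ac)

lemma double_comm_scale_right:
  assumes "clinear T" "clinear g"
  shows "double_comm T r g s (\<lambda>w. c *\<^sub>C h w) w = c *\<^sub>C double_comm T r g s h w"
  by (simp add: double_comm_def clinear_simps[OF assms(1)] clinear_simps[OF assms(2)] scaleC_scaleC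
      scaleC_add_right cvec.scale_right_diff_distrib mult_ac)

section \<open>The anomaly of the supercharges\<close>

text \<open>Both supercharges in one family: \<open>t = False\<close> gives the modes of
  \<open>G\<^sup>+\<close>, \<open>t = True\<close> half those of \<open>G\<^sup>-\<close>.\<close>

definition odd_quad :: "bool \<Rightarrow> int \<Rightarrow> 'g::fd_complex_lie_algebra weil \<Rightarrow> 'g weil" where
  "odd_quad t m = quad (\<not> t) t m (if t then of_int else (\<lambda>j. 1))"

lemma odd_quad_psi:
  "odd_quad t m (psi r x k w) = sg True r *\<^sub>C psi r x k (odd_quad t m w)
    + (if r = t then (if t then of_int k else 1) else 0) *\<^sub>C psi (\<not> r) x (k + m) w"
  unfolding odd_quad_def quad_psi by auto

lemma odd_quad_chi:
  "odd_quad t m (chi r f l w) = sg True r *\<^sub>C chi r f l (odd_quad t m w)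
    + (if r \<noteq> t then (if t then - of_int (l - m) else 1) else 0) *\<^sub>C chi (\<not> r) f (l - m) w"
  unfolding odd_quad_def quad_chi by (cases r; cases t) (auto simp: cvec.scale_left_diff_distrib)

lemma clinear_odd_quad: "clinear (odd_quad t m)"
  unfolding odd_quad_def by (rule clinear_quad)

lemmas odd_quad_simps = clinear_simps[OF clinear_odd_quad]

definition dG :: "bool \<Rightarrow> int \<Rightarrow> 'g::fd_complex_lie_algebra weil \<Rightarrow> 'g weil" where
  "dG t m w = semi_inf_d (odd_quad t m w) + odd_quad t m (semi_inf_d w)"

lemma clinear_dG: "clinear (dG t m)"
  by (simp add: clinear_iff dG_def odd_quad_simps clinear_simps[OF clinear_semi_inf_d]
      scaleC_add_right)

lemmas dG_simps = clinear_simps[OF clinear_dG]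

lemmas d_table = d_psi_psi d_psi_chi d_chi_psi d_chi_chi

lemmas dG_double_comm = anticommutator_double_comm[OF clinear_semi_inf_d clinear_odd_quad,
    folded dG_def]

text \<open>On loop elements \<open>odd_quad\<close> acts as multiplication by t^m, which commutes
  with brackets, or as t^(m+1) d/dt, which is a derivation. This makes the contributions cancel;
  hence the commutator of the anomaly with a generator supercommutes with all generators.\<close>

lemma dG_psi_psi:
  "(dG t m (psi r x k (psi s y l w)) - psi r x k (dG t m (psi s y l w)))
    - sg r s *\<^sub>C psi s y l (dG t m (psi r x k w) - psi r x k (dG t m w)) = 0"
  unfolding dG_double_comm[OF clinear_psi clinear_psi odd_quad_psi odd_quad_psi]
    double_comm_scale_left[OF clinear_semi_inf_d clinear_psi]
    double_comm_scale_right[OF clinear_semi_inf_d clinear_psi] d_table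
  by (cases t; cases r; cases s)
    (simp_all add: odd_quad_psi odd_quad_simps lie_bracket_swap[of y x] psi_arg_simps algebra_simps
      scaleC_add_left)

lemma dG_psi_chi:
  "(dG t m (psi r x k (chi s f l w)) - psi r x k (dG t m (chi s f l w)))
    - sg r s *\<^sub>C chi s f l (dG t m (psi r x k w) - psi r x k (dG t m w)) = 0"
  unfolding dG_double_comm[OF clinear_psi clinear_chi odd_quad_psi odd_quad_chi]
    double_comm_scale_left[OF clinear_semi_inf_d clinear_chi]
    double_comm_scale_right[OF clinear_semi_inf_d clinear_psi] d_table
  by (cases t; cases r; cases s)
    (simp_all add: odd_quad_chi odd_quad_simps algebra_simps scaleC_add_left)

lemma dG_chi_psi:
  "(dG t m (chi r f l (psi s x k w)) - chi r f l (dG t m (psi s x k w)))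
    - sg r s *\<^sub>C psi s x k (dG t m (chi r f l w) - chi r f l (dG t m w)) = 0"
  unfolding dG_double_comm[OF clinear_chi clinear_psi odd_quad_chi odd_quad_psi]
    double_comm_scale_left[OF clinear_semi_inf_d clinear_psi]
    double_comm_scale_right[OF clinear_semi_inf_d clinear_chi] d_table
  by (cases t; cases r; cases s)
    (simp_all add: odd_quad_chi odd_quad_simps algebra_simps scaleC_add_left)

lemma dG_chi_chi:
  "(dG t m (chi r f l (chi s f' k w)) - chi r f l (dG t m (chi s f' k w)))
    - sg r s *\<^sub>C chi s f' k (dG t m (chi r f l w) - chi r f l (dG t m w)) = 0"
  unfolding dG_double_comm[OF clinear_chi clinear_chi odd_quad_chi odd_quad_chi]
    double_comm_scale_left[OF clinear_semi_inf_d clinear_chi]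
    double_comm_scale_right[OF clinear_semi_inf_d clinear_chi] d_table
  by (simp add: odd_quad_simps)

context vev
begin

text \<open>A term survives only if neither factor is a creation operator, that is, if j \<le> 0 < j
  + m.\<close>

lemma phi_quad_expand:
  "\<phi> (quad s t m p w) = (\<Sum>j\<in>{1-m..0}. p j * (\<Sum>v\<in>lie_basis. \<phi> (psi s v (j
      + m) (chi t (dual_basis v) j w))))"
proof -
  obtain N where N: "\<And>j v. \<bar>j\<bar> > N \<Longrightarrow> qterm s t m v j w = 0"
    using qterm_support[of s t m w] by blast
  define A where "A = {-max N \<bar>m\<bar>..max N \<bar>m\<bar>}"
  have trm: "\<phi> (qterm s t m v j w)
      = (if j \<in> {1-m..0} then \<phi> (psi s v (j + m) (chi t (dual_basis v) j w)) else 0)" for v j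
    by (auto simp: qterm_def phi_simps phi_psi phi_chi)
  have "\<phi> (quad s t m p w) = (\<Sum>j\<in>A. p j * (\<Sum>v\<in>lie_basis. \<phi> (qterm s t m v j w)))"
    by (subst quad_eq_sum[of A]) (auto simp: A_def phi_simps scaleC_complex_def intro!: N)
  also have "\<dots> = (\<Sum>j\<in>{1-m..0}. p j * (\<Sum>v\<in>lie_basis. \<phi> (psi s v (j
      + m) (chi t (dual_basis v) j w))))"
    unfolding trm by (rule sum.mono_neutral_cong_right) (auto simp: A_def)
  finally show ?thesis .
qed

text \<open>The only possibly nonzero terms have g = \<beta>(x) in degree k,
  \<open>t = False\<close> and m = - k. There the sum over v is minus the trace of ad x.\<close>

lemma phi_odd_quad_d:
  assumes g: "g = psi r x k \<and> (\<forall>z::'g. trace_ad z = 0) \<or> g = chi r f k"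
  shows "\<phi> (odd_quad t m (semi_inf_d (g vacuum))) = 0"
proof -
  have "(\<Sum>v\<in>lie_basis. \<phi> (psi (\<not> t) v (j + m) (chi t (dual_basis v) j (semi_inf_d (g vacuum)))))
      = 0"
    if j: "j \<in> {1-m..0}" for j
  proof -
    \<comment> \<open>Both d and \<open>chi\<close> in degree j \<le> 0 kill the vacuum, so three of
      the four terms of the double commutator vanish.\<close>
    have D: "chi t (dual_basis v) j (semi_inf_d (g vacuum))
      = - sg (\<not> r) t *\<^sub>C double_comm semi_inf_d r g t (chi t (dual_basis v) j) vacuum" for v
      using g j by (auto simp: double_comm_def chi_vacuum d_vacuum psi_simps chi_simps
          clinear_simps[OF clinear_semi_inf_d] scaleC_scaleC)
    from g show ?thesis
    proof
      assume g: "g = chi r f k"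
      show ?thesis unfolding D unfolding g d_chi_chi by (simp add: psi_simps phi_simps)
    next
      assume "g = psi r x k \<and> (\<forall>z::'g. trace_ad z = 0)"
      then have g: "g = psi r x k" and tr: "trace_ad x = 0" by auto
      have "\<phi> (psi (\<not> t) v (j + m) (chi t (dual_basis v) j (semi_inf_d (g vacuum))))
        = - (if \<not> r \<and> \<not> t \<and> m = - k then dual_apply (coad (dual_basis v) x) v else 0)" for v
        unfolding D unfolding g d_psi_chi using j
        by (cases r; cases t) (auto simp: psi_simps psi_chi psi_vacuum chi_simps phi_simps
            scaleC_complex_def)
      then show ?thesis
        using tr by (cases "\<not> r \<and> \<not> t \<and> m = - k") (simp_all add: trace_ad_coad sum_negf)
    qed
  qed
  then show ?thesis unfolding odd_quad_def phi_quad_expand by simp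
qed

text \<open>The mirror image of \<open>phi_odd_quad_d\<close>, where vanishing comes from the left
  vacuum instead of the vacuum.\<close>

lemma phi_d_odd_quad:
  assumes g: "g = psi r x k \<and> (\<forall>z::'g. trace_ad z = 0) \<or> g = chi r f k" and vac: "g vacuum = 0"
  shows "\<phi> (g (semi_inf_d (odd_quad t m vacuum))) = 0"
proof -
  have lin: "clinear g" using g clinear_psi clinear_chi by auto
  have "(\<Sum>v\<in>lie_basis. \<phi> (g (semi_inf_d (qterm (\<not> t) t m v j vacuum)))) = 0"
    if j: "j \<in> {1..-m}" for j
  proof -
    \<comment> \<open>The functional kills the range of d and every vector beginning with
      \<open>chi\<close> in degree j > 0, so again one term of the double commutator
      remains.\<close>
    have D: "\<phi> (g (semi_inf_d (qterm (\<not> t) t m v j vacuum)))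
      = - sg True r * \<phi> (double_comm semi_inf_d r g t (chi t (dual_basis v) j) (psi (\<not> t) v (j
          + m) vacuum))" for v
      using j by (simp add: double_comm_def qterm_def phi_simps phi_d phi_chi scaleC_complex_def
          sg_def)
    from g show ?thesis
    proof
      assume g: "g = chi r f k"
      show ?thesis unfolding D unfolding g d_chi_chi by (simp add: psi_simps phi_simps)
    next
      assume "g = psi r x k \<and> (\<forall>z::'g. trace_ad z = 0)"
      then have g: "g = psi r x k" and tr: "trace_ad x = 0" by auto
      have "\<phi> (g (semi_inf_d (qterm (\<not> t) t m v j vacuum)))
        = - (if \<not> r \<and> \<not> t \<and> m = - k then dual_apply (coad (dual_basis v) x) v else 0)" for v
        unfolding D unfolding g d_psi_chi using j
        by (cases r; cases t; cases "j - k > 0")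
          (auto simp: chi_psi psi_simps chi_vacuum chi_simps phi_simps phi_chi phi_psi
              scaleC_complex_def)
      then show ?thesis
        using tr by (cases "\<not> r \<and> \<not> t \<and> m = - k") (simp_all add: trace_ad_coad sum_negf)
    qed
  qed
  then show ?thesis
    unfolding odd_quad_def quad_vacuum_expand
    by (simp add: clinear_simps[OF lin] clinear_simps[OF clinear_semi_inf_d] phi_simps
        scaleC_complex_def)
qed

text \<open>A homogeneous generator either kills the vacuum or is killed by the functional, so each
  half of the commutator is covered by one of the two preceding computations.\<close>

lemma phi_dG_commutator:
  assumes g: "g = psi r x k \<and> (\<forall>z::'g. trace_ad z = 0) \<or> g = chi r f k"
  shows "\<phi> (dG t m (g vacuum) - g (dG t m vacuum)) = 0"
proof -
  have lin: "clinear g" using g clinear_psi clinear_chi by auto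
  have "g vacuum = 0 \<or> (\<forall>w. \<phi> (g w) = 0)"
    using g psi_vacuum[of k r x] phi_psi[of k r x] chi_vacuum[of k r f] phi_chi[of k r f] by force
  then show ?thesis
    using phi_odd_quad_d[OF g] phi_d_odd_quad[OF g]
    by (auto simp: dG_def phi_simps phi_d d_vacuum odd_quad_simps clinear_simps[OF lin]
        clinear_simps[OF clinear_semi_inf_d])
qed

text \<open>\<open>supercommuting_zero\<close> is used at two levels: for the commutator of the
  anomaly with each generator, and then for the anomaly itself.\<close>

lemma dG_zero:
  fixes w :: "'g weil"
  assumes "\<And>z::'g. trace_ad z = 0"
  shows "dG t m w = 0"
proof -
  have psi: "dG t m (psi r x k w) - psi r x k (dG t m w) = 0" for r x k and w :: "'g weil"
  proof (rule supercommuting_zero[where p = r and X = "\<lambda>w. dG t m (psi r x k w)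
      - psi r x k (dG t m w)"])
    show "clinear (\<lambda>w. dG t m (psi r x k w) - psi r x k (dG t m w))"
      by (simp add: clinear_iff dG_simps psi_simps cvec.scale_right_diff_distrib)
    show "\<phi> (dG t m (psi r x k vacuum) - psi r x k (dG t m vacuum)) = 0"
      by (rule phi_dG_commutator) (use assms in blast)
  qed (use dG_psi_psi dG_psi_chi in \<open>simp_all only: right_minus_eq\<close>)
  have chi: "dG t m (chi r f k w) - chi r f k (dG t m w) = 0" for r f k and w :: "'g weil"
  proof (rule supercommuting_zero[where p = r and X = "\<lambda>w. dG t m (chi r f k w)
      - chi r f k (dG t m w)"])
    show "clinear (\<lambda>w. dG t m (chi r f k w) - chi r f k (dG t m w))"
      by (simp add: clinear_iff dG_simps chi_simps cvec.scale_right_diff_distrib)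
    show "\<phi> (dG t m (chi r f k vacuum) - chi r f k (dG t m vacuum)) = 0"
      by (rule phi_dG_commutator) blast
  qed (use dG_chi_psi dG_chi_chi in \<open>simp_all only: right_minus_eq\<close>)
  show ?thesis
  proof (rule supercommuting_zero[where p = False and X = "dG t m"])
    have "\<phi> (odd_quad t m (semi_inf_d vacuum)) = 0"
      by (simp add: d_vacuum odd_quad_simps phi_simps)
    then show "\<phi> (dG t m vacuum) = 0" by (simp add: dG_def phi_simps phi_d)
  qed (use psi chi clinear_dG in simp_all)
qed

end

lemma d_odd_quad:
  fixes w :: "'g::fd_complex_lie_algebra weil"
  assumes "\<And>z::'g. trace_ad z = 0"
  shows "semi_inf_d (odd_quad t m w) = - odd_quad t m (semi_inf_d w)"
proof (cases "vacuum = (0 :: 'g weil)")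
  case True
  show ?thesis by (rule trans[OF weil_trivial[OF True] weil_trivial[OF True, symmetric]])
next
  case False
  then obtain \<phi> :: "'g weil \<Rightarrow> complex" where "is_vev \<phi>" using vev_exists by blast
  then interpret vev \<phi> by unfold_locales
  show ?thesis using dG_zero[OF assms, where w = w and t = t and m = m]
      by (simp add: dG_def eq_neg_iff_add_eq_0)
qed

text \<open>\<open>L\<close> and \<open>H\<close> are combinations of anticommutators of the
  supercharges and the central element, so compatibility with d passes to them.\<close>

lemma d_n2_op:
  fixes w :: "'g::fd_complex_lie_algebra weil"
  assumes "\<And>z::'g. trace_ad z = 0"
  shows "semi_inf_d (n2_op b w) = sg True (n2_basis_odd b) *\<^sub>C n2_op b (semi_inf_d w)"
proof -
  note d_simps = clinear_simps[OF clinear_semi_inf_d] clinear_simps[OF clinear_n2_op]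
  have Gp: "semi_inf_d (n2_op (Gp_basis k) w) = - n2_op (Gp_basis k) (semi_inf_d w)"
      for k and w :: "'g weil"
    using d_odd_quad[OF assms, of False "- k - 1" w] by (simp add: odd_quad_def)
  have Gm: "semi_inf_d (n2_op (Gm_basis k) w) = - n2_op (Gm_basis k) (semi_inf_d w)"
      for k and w :: "'g weil"
    using d_odd_quad[OF assms, of True "- k" w] by (simp add: odd_quad_def quad_scale d_simps)
  have C: "semi_inf_d (n2_op C_basis w) = n2_op C_basis (semi_inf_d w)" for w :: "'g weil"
    by (simp add: d_simps)
  define LH where "LH k l w = 2 *\<^sub>C n2_op (L_basis (k + l + 1)) w + (half k - half l)
      *\<^sub>C n2_op (H_basis (k + l + 1)) w" for k l and w :: "'g weil"
  have LH: "LH k l w = n2_op (Gp_basis k) (n2_op (Gm_basis l) w)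
      + n2_op (Gm_basis l) (n2_op (Gp_basis k) w)
    - (if half k = - half l then ((half k)\<^sup>2 - 1/4) / 3 else 0) *\<^sub>C n2_op C_basis w"
        for k l and w :: "'g weil"
    unfolding LH_def n2_op_GpGm by simp
  have dLH: "semi_inf_d (LH k l w) = LH k l (semi_inf_d w)" for k l and w :: "'g weil"
    unfolding LH by (simp add: d_simps Gp Gm C del: n2_op.simps)
  \<comment> \<open>The index pairs (n, -1) and (n - 1, 0) give the same \<open>L\<close>, while
    \<open>H\<close> appears with coefficients n + 1 and n - 1.\<close>
  have H: "2 *\<^sub>C n2_op (H_basis n) w = LH n (- 1) w - LH (n - 1) 0 w" for n and w :: "'g weil"
    by (simp add: LH_def half_def flip: cvec.scale_left_diff_distrib del: n2_op.simps)
  have dH: "semi_inf_d (n2_op (H_basis n) w) = n2_op (H_basis n) (semi_inf_d w)"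
      for n and w :: "'g weil"
  proof -
    have "2 *\<^sub>C semi_inf_d (n2_op (H_basis n) w) = 2 *\<^sub>C n2_op (H_basis n) (semi_inf_d w)"
      unfolding H by (simp only: d_simps(3)[symmetric] H d_simps(2) dLH)
    then show ?thesis by simp
  qed
  have L: "2 *\<^sub>C n2_op (L_basis n) w = LH n (- 1) w - (half n - half (- 1)) *\<^sub>C n2_op (H_basis n) w"
      for n and w :: "'g weil"
    by (simp add: LH_def del: n2_op.simps)
  have dL: "semi_inf_d (n2_op (L_basis n) w) = n2_op (L_basis n) (semi_inf_d w)"
      for n and w :: "'g weil"
  proof -
    have "2 *\<^sub>C semi_inf_d (n2_op (L_basis n) w) = 2 *\<^sub>C n2_op (L_basis n) (semi_inf_d w)"
      unfolding L by (simp only: d_simps(3)[symmetric] L d_simps(2) dLH) (simp only: d_simps(3) dH)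
    then show ?thesis by simp
  qed
  show ?thesis by (cases b) (simp_all add: Gp Gm dH dL C del: n2_op.simps)
qed

section \<open>Graded isomorphisms of spaces of countable dimension\<close>

lemma independent_Un:
  fixes A B :: "'a::complex_vector set"
  assumes "cvec.independent A" "cvec.independent B" "cvec.span A \<inter> cvec.span B \<subseteq> {0}"
  shows "cvec.independent (A \<union> B)"
proof
  assume "cvec.dependent (A \<union> B)"
  then obtain T u v where T: "finite T" "T \<subseteq> A \<union> B" "(\<Sum>v\<in>T. u v *\<^sub>C v) = 0" and v: "v \<in> T" "u v \<noteq> 0"
    unfolding cvec.dependent_explicit by blast
  let ?a = "\<Sum>v\<in>T \<inter> A. u v *\<^sub>C v" and ?b = "\<Sum>v\<in>T - A. u v *\<^sub>C v"
  have a: "?a \<in> cvec.span A" by (intro cvec.span_sum cvec.span_scale cvec.span_base) auto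
  have b: "?b \<in> cvec.span B"
    using T(2) by (intro cvec.span_sum cvec.span_scale cvec.span_base) auto
  have "?a + ?b = (\<Sum>v\<in>T. u v *\<^sub>C v)"
    using T(1) by (subst sum.union_disjoint[symmetric]) (auto intro!: sum.cong)
  then have ab: "?a = - ?b" using T(3) by (simp add: eq_neg_iff_add_eq_0)
  then have "?a \<in> cvec.span B" using cvec.span_neg[OF b] by simp
  with a assms(3) have "?a = 0" by blast
  moreover from this ab have "?b = 0" by simp
  moreover have "finite (T \<inter> A)" "finite (T - A)" using T(1) by auto
  ultimately have "\<forall>v\<in>T \<inter> A. u v = 0" "\<forall>v\<in>T - A. u v = 0"
    using assms(1,2) T(2) unfolding cvec.dependent_explicit by blast+
  with v show False by blast
qed

text \<open>The span of a countable set is an increasing union of finite-dimensional spans, each of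
  which meets an independent set in a finite set.\<close>

lemma countable_independent:
  fixes S B :: "'a::complex_vector set"
  assumes "countable S" "B \<subseteq> cvec.span S" "cvec.independent B"
  shows "countable B"
proof (cases "S = {}")
  case True
  then have "B \<subseteq> {0}" using assms(2) by simp
  then show ?thesis by (rule countable_subset) simp
next
  case False
  define T where "T n = from_nat_into S ` {..n}" for n :: nat
  have "\<exists>n. b \<in> cvec.span (T n)" if "b \<in> cvec.span S" for b
    using that
  proof (induction rule: cvec.span_induct_alt)
    case base
    show ?case by (auto intro: cvec.span_zero)
  next
    case (step c x y)
    then obtain n where n: "y \<in> cvec.span (T n)" by blast
    obtain m where m: "x = from_nat_into S m"
      using step(1) assms(1) by (metis from_nat_into_surj)
    have "T n \<subseteq> T (max n m)" by (auto simp: T_def)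
    then have "y \<in> cvec.span (T (max n m))" using n cvec.span_mono by blast
    moreover have "x \<in> cvec.span (T (max n m))" by (rule cvec.span_base) (auto simp: T_def m)
    ultimately show ?case by (blast intro: cvec.span_add cvec.span_scale)
  qed
  then have B: "B = (\<Union>n. B \<inter> cvec.span (T n))" using assms(2) by blast
  have "finite (B \<inter> cvec.span (T n))" for n
    using cvec.independent_span_bound[of "T n" "B \<inter> cvec.span (T n)"]
      cvec.independent_mono[OF assms(3)] by (auto simp: T_def)
  then have "countable (\<Union>n. B \<inter> cvec.span (T n))"
    by (intro countable_UN countableI_type countable_finite)
  then show ?thesis by (subst B)
qed

text \<open>The biorthogonal system of \<open>y\<close> and \<open>f\<close> makes the dimension
  infinite, and the countable spanning set makes it countable. So a basis can be indexed by the
  natural numbers.\<close>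

lemma countable_basis_exists:
  fixes S :: "'a::complex_vector set"
  assumes "countable S" "V \<subseteq> cvec.span S" "cvec.subspace V"
    and y: "\<And>k. y k \<in> V" and f: "\<And>j. clinear (f j)" "\<And>j k. f j (y k) = (if j
        = k then c k else (0::complex))" "\<And>k::nat. c k \<noteq> 0"
  shows "\<exists>b :: nat \<Rightarrow> 'a. inj b \<and> cvec.independent (range b) \<and> cvec.span (range b) = V"
proof -
  obtain B where B: "B \<subseteq> V" "cvec.independent B" "V \<subseteq> cvec.span B"
    using cvec.maximal_independent_subset[of V] by metis
  have inj: "inj y"
    by (rule injI) (metis f(2) f(3))
  have "cvec.independent (range y)"
  proof
    assume "cvec.dependent (range y)"
    then obtain T u k where T: "finite T" "T \<subseteq> range y" "(\<Sum>v\<in>T. u v *\<^sub>C v) = 0"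
      and k: "y k \<in> T" "u (y k) \<noteq> 0"
      unfolding cvec.dependent_explicit by blast
    have "0 = f k (\<Sum>v\<in>T. u v *\<^sub>C v)" by (simp add: T(3) clinear_0[OF f(1)])
    also have "\<dots> = (\<Sum>v\<in>T. u v * f k v)" by (simp add: clinear_simps[OF f(1)] scaleC_complex_def)
    also have "\<dots> = (\<Sum>v\<in>T. if v = y k then u (y k) * c k else 0)"
      using T(2) by (intro sum.cong) (auto simp: f(2) inj_eq[OF inj])
    also have "\<dots> = u (y k) * c k" using T(1) k(1) by simp
    finally show False using k(2) f(3) by simp
  qed
  moreover have "range y \<subseteq> cvec.span B" using y B(3) by blast
  ultimately have "infinite B"
    using cvec.independent_span_bound[of B "range y"] inj by (auto simp: finite_image_iff)
  moreover have "countable B"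
    by (rule countable_independent[OF assms(1) _ B(2)]) (use B(1) assms(2) in blast)
  ultimately have "bij_betw (from_nat_into B) UNIV B" by (rule bij_betw_from_nat_into[rotated])
  moreover have "cvec.span B = V" using B assms(3) by (metis cvec.span_subspace)
  ultimately show ?thesis using B(2)
    by (intro exI[of _ "from_nat_into B"]) (auto simp: bij_betw_def)
qed

lemma graded_isomorphism:
  fixes b :: "bool \<Rightarrow> nat \<Rightarrow> 'a::complex_vector" and b' :: "bool \<Rightarrow> nat \<Rightarrow> 'b::complex_vector"
  assumes "\<And>p. inj (b p)" "\<And>p. cvec.independent (range (b p))"
    and "cvec.span (range (b False)) \<inter> cvec.span (range (b True)) \<subseteq> {0}"
  shows "\<exists>F. clinear F \<and> (\<forall>p k. F (b p k) = b' p k)"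
proof -
  interpret pair: vector_space_pair "scaleC :: complex \<Rightarrow> 'a \<Rightarrow> 'a" "scaleC :: complex \<Rightarrow> 'b \<Rightarrow> 'b"
    by unfold_locales
  let ?B = "range (b False) \<union> range (b True)"
  define g where "g v = (if v \<in> range (b False) then b' False (inv (b False) v) else b' True (inv
      (b True) v))" for v
  have "cvec.independent ?B" by (rule independent_Un) (use assms in auto)
  from pair.linear_independent_extend[OF this, of g]
  obtain F where F: "clinear F" "\<And>v. v \<in> ?B \<Longrightarrow> F v = g v" by blast
  have disjoint: "b True k \<noteq> b False l" for k l
  proof
    assume eq: "b True k = b False l"
    have "b True k \<in> cvec.span (range (b False))" unfolding eq by (rule cvec.span_base) simp
    moreover have "b True k \<in> cvec.span (range (b True))" by (rule cvec.span_base) simp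
    ultimately have "b True k = 0" using assms(3) by blast
    then show False using assms(2)[of True] cvec.dependent_zero[of "range (b True)"]
      by (metis rangeI)
  qed
  have "F (b p k) = b' p k" for p k
  proof (cases p)
    case True
    then have "g (b p k) = b' p k"
      using disjoint by (auto simp: g_def inv_f_f[OF assms(1)])
    then show ?thesis using F(2)[of "b p k"] True by auto
  next
    case False
    then have "g (b p k) = b' p k" by (simp add: g_def inv_f_f[OF assms(1)])
    then show ?thesis using F(2)[of "b p k"] False by auto
  qed
  with F(1) show ?thesis by blast
qed

lemma graded_isomorphism_inverse:
  fixes b :: "bool \<Rightarrow> nat \<Rightarrow> 'a::complex_vector"
  assumes "clinear F" "clinear G" "\<And>p k. F (b p k) = b' p k" "\<And>p k. G (b' p k) = b p k"
    and "v = v0 + v1" "v0 \<in> cvec.span (range (b False))" "v1 \<in> cvec.span (range (b True))"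
  shows "G (F v) = v"
proof -
  have "G (F v) = v" if "v \<in> cvec.span (range (b p))" for p v
    using that
    by (induction rule: cvec.span_induct_alt)
      (auto simp: clinear_simps[OF assms(1)] clinear_simps[OF assms(2)] assms(3,4))
  from this[OF assms(6)] this[OF assms(7)] show ?thesis
    by (simp add: assms(5) clinear_simps[OF assms(1)] clinear_simps[OF assms(2)])
qed

section \<open>Parity\<close>

lemma subspace_weil_part: "cvec.subspace (weil_part p)"
  unfolding weil_part_def by (rule cvec.subspace_span)

lemma ext_act_monomial: "ext_act y (ext_monomial xs) = ext_monomial (y # xs)"
  by transfer (simp add: gen_mult_single cvec.span_zero)

lemma ext_monomial_Nil: "ext_monomial [] = ext_vacuum"
  by transfer (simp add: cvec.span_zero single_one flip: zero_word_def)

lemma op_apply_weil_part: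
  assumes "w \<in> weil_part p" shows "op_apply a w \<in> weil_part (p \<noteq> op_odd a)"
  unfolding weil_part_def
proof (rule clinear_span_closed[OF clinear_op_apply _ assms[unfolded weil_part_def]])
  fix v :: "'a weil"
  assume "v \<in> {s \<otimes> ext_monomial xs | s xs. odd (length xs) = p}"
  then obtain s xs where v: "v = s \<otimes> ext_monomial xs" "odd (length xs) = p" by blast
  have "\<exists>s' xs'. op_apply a v = s' \<otimes> ext_monomial xs' \<and> odd (length xs') = (p \<noteq> op_odd a)"
    using v(2)
    by (cases a) (auto simp: v(1) on_left_tens on_right_tens clinear_sym_act clinear_ext_act
        ext_act_monomial intro!: exI)
  then show "op_apply a v \<in> cvec.span {s \<otimes> ext_monomial xs | s xs. odd (length xs)
      = (p \<noteq> op_odd a)}"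
    by (intro cvec.span_base) blast
qed

lemma psi_weil_part: "w \<in> weil_part p \<Longrightarrow> psi s x n w \<in> weil_part (p \<noteq> s)"
  using op_apply_weil_part[of w p "if s then Tau (at_degree x n) else Beta (at_degree x n)"]
  by (cases s) (simp_all add: psi_def del: op_apply.simps)

lemma chi_weil_part: "w \<in> weil_part p \<Longrightarrow> chi s f n w \<in> weil_part (p \<noteq> s)"
  using op_apply_weil_part[of w p "if s then Eps (at_degree f n) else Gamma (at_degree f n)"]
  by (cases s) (simp_all add: chi_def del: op_apply.simps)

lemma vacuum_weil_part: "vacuum \<in> weil_part False"
  unfolding weil_part_def vacuum_def ext_monomial_Nil[symmetric]
  by (intro cvec.span_base) (use exI in force)

lemma Sum_any_subspace:
  "cvec.subspace V \<Longrightarrow> (\<And>p. f p \<in> V) \<Longrightarrow> Sum_any f \<in> V"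
  by (simp add: Sum_any.expand_set cvec.subspace_sum)

lemma quad_weil_part:
  assumes "w \<in> weil_part p" shows "quad s t m f w \<in> weil_part (p \<noteq> (s \<noteq> t))"
proof -
  note sub = subspace_weil_part[of "p \<noteq> (s \<noteq> t)"]
  have "qterm s t m v j w \<in> weil_part (p \<noteq> (s \<noteq> t))" for v j
  proof -
    have "psi s v (j + m) (chi t (dual_basis v) j w) \<in> weil_part ((p \<noteq> t) \<noteq> s)"
      "chi t (dual_basis v) j (psi s v (j + m) w) \<in> weil_part ((p \<noteq> s) \<noteq> t)"
      by (intro psi_weil_part chi_weil_part assms)+
    moreover have "((p \<noteq> t) \<noteq> s) = (p \<noteq> (s \<noteq> t))" "((p \<noteq> s) \<noteq> t) = (p \<noteq> (s \<noteq> t))" by auto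
    ultimately show ?thesis
      unfolding qterm_def by (simp only: cvec.subspace_scale[OF sub] split: if_split) blast
  qed
  then show ?thesis
    unfolding quad_def
    by (intro Sum_any_subspace sub cvec.subspace_scale cvec.subspace_sum) auto
qed

lemma n2_op_weil_part:
  "w \<in> weil_part p \<Longrightarrow> n2_op b w \<in> weil_part (n2_basis_odd b \<noteq> p)"
  using quad_weil_part[of w p False False] quad_weil_part[of w p True True]
    quad_weil_part[of w p True False] quad_weil_part[of w p False True]
  by (cases b; cases p)
    (auto intro: cvec.subspace_add[OF subspace_weil_part] cvec.subspace_scale[OF
        subspace_weil_part])

lemma dterm_weil_part:
  assumes "w \<in> weil_part p" shows "dterm q u v ij w \<in> weil_part (\<not> p)"
proof (cases ij)
  case (Pair i j)
  obtain k1 k2 where "\<not> q \<longrightarrow> k2 = 0" "dterm q u v (i, j) w =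
     psi q (lie_bracket u v) (i + j) (chi q (dual_basis v) j (chi True (dual_basis u) i w))
     + k1 *\<^sub>C chi True (dual_basis u) i w + k2 *\<^sub>C chi q (dual_basis v) j w"
    using dterm_product[of q u v i j] by blast
  moreover have "chi True (dual_basis u) i w \<in> weil_part (\<not> p)"
    using chi_weil_part[OF assms, of True] by simp
  moreover have "psi q (lie_bracket u v) (i + j) (chi q (dual_basis v) j (chi True (dual_basis u)
      i w)) \<in> weil_part (\<not> p)"
  proof -
    have "psi q (lie_bracket u v) (i + j) (chi q (dual_basis v) j (chi True (dual_basis u) i w))
        \<in> weil_part (((p \<noteq> True) \<noteq> q) \<noteq> q)"
      by (intro psi_weil_part chi_weil_part assms)
    then show ?thesis by (cases q) auto
  qed
  moreover have "q \<Longrightarrow> chi q (dual_basis v) j w \<in> weil_part (\<not> p)"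
    using chi_weil_part[OF assms, of True] by simp
  ultimately show ?thesis
    using subspace_weil_part[of "\<not> p"] unfolding Pair
    by (cases q) (auto intro!: cvec.subspace_add cvec.subspace_scale)
qed

lemma d_weil_part:
  assumes "w \<in> weil_part p" shows "semi_inf_d w \<in> weil_part (\<not> p)"
  unfolding semi_inf_d_dterm
  by (intro cvec.subspace_add cvec.subspace_scale cvec.subspace_sum Sum_any_subspace
      subspace_weil_part dterm_weil_part assms)

lemma weil_part_decomposition: "\<exists>w0\<in>weil_part False. \<exists>w1\<in>weil_part True. w = w0 + w1"
proof (induction w rule: weil_induct)
  case (vacuum c)
  have "c *\<^sub>C vacuum \<in> weil_part False" "0 \<in> weil_part True"
    by (intro cvec.subspace_scale cvec.subspace_0 subspace_weil_part vacuum_weil_part)+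
  then show ?case by force
next
  case (psi s x n w)
  then obtain w0 w1 where w: "w0 \<in> weil_part False" "w1 \<in> weil_part True" "w = w0 + w1" by blast
  have *: "psi s x n w0 \<in> weil_part s" "psi s x n w1 \<in> weil_part (\<not> s)"
    using psi_weil_part[OF w(1), of s x n] psi_weil_part[OF w(2), of s x n] by auto
  show ?case unfolding w(3) psi_simps
    using * by (cases s) (force simp: add.commute)+
next
  case (chi s x n w)
  then obtain w0 w1 where w: "w0 \<in> weil_part False" "w1 \<in> weil_part True" "w = w0 + w1" by blast
  have *: "chi s x n w0 \<in> weil_part s" "chi s x n w1 \<in> weil_part (\<not> s)"
    using chi_weil_part[OF w(1), of s x n] chi_weil_part[OF w(2), of s x n] by auto
  show ?case unfolding w(3) chi_simps
    using * by (cases s) (force simp: add.commute)+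
next
  case (add v w)
  then obtain v0 v1 w0 w1 where "v0 \<in> weil_part False" "v1 \<in> weil_part True" "v = v0 + v1"
    "w0 \<in> weil_part False" "w1 \<in> weil_part True" "w = w0 + w1" by blast
  then have "v + w = (v0 + w0) + (v1 + w1)" "v0 + w0 \<in> weil_part False" "v1 + w1 \<in> weil_part True"
    by (auto intro: cvec.subspace_add[OF subspace_weil_part])
  then show ?case by blast
qed

text \<open>The eigenvalues of this operator on \<open>weil_part p\<close> have parity \<open>p\<close>, so the two
  parts meet only in 0.\<close>

definition charge :: "'g::fd_complex_lie_algebra weil \<Rightarrow> 'g weil" where
  "charge = quad True True 0 (\<lambda>j. 1)"

lemma clinear_charge: "clinear charge"
  unfolding charge_def by (rule clinear_quad)

lemmas charge_simps = clinear_simps[OF clinear_charge]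

definition charge_part :: "bool \<Rightarrow> 'g::fd_complex_lie_algebra weil set" where
  "charge_part p = cvec.span {v. \<exists>k::int. odd k = p \<and> charge v = of_int k *\<^sub>C v}"

lemma psi_charge_part:
  assumes "w \<in> charge_part p" shows "psi s x n w \<in> charge_part (p \<noteq> s)"
  unfolding charge_part_def
proof (rule clinear_span_closed[OF clinear_psi _ assms[unfolded charge_part_def]])
  fix v :: "'a weil" assume "v \<in> {v. \<exists>k::int. odd k = p \<and> charge v = of_int k *\<^sub>C v}"
  then obtain k :: int where k: "odd k = p" "charge v = of_int k *\<^sub>C v" by blast
  have "charge (psi s x n v) = of_int (k + (if s then 1 else 0)) *\<^sub>C psi s x n v"
    using k(2) by (cases s) (simp_all add: charge_def quad_psi psi_simps scaleC_add_left)
  moreover have "odd (k + (if s then 1 else 0)) = (p \<noteq> s)" using k(1) by auto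
  ultimately show "psi s x n v \<in> cvec.span {v. \<exists>k::int. odd k = (p \<noteq> s) \<and> charge v = of_int k *\<^sub>C v}"
    by (intro cvec.span_base) blast
qed

lemma chi_charge_part:
  assumes "w \<in> charge_part p" shows "chi s f n w \<in> charge_part (p \<noteq> s)"
  unfolding charge_part_def
proof (rule clinear_span_closed[OF clinear_chi _ assms[unfolded charge_part_def]])
  fix v :: "'a weil" assume "v \<in> {v. \<exists>k::int. odd k = p \<and> charge v = of_int k *\<^sub>C v}"
  then obtain k :: int where k: "odd k = p" "charge v = of_int k *\<^sub>C v" by blast
  have "charge (chi s f n v) = of_int (k - (if s then 1 else 0)) *\<^sub>C chi s f n v"
    using k(2) by (cases s) (simp_all add: charge_def quad_chi chi_simps
        cvec.scale_left_diff_distrib)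
  moreover have "odd (k - (if s then 1 else 0)) = (p \<noteq> s)" using k(1) by auto
  ultimately show "chi s f n v \<in> cvec.span {v. \<exists>k::int. odd k = (p \<noteq> s) \<and> charge v = of_int k *\<^sub>C v}"
    by (intro cvec.span_base) blast
qed

lemma subspace_charge_part: "cvec.subspace (charge_part p)"
  unfolding charge_part_def by (rule cvec.subspace_span)

lemma op_apply_charge_part:
  assumes "w \<in> charge_part p" shows "op_apply a w \<in> charge_part (p \<noteq> op_odd a)"
proof (cases a)
  case (Beta x)
  have "op_apply (Beta x) w \<in> charge_part (p \<noteq> False)"
  proof (induction x rule: free_induct)
    case (single k c)
    show ?case using psi_charge_part[OF assms, of False c k] by (simp add: psi_def at_degree_def)
  qed (simp_all only: op_apply_add op_apply_0 cvec.subspace_add[OF subspace_charge_part]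
      cvec.subspace_0[OF subspace_charge_part])
  with Beta show ?thesis by simp
next
  case (Tau x)
  have "op_apply (Tau x) w \<in> charge_part (p \<noteq> True)"
  proof (induction x rule: free_induct)
    case (single k c)
    show ?case using psi_charge_part[OF assms, of True c k] by (simp add: psi_def at_degree_def)
  qed (simp_all only: op_apply_add op_apply_0 cvec.subspace_add[OF subspace_charge_part]
      cvec.subspace_0[OF subspace_charge_part])
  with Tau show ?thesis by simp
next
  case (Gamma x)
  have "op_apply (Gamma x) w \<in> charge_part (p \<noteq> False)"
  proof (induction x rule: free_induct)
    case (single k c)
    show ?case using chi_charge_part[OF assms, of False c k] by (simp add: chi_def at_degree_def)
  qed (simp_all only: op_apply_add op_apply_0 cvec.subspace_add[OF subspace_charge_part]
      cvec.subspace_0[OF subspace_charge_part])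
  with Gamma show ?thesis by simp
next
  case (Eps x)
  have "op_apply (Eps x) w \<in> charge_part (p \<noteq> True)"
  proof (induction x rule: free_induct)
    case (single k c)
    show ?case using chi_charge_part[OF assms, of True c k] by (simp add: chi_def at_degree_def)
  qed (simp_all only: op_apply_add op_apply_0 cvec.subspace_add[OF subspace_charge_part]
      cvec.subspace_0[OF subspace_charge_part])
  with Eps show ?thesis by simp
qed

lemma tens_monomial_charge_part:
  "s \<otimes> ext_monomial xs \<in> charge_part (odd (length xs))"
proof (induction xs)
  case Nil
  show ?case
    unfolding ext_monomial_Nil
  proof (induction s rule: sym_induct)
    case (vacuum c)
    have "charge (vacuum :: 'a weil) = of_int 0 *\<^sub>C vacuum" by (simp add: charge_def quad_vacuum)
    then have "(vacuum :: 'a weil) \<in> charge_part False"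
      unfolding charge_part_def by (intro cvec.span_base) (use even_zero in blast)
    then have "c *\<^sub>C (vacuum :: 'a weil) \<in> charge_part False"
        by (rule cvec.subspace_scale[OF subspace_charge_part])
    then show ?case by (simp add: vacuum_def tens_scale_left)
  next
    case (act y s)
    have "op_apply (Beta (fst y)) (s \<otimes> ext_vacuum) + op_apply (Gamma (snd y)) (s \<otimes> ext_vacuum)
        \<in> charge_part False"
      using op_apply_charge_part[OF act, of "Beta (fst y)"] op_apply_charge_part[OF act, of
          "Gamma (snd y)"]
      by (intro cvec.subspace_add subspace_charge_part) simp_all
    then show ?case by (simp add: on_left_tens clinear_sym_act flip: tens_add_left sym_act_add)
  next
    case (add s t)
    then show ?case by (simp add: tens_add_left cvec.subspace_add[OF subspace_charge_part])
  qed
next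
  case (Cons y xs)
  have "op_apply (Tau (fst y)) (s \<otimes> ext_monomial xs)
      + op_apply (Eps (snd y)) (s \<otimes> ext_monomial xs) \<in> charge_part (odd (length (y # xs)))"
    using op_apply_charge_part[OF Cons, of "Tau (fst y)"] op_apply_charge_part[OF Cons, of
        "Eps (snd y)"]
    by (intro cvec.subspace_add subspace_charge_part) simp_all
  then show ?case
    by (simp add: on_right_tens clinear_ext_act flip: tens_add_right ext_act_add ext_act_monomial)
qed

lemma weil_part_charge_part: "weil_part p \<subseteq> charge_part p"
  unfolding weil_part_def
  by (rule cvec.span_minimal[OF _ subspace_charge_part]) (use tens_monomial_charge_part in blast)

lemma charge_part_decomposition:
  assumes "w \<in> charge_part p"
  shows "\<exists>A f. finite A \<and> (\<forall>k\<in>A. odd k = p) \<and> w = (\<Sum>k\<in>A. f k) \<and> (\<forall>k. charge (f k) = of_int k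
      *\<^sub>C f k)"
  using assms unfolding charge_part_def
proof (induction rule: cvec.span_induct_alt)
  case base
  show ?case by (intro exI[of _ "{}"] exI[of _ "\<lambda>_. 0"]) (simp add: charge_simps)
next
  case (step c x y)
  then obtain k A f where k: "odd k = p" "charge x = of_int k *\<^sub>C x" and A: "finite A" "\<forall>k\<in>A. odd k
      = p"
    "y = (\<Sum>k\<in>A. f k)" and f: "\<And>k. charge (f k) = of_int k *\<^sub>C f k" by blast
  define g where "g j = (if j = k then c *\<^sub>C x else 0) + (if j \<in> A then f j else 0)" for j
  have "(\<Sum>j\<in>insert k A. if j \<in> A then f j else 0) = (\<Sum>j\<in>A. f j)"
    by (rule sum.mono_neutral_cong_right) (use A in auto)
  then have "c *\<^sub>C x + y = (\<Sum>j\<in>insert k A. g j)"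
    using A by (simp add: g_def sum.distrib del: sum.insert)
  moreover have "charge (g j) = of_int j *\<^sub>C g j" for j
    using k f by (auto simp: g_def charge_simps scaleC_add_right scaleC_scaleC mult.commute)
  ultimately show ?case
    using A k by (intro exI[of _ "insert k A"] exI[of _ g]) auto
qed

lemma weil_part_disjoint: "weil_part False \<inter> weil_part True \<subseteq> {0 :: 'g::fd_complex_lie_algebra
    weil}"
proof
  fix w :: "'g weil" assume "w \<in> weil_part False \<inter> weil_part True"
  then have w: "w \<in> charge_part False" "w \<in> charge_part True" using weil_part_charge_part by blast+
  obtain A f where A: "finite A" "\<forall>k\<in>A. even k" "w = (\<Sum>k\<in>A. f k)" "\<And>k. charge (f k) = of_int k
      *\<^sub>C f k"
    using charge_part_decomposition[OF w(1)] by auto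
  obtain B g where B: "finite B" "\<forall>k\<in>B. odd k" "w = (\<Sum>k\<in>B. g k)" "\<And>k. charge (g k) = of_int k
      *\<^sub>C g k"
    using charge_part_decomposition[OF w(2)] by auto
  \<comment> \<open>The even and odd expansions of the same vector are joined into one vanishing sum
    of eigenvectors with distinct eigenvalues.\<close>
  define h where "h k = (if even k then f k else - g k)" for k
  have disj: "A \<inter> B = {}" using A(2) B(2) by blast
  have "(\<Sum>k\<in>A \<union> B. h k) = (\<Sum>k\<in>A. h k) + (\<Sum>k\<in>B. h k)"
    by (rule sum.union_disjoint) (use A B disj in auto)
  also have "(\<Sum>k\<in>A. h k) = w" using A by (simp add: h_def)
  also have "(\<Sum>k\<in>B. h k) = - w" using B by (simp add: h_def sum_negf)
  finally have "(\<Sum>k\<in>A \<union> B. h k) = 0" by simp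
  then have "h k = 0" if "k \<in> A \<union> B" for k
    using that A B
    by (intro eigenvectors_independent[OF clinear_charge, of "A \<union> B" of_int h k])
      (auto simp: h_def charge_simps inj_on_def)
  then have "f k = 0" if "k \<in> A" for k using that A(2) unfolding h_def by force
  then show "w \<in> {0}" using A(3) by simp
qed

section \<open>Cohomology classes\<close>

abbreviation cls :: "'g::fd_complex_lie_algebra weil \<Rightarrow> 'g semi_inf_cohomology" where
  "cls \<equiv> abs_semi_inf_cohomology"

lemmas d_simps = clinear_simps[OF clinear_semi_inf_d]

lemma cohomologous_self: "cohomologous x x \<longleftrightarrow> semi_inf_d x = 0"
  by (simp add: cohomologous_def range_d_simps(1))

lemma cls_eq_iff:
  assumes "semi_inf_d x = 0" "semi_inf_d y = 0"
  shows "cls x = cls y \<longleftrightarrow> x - y \<in> range semi_inf_d"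
  using Quotient3_rel[OF Quotient3_semi_inf_cohomology, of x y] assms
  by (simp add: cohomologous_self) (simp add: cohomologous_def assms)

lemma cls_cases:
  obtains z where "semi_inf_d z = 0" "h = cls z"
  using Quotient3_abs_rep[OF Quotient3_semi_inf_cohomology, of h]
    Quotient3_rep_reflp[OF Quotient3_semi_inf_cohomology, of h]
  by (metis cohomologous_self)

lemma rep_cls:
  assumes "semi_inf_d z = 0"
  shows "semi_inf_d (rep_semi_inf_cohomology (cls z)) = 0"
    "rep_semi_inf_cohomology (cls z) - z \<in> range semi_inf_d"
proof -
  show d: "semi_inf_d (rep_semi_inf_cohomology (cls z)) = 0"
    using Quotient3_rep_reflp[OF Quotient3_semi_inf_cohomology, of "cls z"]
    by (simp add: cohomologous_self)
  show "rep_semi_inf_cohomology (cls z) - z \<in> range semi_inf_d"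
    using cls_eq_iff[OF d assms] Quotient3_abs_rep[OF Quotient3_semi_inf_cohomology, of "cls z"]
        by simp
qed

lemma cls_add: "semi_inf_d x = 0 \<Longrightarrow> semi_inf_d y = 0 \<Longrightarrow> cls (x + y) = cls x + cls y"
  and cls_scale: "semi_inf_d x = 0 \<Longrightarrow> cls (c *\<^sub>C x) = c *\<^sub>C cls x"
  and cls_0: "cls 0 = 0"
  by (simp_all add: plus_semi_inf_cohomology.abs_eq scaleC_semi_inf_cohomology.abs_eq
      cohomologous_self
      zero_semi_inf_cohomology_def)

lemma cls_diff: "semi_inf_d x = 0 \<Longrightarrow> semi_inf_d y = 0 \<Longrightarrow> cls (x - y) = cls x - cls y"
  using cls_add[of "x - y" y] by (simp add: d_simps)

lemma cls_sum: "(\<And>i. i \<in> A \<Longrightarrow> semi_inf_d (f i) = 0) \<Longrightarrow> cls (\<Sum>i\<in>A. f i) = (\<Sum>i\<in>A. cls (f i))"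
  by (induction A rule: infinite_finite_induct) (simp_all add: cls_0 cls_add d_simps)

definition cls_op :: "('g::fd_complex_lie_algebra weil \<Rightarrow> 'g weil) \<Rightarrow> 'g semi_inf_cohomology \<Rightarrow> 'g
    semi_inf_cohomology" where
  "cls_op A h = cls (A (rep_semi_inf_cohomology h))"

text \<open>\<open>cls_op\<close> uses a chosen representative. Another choice differs by some d y,
  and A (d y) = d (c^(-1) A y) is again a boundary.\<close>

lemma cls_op_cls:
  assumes "clinear A" "\<And>w. semi_inf_d (A w) = c *\<^sub>C A (semi_inf_d w)" "c \<noteq> 0" "semi_inf_d z = 0"
  shows "cls_op A (cls z) = cls (A z)" "semi_inf_d (A z) = 0"
proof -
  let ?r = "rep_semi_inf_cohomology (cls z)"
  show 0: "semi_inf_d (A z) = 0" by (simp add: assms clinear_0[OF assms(1)])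
  obtain y where "?r - z = semi_inf_d y" using rep_cls(2)[OF assms(4)] by blast
  then have "A ?r - A z = A (semi_inf_d y)" by (simp flip: clinear_diff[OF assms(1)])
  also have "\<dots> = semi_inf_d (inverse c *\<^sub>C A y)" using assms(3)
      by (simp add: d_simps assms(2) scaleC_scaleC)
  finally have "A ?r - A z \<in> range semi_inf_d" by blast
  moreover have "semi_inf_d (A ?r) = 0" by (simp add: assms rep_cls clinear_0[OF assms(1)])
  ultimately show "cls_op A (cls z) = cls (A z)" unfolding cls_op_def
      by (subst cls_eq_iff) (simp_all add: 0)
qed

lemma subspace_cohomology_part: "cvec.subspace (cohomology_part p)"
proof (rule cvec.subspaceI)
  show "0 \<in> cohomology_part p"
    unfolding cohomology_part_def
    by (rule image_eqI[of _ _ 0]) (simp_all add: cls_0 d_simps cvec.subspace_0[OF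
        subspace_weil_part])
next
  fix x y :: "'a semi_inf_cohomology" assume "x \<in> cohomology_part p" "y \<in> cohomology_part p"
  then obtain v w where "v \<in> weil_part p" "w \<in> weil_part p" "semi_inf_d v = 0" "semi_inf_d w = 0"
    "x = cls v" "y = cls w" unfolding cohomology_part_def by blast
  then show "x + y \<in> cohomology_part p"
    unfolding cohomology_part_def
    by (intro image_eqI[of _ _ "v + w"]) (simp_all add: cls_add d_simps cvec.subspace_add[OF
        subspace_weil_part])
next
  fix c and x :: "'a semi_inf_cohomology" assume "x \<in> cohomology_part p"
  then obtain v where "v \<in> weil_part p" "semi_inf_d v = 0" "x
      = cls v" unfolding cohomology_part_def by blast
  then show "c *\<^sub>C x \<in> cohomology_part p"
    unfolding cohomology_part_def
    by (intro image_eqI[of _ _ "c *\<^sub>C v"]) (simp_all add: cls_scale d_simps cvec.subspace_scale[OF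
        subspace_weil_part])
qed

lemma weil_part_unique:
  fixes w0 w1 :: "'g::fd_complex_lie_algebra weil"
  assumes "w0 \<in> weil_part False" "w1 \<in> weil_part True" "w0 + w1 = 0"
  shows "w0 = 0" "w1 = 0"
proof -
  have "w0 = - w1" unfolding eq_neg_iff_add_eq_0 by (rule assms(3))
  moreover have "- w1 \<in> weil_part True" by (rule cvec.subspace_neg[OF subspace_weil_part assms(2)])
  ultimately have "w0 \<in> weil_part False \<inter> weil_part True" using assms(1) by (metis IntI)
  then have "w0 \<in> {0}" by (rule subsetD[OF weil_part_disjoint])
  then show "w0 = 0" by (rule singletonD)
  with assms(3) show "w1 = 0" by (metis add_0)
qed

text \<open>The differential reverses parity, so the two homogeneous components of a cycle have
  boundaries in different parts and are cycles separately.\<close>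

lemma cohomology_part_decomposition: "\<exists>h0\<in>cohomology_part False. \<exists>h1\<in>cohomology_part True. h = h0
    + h1"
proof -
  obtain z where z: "semi_inf_d z = 0" "h = cls z" by (rule cls_cases)
  obtain w0 w1 where w: "w0 \<in> weil_part False" "w1 \<in> weil_part True" "z = w0 + w1"
    using weil_part_decomposition[of z] by blast
  have "semi_inf_d w1 \<in> weil_part False" "semi_inf_d w0 \<in> weil_part True"
    using d_weil_part[OF w(1)] d_weil_part[OF w(2)] by simp_all
  moreover have "semi_inf_d w1 + semi_inf_d w0 = 0" using z(1) w(3)
      by (simp add: d_simps add.commute)
  ultimately have d: "semi_inf_d w1 = 0" "semi_inf_d w0 = 0" by (rule weil_part_unique)+
  then have "h = cls w0 + cls w1" by (simp add: z(2) w(3) cls_add)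
  moreover have "cls w0 \<in> cohomology_part False" "cls w1 \<in> cohomology_part True"
    using d w unfolding cohomology_part_def by blast+
  ultimately show ?thesis by blast
qed

text \<open>If an even v and an odd w represent the same class, then v - w = d y; comparing even
  components gives v = d y1 with y1 the odd component of y.\<close>

lemma cohomology_part_disjoint:
  "cohomology_part False \<inter> cohomology_part True \<subseteq> {0 :: 'g::fd_complex_lie_algebra
      semi_inf_cohomology}"
proof
  fix h :: "'g semi_inf_cohomology" assume "h \<in> cohomology_part False \<inter> cohomology_part True"
  then obtain v w where v: "v \<in> weil_part False" "semi_inf_d v = 0" "h = cls v"
    and w: "w \<in> weil_part True" "semi_inf_d w = 0" "h = cls w" unfolding cohomology_part_def
        by blast
  obtain y where y: "v - w = semi_inf_d y" using cls_eq_iff[OF v(2) w(2)] v(3) w(3) by auto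
  obtain y0 y1 where y01: "y0 \<in> weil_part False" "y1 \<in> weil_part True" "y = y0 + y1"
    using weil_part_decomposition[of y] by blast
  have "v - semi_inf_d y1 \<in> weil_part False" "- w - semi_inf_d y0 \<in> weil_part True"
    using v w d_weil_part[OF y01(1)] d_weil_part[OF y01(2)]
    by (auto intro!: cvec.subspace_diff cvec.subspace_neg subspace_weil_part)
  moreover have "(v - semi_inf_d y1) + (- w - semi_inf_d y0) = 0"
    using y by (simp add: y01(3) d_simps algebra_simps)
  ultimately have "v - semi_inf_d y1 = 0" by (rule weil_part_unique)
  then have "v \<in> range semi_inf_d" by auto
  then have "cls v = cls 0" using cls_eq_iff[OF v(2), of 0] by (simp add: d_simps)
  then show "h \<in> {0}" by (simp add: v(3) cls_0)
qed

section \<open>Classes in the non-unimodular case\<close>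

definition trace_form :: "'g::fd_complex_lie_algebra dual" where
  "trace_form = Abs_dual trace_ad"

lemma trace_form_apply: "dual_apply trace_form (x :: 'g::fd_complex_lie_algebra) = trace_ad x"
proof -
  have "clinear (trace_ad :: 'g \<Rightarrow> complex)"
    by (simp add: clinear_iff trace_ad_def lie_bracket_add_left lie_bracket_scale_left
        dual_apply_simps sum.distrib scaleC_complex_def sum_distrib_left)
  then show ?thesis by (simp add: trace_form_def Abs_dual_inverse)
qed

text \<open>By the Jacobi identity ad [x, y] is the commutator of ad x and ad y, and the trace of a
  commutator is 0.\<close>

lemma trace_ad_bracket: "trace_ad (lie_bracket x y) = 0"
proof -
  have jac: "lie_bracket (lie_bracket x y) v = lie_bracket x (lie_bracket y v)
      - lie_bracket y (lie_bracket x v)" for v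
  proof -
    have "lie_bracket x (lie_bracket y v) + lie_bracket y (lie_bracket v x)
        + lie_bracket v (lie_bracket x y) = 0"
      by (rule lie_jacobi)
    then show ?thesis
      by (simp add: lie_bracket_swap[of v] clinear_simps[OF clinear_lie_bracket(1)] algebra_simps)
  qed
  have tr: "(\<Sum>v\<in>lie_basis. dual_apply (dual_basis v) (lie_bracket a (lie_bracket b v)))
    = (\<Sum>v\<in>lie_basis. \<Sum>u\<in>lie_basis. dual_apply (dual_basis u) (lie_bracket b v)
        * dual_apply (dual_basis v) (lie_bracket a u))" for a b
  proof (rule sum.cong, rule refl)
    fix v
    have "lie_bracket a (lie_bracket b v) = lie_bracket a (\<Sum>u\<in>lie_basis. dual_apply (dual_basis u)
        (lie_bracket b v) *\<^sub>C u)"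
      by (simp add: basis_expansion)
    then show "dual_apply (dual_basis v) (lie_bracket a (lie_bracket b v))
      = (\<Sum>u\<in>lie_basis. dual_apply (dual_basis u) (lie_bracket b v) * dual_apply (dual_basis v)
          (lie_bracket a u))"
      by (simp add: clinear_simps[OF clinear_lie_bracket(1)] dual_apply_simps scaleC_complex_def)
  qed
  have "(\<Sum>v\<in>lie_basis. dual_apply (dual_basis v) (lie_bracket x (lie_bracket y v)))
    = (\<Sum>v\<in>lie_basis. dual_apply (dual_basis v) (lie_bracket y (lie_bracket x v)))"
    unfolding tr by (subst sum.swap) (simp add: mult.commute)
  then show ?thesis
    by (simp add: trace_ad_def jac dual_apply_simps sum_subtractf)
qed

lemma coad_trace_form: "coad trace_form x = 0"
  by (simp add: dual_apply_inject[symmetric] fun_eq_iff coad_apply trace_form_apply trace_ad_bracket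
      zero_dual_apply)

lemma double_comm_fst:
  "double_comm T r g s h w = (T (g (h w)) - sg True r *\<^sub>C g (T (h w)))
    - sg (\<not> r) s *\<^sub>C h (T (g w) - sg True r *\<^sub>C g (T w))"
  if "clinear h"
  by (simp add: double_comm_def clinear_simps[OF that] cvec.scale_right_diff_distrib scaleC_scaleC)

context vev
begin

section \<open>Cycles and dual cocycles\<close>

text \<open>Since \<open>coad trace_form x = 0\<close>, all double commutators of d with this
  generator vanish; so its supercommutator with d supercommutes with all generators, and its
  expectation value is 0.\<close>

lemma d_chi_trace_form:
  fixes w :: "'g weil"
  shows "semi_inf_d (chi r trace_form n w) = sg True r *\<^sub>C chi r trace_form n (semi_inf_d w)"
proof -
  define X where "X w = semi_inf_d (chi r trace_form n w) - sg True r
      *\<^sub>C chi r trace_form n (semi_inf_d w)" for w :: "'g weil"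
  have "X w = 0"
  proof (rule supercommuting_zero[where p = "\<not> r" and X = X])
    show "clinear X"
      by (simp add: clinear_iff X_def d_simps chi_simps cvec.scale_right_diff_distrib scaleC_scaleC
          scaleC_add_right mult.commute)
    show "X (psi s x k w) = sg (\<not> r) s *\<^sub>C psi s x k (X w)" for s x k and w :: "'g weil"
      using d_chi_psi[of r trace_form n s x k w]
      unfolding double_comm_fst[OF clinear_psi] X_def coad_trace_form
      by (simp add: chi_arg_simps split: if_splits)
    show "X (chi s f k w) = sg (\<not> r) s *\<^sub>C chi s f k (X w)" for s f k and w :: "'g weil"
      using d_chi_chi[of r trace_form n s f k w]
      unfolding double_comm_fst[OF clinear_chi] X_def by simp
    show "\<phi> (X vacuum) = 0" by (simp add: X_def phi_simps phi_d d_vacuum chi_simps)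
  qed
  then show ?thesis by (simp add: X_def)
qed

definition cycle :: "'g \<Rightarrow> bool \<Rightarrow> nat \<Rightarrow> 'g weil" where
  "cycle e p k = (if p then psi True e 0 else id) ((psi False e 0 ^^ k) vacuum)"

text \<open>The supercommutator of d with \<open>psi r e 0\<close> kills the vacuum and passes
  through the powers of \<beta>(e), because [e, e] = 0.\<close>

lemma d_psi_power:
  fixes e :: 'g
  shows "semi_inf_d (psi r e 0 ((psi False e 0 ^^ k) vacuum))
    - sg True r *\<^sub>C psi r e 0 (semi_inf_d ((psi False e 0 ^^ k) vacuum)) = 0"
proof -
  define P where "P w = semi_inf_d (psi r e 0 w) - sg True r *\<^sub>C psi r e 0 (semi_inf_d w)"
      for w :: "'g weil"
  have P_psi: "P (psi s y l w) = sg (\<not> r) s *\<^sub>C psi s y l (P w)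
      + (if r then psi s (lie_bracket e y) l w else if s then psi r (lie_bracket y e) l w else 0)"
          for s y l w
    using d_psi_psi[of r e 0 s y l w] unfolding double_comm_fst[OF clinear_psi] P_def
    by (simp add: algebra_simps)
  have P_chi: "P (chi s f l w) = sg (\<not> r) s *\<^sub>C chi s f l (P w)
      + (if r then - chi s (coad f e) l w else if \<not> s then chi True (coad f e) l w else 0)"
          for s f l w
    using d_psi_chi[of r e 0 s f l w] unfolding double_comm_fst[OF clinear_chi] P_def
    by (simp add: algebra_simps)
  have P0: "P 0 = 0" by (simp add: P_def d_simps psi_simps)
  \<comment> \<open>Commuting P with an annihilation operator gives at most another generator of the
    same degree, again an annihilation operator; so P applied to the vacuum is a multiple of the
    vacuum.\<close>
  have "P vacuum = \<phi> (P vacuum) *\<^sub>C vacuum"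
  proof (rule vacuum_unique)
    show "psi s y l (P vacuum) = 0" if "l > 0" for s y l
      using P_psi[of s y l vacuum] that by (auto simp: psi_vacuum P0 sg_def split: if_splits)
    show "chi s f l (P vacuum) = 0" if "l \<le> 0" for s f l
      using P_chi[of s f l vacuum] that by (auto simp: chi_vacuum P0 sg_def split: if_splits)
  qed
  moreover have "\<phi> (P vacuum) = 0" by (simp add: P_def phi_simps phi_d d_vacuum psi_simps)
  ultimately have "P vacuum = 0" by simp
  then have "P ((psi False e 0 ^^ k) vacuum) = 0"
    by (induction k) (simp_all add: P_psi lie_bracket_self psi_simps psi_arg_simps)
  then show ?thesis by (simp add: P_def)
qed

lemma d_cycle: "semi_inf_d (cycle e p k) = 0"
proof -
  have 0: "semi_inf_d ((psi False e 0 ^^ k) vacuum) = 0" for k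
  proof (induction k)
    case (Suc k)
    then show ?case using d_psi_power[of False e k] by (simp add: psi_simps)
  qed (simp add: d_vacuum)
  show ?thesis using 0[of k] d_psi_power[of True e k] by (simp add: cycle_def psi_simps)
qed

lemma cycle_weil_part: "cycle e p k \<in> weil_part p"
proof -
  have "(psi False e 0 ^^ k) vacuum \<in> weil_part False"
  proof (induction k)
    case (Suc k)
    then show ?case using psi_weil_part[OF Suc, of False] by simp
  qed (simp add: vacuum_weil_part)
  then show ?thesis
    using psi_weil_part[of "(psi False e 0 ^^ k) vacuum" False True e 0] by (simp add: cycle_def)
qed

text \<open>These functionals descend to cohomology: the inserted operators supercommute with d, and
  the left vacuum kills its range.\<close>

definition cocycle :: "bool \<Rightarrow> nat \<Rightarrow> 'g weil \<Rightarrow> complex" where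
  "cocycle p j w = \<phi> ((chi False trace_form 0 ^^ j) ((if p then chi True trace_form 0 else id) w))"

lemma clinear_cocycle: "clinear (cocycle p j)"
proof -
  have "clinear (chi False trace_form 0 ^^ j :: 'g weil \<Rightarrow> _)"
    by (induction j) (simp_all add: clinear_iff chi_simps)
  then show ?thesis
    by (simp add: cocycle_def clinear_iff phi_simps chi_simps)
qed

lemma cocycle_d:
  fixes w :: "'g weil"
  shows "cocycle p j (semi_inf_d w) = 0"
proof -
  have F: "(chi False trace_form 0 ^^ j) (semi_inf_d w)
      = semi_inf_d ((chi False trace_form 0 ^^ j) w)" for w :: "'g weil"
    by (induction j) (simp_all add: d_chi_trace_form)
  have T: "chi True trace_form 0 (semi_inf_d w) = semi_inf_d (- chi True trace_form 0 w)"
    by (simp add: d_simps d_chi_trace_form)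
  show ?thesis by (cases p) (simp_all add: cocycle_def T F phi_d)
qed

lemma cocycle_cycle:
  assumes "trace_ad e = 1"
  shows "cocycle p j (cycle e p k) = (if j = k then fact k else 0)"
proof -
  let ?y = "\<lambda>k. (psi False e 0 ^^ k) vacuum"
  \<comment> \<open>The operator \<gamma>(\<open>trace_form\<close>) acts on polynomials in
    \<beta>(e) as the derivative, which is where \<open>fact k\<close> comes from.\<close>
  have F: "chi False trace_form 0 (?y k) = of_nat k *\<^sub>C ?y (k - 1)" for k
  proof (induction k)
    case (Suc k)
    have "chi False trace_form 0 (?y (Suc k)) = psi False e 0 (of_nat k *\<^sub>C ?y (k - 1)) + ?y k"
      by (simp add: chi_psi Suc trace_form_apply assms)
    also have "psi False e 0 (of_nat k *\<^sub>C ?y (k - 1)) = of_nat k *\<^sub>C ?y k"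
      by (cases k) (simp_all add: psi_simps)
    finally show ?case by (simp add: scaleC_add_left add.commute)
  qed (simp add: chi_vacuum)
  have main: "\<phi> ((chi False trace_form 0 ^^ j) (?y k)) = (if j = k then fact k else 0)" for j k
  proof (induction j arbitrary: k)
    case 0
    then show ?case by (cases k) (simp_all add: phi_psi)
  next
    case (Suc j)
    have lin: "clinear (chi False trace_form 0 ^^ j :: 'g weil \<Rightarrow> _)"
      by (induction j) (simp_all add: clinear_iff chi_simps)
    show ?case
      unfolding funpow_Suc_right o_def F clinear_simps[OF lin] phi_simps Suc.IH
      by (cases k) (auto simp: scaleC_complex_def)
  qed
  have T: "chi True trace_form 0 (psi True e 0 (?y k)) = ?y k" for k
  proof -
    have "chi True trace_form 0 (?y k) = 0"
      by (induction k) (simp_all add: chi_vacuum chi_psi psi_simps)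
    then show ?thesis by (simp add: chi_psi trace_form_apply assms psi_simps)
  qed
  show ?thesis by (cases p) (simp_all add: cocycle_def cycle_def T main)
qed

end

section \<open>Countable dimension\<close>

text \<open>Words in the generators attached to basis elements suffice. This alphabet is countable,
  since the basis is finite and the degrees are integers.\<close>

lemma weil_countable_spanning: "\<exists>S :: 'g::fd_complex_lie_algebra weil set. countable S
    \<and> cvec.span S = UNIV"
proof -
  define f :: "bool \<times> bool \<times> 'g \<times> int \<Rightarrow> 'g weil \<Rightarrow> 'g weil"
    where "f = (\<lambda>(t, s, v, n). if t then psi s v n else chi s (dual_basis v) n)"
  define S where "S = (\<lambda>xs. foldr f xs vacuum) ` lists (UNIV \<times> UNIV \<times> lie_basis \<times> UNIV)"
  have step: "f x v \<in> S" if "v \<in> S" "fst (snd (snd x)) \<in> lie_basis" for x v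
  proof -
    obtain xs where "xs \<in> lists (UNIV \<times> UNIV \<times> lie_basis \<times> UNIV)" "v = foldr f xs vacuum"
      using \<open>v \<in> S\<close> unfolding S_def by blast
    then show ?thesis using that(2) unfolding S_def by (intro image_eqI[of _ _
        "x # xs"]) (auto simp: mem_Times_iff)
  qed
  have "w \<in> cvec.span S" for w
  proof (induction w rule: weil_induct)
    case (vacuum c)
    have "vacuum \<in> S" unfolding S_def by (rule image_eqI[of _ _ "[]"]) auto
    then show ?case by (intro cvec.span_scale cvec.span_base)
  next
    case (psi s x n w)
    have "psi s v n w \<in> cvec.span S" if "v \<in> lie_basis" for v
      by (rule clinear_span_closed[OF clinear_psi _ psi])
        (use step[of _ "(True, s, v, n)"] that in \<open>auto simp: f_def intro: cvec.span_base\<close>)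
    then have "(\<Sum>v\<in>lie_basis. dual_apply (dual_basis v) x *\<^sub>C psi s v n w) \<in> cvec.span S"
      by (intro cvec.span_sum cvec.span_scale) auto
    then show ?case by (simp add: psi_expansion)
  next
    case (chi s g n w)
    have "chi s (dual_basis v) n w \<in> cvec.span S" if "v \<in> lie_basis" for v
      by (rule clinear_span_closed[OF clinear_chi _ chi])
        (use step[of _ "(False, s, v, n)"] that in \<open>auto simp: f_def intro: cvec.span_base\<close>)
    then have "(\<Sum>v\<in>lie_basis. dual_apply g v *\<^sub>C chi s (dual_basis v) n w) \<in> cvec.span S"
      by (intro cvec.span_sum cvec.span_scale) auto
    then show ?case by (simp add: chi_expansion)
  qed (rule cvec.span_add)
  moreover have "countable S"
    unfolding S_def
    by (intro countable_image countable_lists countable_SIGMA countable_finite[OF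
        finite_lie_basis]) auto
  ultimately show ?thesis by blast
qed

text \<open>The cycles lie in a space of countable dimension and so have a countable basis, whose
  classes span the cohomology.\<close>

lemma cohomology_countable_spanning:
  "\<exists>S :: 'g::fd_complex_lie_algebra semi_inf_cohomology set. countable S \<and> cvec.span S = UNIV"
proof -
  obtain S :: "'g weil set" where S: "countable S" "cvec.span S = UNIV"
      using weil_countable_spanning by blast
  obtain K :: "'g weil set" where K: "K \<subseteq> {z. semi_inf_d z = 0}" "cvec.independent K"
      "{z. semi_inf_d z = 0} \<subseteq> cvec.span K"
    using cvec.maximal_independent_subset[of "{z. semi_inf_d z = 0}"] by metis
  have "countable K" by (rule countable_independent[OF S(1) _ K(2)]) (simp add: S(2))
  moreover have "h \<in> cvec.span (cls ` K)" for h :: "'g semi_inf_cohomology"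
  proof -
    obtain z where z: "semi_inf_d z = 0" "h = cls z" by (rule cls_cases)
    from z(1) K(3) have "z \<in> cvec.span K" by blast
    then have "cls z \<in> cvec.span (cls ` K) \<and> semi_inf_d z = 0"
    proof (induction rule: cvec.span_induct_alt)
      case base
      show ?case by (simp add: cls_0 d_simps cvec.span_zero)
    next
      case (step c x y)
      then have "semi_inf_d x = 0" using K(1) by blast
      with step show ?case
        by (auto simp: cls_add cls_scale d_simps intro!: cvec.span_add cvec.span_scale intro:
            cvec.span_base)
    qed
    then show ?thesis by (simp add: z(2))
  qed
  ultimately show ?thesis by (intro exI[of _ "cls ` K"]) auto
qed

section \<open>The representation on cohomology\<close>

lemma card_lie_basis: "cvec.dim (UNIV :: 'g set) = card (lie_basis :: 'g::fd_complex_lie_algebra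
    set)"
proof -
  interpret fd: finite_dimensional_vector_space scaleC "lie_basis :: 'g set"
    by (rule finite_dimensional_lie_basis)
  show ?thesis
    by (rule cvec.dim_eq_card) (simp_all add: fd.span_Basis fd.independent_Basis)
qed

lemma representation_unimodular:
  assumes "\<And>z::'g::fd_complex_lie_algebra. trace_ad z = 0"
  shows "\<exists>\<rho> :: n2_algebra \<Rightarrow> 'g semi_inf_cohomology \<Rightarrow> 'g semi_inf_cohomology.
    n2_representation cohomology_part \<rho> \<and> has_central_charge \<rho> (3 * of_nat (card (lie_basis :: 'g
        set)))"
proof -
  define R :: "n2_basis \<Rightarrow> 'g semi_inf_cohomology \<Rightarrow> 'g semi_inf_cohomology"
      where "R b = cls_op (n2_op b)" for b
  have sg: "sg p q \<noteq> 0" for p q by (simp add: sg_def)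
  have R: "R b (cls z) = cls (n2_op b z)" and d: "semi_inf_d (n2_op b z) = 0"
      if "semi_inf_d z = 0" for b and z :: "'g weil"
    using cls_op_cls[OF clinear_n2_op d_n2_op[OF assms] sg that] by (simp_all add: R_def)
  have lin: "clinear (R b)" for b
    unfolding clinear_iff
  proof (intro conjI allI)
    fix x y :: "'g semi_inf_cohomology" and c
    obtain v w where "semi_inf_d v = 0" "x = cls v" "semi_inf_d w = 0" "y = cls w"
        by (metis cls_cases)
    then show "R b (x + y) = R b x + R b y" "R b (c *\<^sub>C x) = c *\<^sub>C R b x"
      by (simp_all add: R d d_simps clinear_simps[OF clinear_n2_op] flip: cls_add cls_scale)
  qed
  have "n2_representation cohomology_part (\<lambda>x m. lin_ext (\<lambda>b. R b m) x)"
  proof (rule n2_representationI[OF lin subspace_cohomology_part])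
    fix b q and m :: "'g semi_inf_cohomology" assume "m \<in> cohomology_part q"
    then obtain z where z: "z \<in> weil_part q" "semi_inf_d z = 0" "m = cls z"
      unfolding cohomology_part_def by blast
    show "R b m \<in> cohomology_part (n2_basis_odd b \<noteq> q)"
      unfolding cohomology_part_def z(3) R[OF z(2)]
      by (intro imageI CollectI conjI n2_op_weil_part z(1) d[OF z(2)])
  next
    fix a b and m :: "'g semi_inf_cohomology"
    obtain z where z: "semi_inf_d z = 0" "m = cls z" by (rule cls_cases)
    have "lin_ext (\<lambda>c. R c m) (n2_basis_bracket a b)
        = cls (lin_ext (\<lambda>c. n2_op c z) (n2_basis_bracket a b))"
      using z by (simp add: lin_ext_def R d d_simps cls_sum cls_scale)
    also have "\<dots> = R a (R b m) - sg (n2_basis_odd a) (n2_basis_odd b) *\<^sub>C R b (R a m)"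
      unfolding n2_op_bracket using z by (simp add: R d d_simps cls_diff cls_scale)
    finally show "lin_ext (\<lambda>c. R c m) (n2_basis_bracket a b)
      = R a (R b m) - sg (n2_basis_odd a) (n2_basis_odd b) *\<^sub>C R b (R a m)" .
  qed
  moreover have "has_central_charge (\<lambda>x m. lin_ext (\<lambda>b. R b m) x) (3 * of_nat (card (lie_basis ::
      'g set)))"
    unfolding has_central_charge_def
  proof
    fix m :: "'g semi_inf_cohomology"
    obtain z where z: "semi_inf_d z = 0" "m = cls z" by (rule cls_cases)
    then show "lin_ext (\<lambda>b. R b m) (n2_term C_basis 1) = (3 * of_nat (card (lie_basis :: 'g set)))
        *\<^sub>C m"
      by (simp add: lin_ext_single R cls_scale)
  qed
  ultimately show ?thesis by blast
qed

lemma representation_transport: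
  fixes F :: "'m::complex_vector \<Rightarrow> 'g::fd_complex_lie_algebra weil"
  assumes "clinear F" "clinear G" "\<And>v. G (F v) = v" "\<And>w. F (G w) = w"
    and "\<And>p v. v \<in> part p \<Longrightarrow> F v \<in> weil_part p" "\<And>p w. w \<in> weil_part p \<Longrightarrow> G w \<in> part p"
    and "\<And>p. cvec.subspace (part p)"
  shows "\<exists>\<rho>. n2_representation part \<rho> \<and> has_central_charge \<rho> (3 * of_nat (card (lie_basis :: 'g
      set)))"
proof -
  define R where "R b m = G (n2_op b (F m))" for b m
  have "n2_representation part (\<lambda>x m. lin_ext (\<lambda>b. R b m) x)"
  proof (rule n2_representationI[OF _ assms(7)])
    show "clinear (R b)" for b
      by (simp add: clinear_iff R_def clinear_simps[OF assms(1)] clinear_simps[OF assms(2)]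
          clinear_simps[OF clinear_n2_op])
    show "R b m \<in> part (n2_basis_odd b \<noteq> q)" if "m \<in> part q" for b q m
      unfolding R_def by (intro assms(6) n2_op_weil_part assms(5) that)
    show "lin_ext (\<lambda>c. R c m) (n2_basis_bracket a b)
      = R a (R b m) - sg (n2_basis_odd a) (n2_basis_odd b) *\<^sub>C R b (R a m)" for a b m
      unfolding R_def assms(4) clinear_lin_ext_comp[OF assms(2), symmetric] n2_op_bracket
      by (simp add: clinear_simps[OF assms(2)])
  qed
  moreover have "has_central_charge (\<lambda>x m. lin_ext (\<lambda>b. R b m) x) (3 * of_nat (card (lie_basis ::
      'g set)))"
    by (simp add: has_central_charge_def lin_ext_single R_def clinear_simps[OF assms(2)] assms(3))
  ultimately show ?thesis by blast
qed

lemma (in vev) representation_not_unimodular: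
  assumes "trace_ad (z::'g) \<noteq> 0"
  shows "\<exists>\<rho> :: n2_algebra \<Rightarrow> 'g semi_inf_cohomology \<Rightarrow> 'g semi_inf_cohomology.
    n2_representation cohomology_part \<rho> \<and> has_central_charge \<rho> (3 * of_nat (card (lie_basis :: 'g
        set)))"
proof -
  define e where "e = inverse (trace_ad z) *\<^sub>C z"
  have e: "trace_ad e = 1"
    using assms dual_apply_simps(3)[of trace_form "inverse (trace_ad z)" z]
    by (simp add: trace_form_apply e_def scaleC_complex_def)
  define f where "f p j h = cocycle p j (rep_semi_inf_cohomology h)" for p j h
  have f: "f p j (cls w) = cocycle p j w" if w: "semi_inf_d w = 0" for p j w
  proof -
    obtain y where "rep_semi_inf_cohomology (cls w) - w = semi_inf_d y" using rep_cls(2)[OF w]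
        by blast
    then have "cocycle p j (rep_semi_inf_cohomology (cls w)) - cocycle p j w = 0"
      by (simp add: cocycle_d flip: clinear_diff[OF clinear_cocycle])
    then show ?thesis by (simp add: f_def)
  qed
  have f_lin: "clinear (f p j)" for p j
    unfolding clinear_iff
  proof (intro conjI allI)
    fix x y :: "'g semi_inf_cohomology" and c
    obtain v w where "semi_inf_d v = 0" "x = cls v" "semi_inf_d w = 0" "y = cls w"
        by (metis cls_cases)
    then show "f p j (x + y) = f p j x + f p j y" "f p j (c *\<^sub>C x) = c *\<^sub>C f p j x"
      by (simp_all add: f d_simps clinear_simps[OF clinear_cocycle] flip: cls_add cls_scale)
  qed
  obtain S :: "'g weil set" where S: "countable S" "cvec.span S = UNIV"
      using weil_countable_spanning by blast
  obtain S' :: "'g semi_inf_cohomology set" where S': "countable S'" "cvec.span S' = UNIV"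
    using cohomology_countable_spanning by blast
  \<comment> \<open>The same cycles and functionals prove infinite dimension twice: here in the
    complex, and below, through their classes, in cohomology.\<close>
  have "\<exists>b :: nat \<Rightarrow> 'g weil. inj b \<and> cvec.independent (range b) \<and> cvec.span (range b)
      = weil_part p" for p
    by (rule countable_basis_exists[OF S(1) _ subspace_weil_part, where y = "cycle e p" and f =
        "cocycle p" and c = fact])
      (simp_all add: S(2) cycle_weil_part clinear_cocycle cocycle_cycle[OF e])
  then obtain b :: "bool \<Rightarrow> nat \<Rightarrow> 'g weil" where b: "\<And>p. inj (b p)"
      "\<And>p. cvec.independent (range (b p))"
    "\<And>p. cvec.span (range (b p)) = weil_part p" by metis
  have "\<exists>b :: nat \<Rightarrow> 'g semi_inf_cohomology. inj b \<and> cvec.independent (range b)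
      \<and> cvec.span (range b) = cohomology_part p" for p
    by (rule countable_basis_exists[OF S'(1) _ subspace_cohomology_part,
        where y = "\<lambda>k. cls (cycle e p k)" and f = "f p" and c = fact])
      (auto simp: S'(2) f_lin f d_cycle cocycle_cycle[OF e] cohomology_part_def intro:
          cycle_weil_part)
  then obtain b' :: "bool \<Rightarrow> nat \<Rightarrow> 'g semi_inf_cohomology" where b': "\<And>p. inj (b' p)"
      "\<And>p. cvec.independent (range (b' p))"
    "\<And>p. cvec.span (range (b' p)) = cohomology_part p" by metis
  obtain F where F: "clinear F" "\<And>p k. F (b' p k) = b p k"
    using graded_isomorphism[of b' b, OF b'(1,2)] b'(3) cohomology_part_disjoint by metis
  obtain G where G: "clinear G" "\<And>p k. G (b p k) = b' p k"
    using graded_isomorphism[of b b', OF b(1,2)] b(3) weil_part_disjoint by metis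
  show ?thesis
  proof (rule representation_transport[OF F(1) G(1) _ _ _ _ subspace_cohomology_part])
    show "G (F v) = v" for v
    proof -
      obtain h0 h1 where "h0 \<in> cohomology_part False" "h1 \<in> cohomology_part True" "v = h0 + h1"
        using cohomology_part_decomposition[of v] by blast
      then show ?thesis
        by (intro graded_isomorphism_inverse[where b = b' and b' = b, OF F(1) G(1) F(2) G(2)])
          (simp_all add: b'(3))
    qed
    show "F (G w) = w" for w
    proof -
      obtain w0 w1 where "w0 \<in> weil_part False" "w1 \<in> weil_part True" "w = w0 + w1"
        using weil_part_decomposition[of w] by blast
      then show ?thesis
        by (intro graded_isomorphism_inverse[where b = b and b' = b', OF G(1) F(1) G(2) F(2)])
          (simp_all add: b(3))
    qed
    show "F v \<in> weil_part p" if "v \<in> cohomology_part p" for p v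
    proof -
      have "F v \<in> cvec.span (range (b p))"
        by (rule clinear_span_closed[OF F(1), of "range (b' p)"])
          (use that in \<open>auto simp: b'(3) F(2) intro: cvec.span_base\<close>)
      then show ?thesis by (simp add: b(3))
    qed
    show "G w \<in> cohomology_part p" if "w \<in> weil_part p" for p w
    proof -
      have "G w \<in> cvec.span (range (b' p))"
        by (rule clinear_span_closed[OF G(1), of "range (b p)"])
          (use that in \<open>auto simp: b(3) G(2) intro: cvec.span_base\<close>)
      then show ?thesis by (simp add: b'(3))
    qed
  qed
qed

theorem corollary3p1:
  shows "\<exists>\<rho> :: n2_algebra \<Rightarrow> 'g::fd_complex_lie_algebra semi_inf_cohomology
             \<Rightarrow> 'g semi_inf_cohomology.
           n2_representation cohomology_part \<rho> \<and>
           has_central_charge \<rho> (3 * of_nat (cvec.dim (UNIV :: 'g set)))"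
  unfolding card_lie_basis
proof (cases "\<forall>z::'g. trace_ad z = 0")
  case True
  then show "\<exists>\<rho> :: n2_algebra \<Rightarrow> 'g semi_inf_cohomology \<Rightarrow> 'g semi_inf_cohomology.
      n2_representation cohomology_part \<rho> \<and> has_central_charge \<rho> (3 * of_nat (card (lie_basis ::
          'g set)))"
    by (intro representation_unimodular) blast
next
  case False
  then obtain z :: 'g where z: "trace_ad z \<noteq> 0" by blast
  show "\<exists>\<rho> :: n2_algebra \<Rightarrow> 'g semi_inf_cohomology \<Rightarrow> 'g semi_inf_cohomology.
      n2_representation cohomology_part \<rho> \<and> has_central_charge \<rho> (3 * of_nat (card (lie_basis ::
          'g set)))"
  proof (cases "vacuum = (0 :: 'g weil)")
    \<comment> \<open>Here the cohomology is 0, so the zero action is a representation and its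
      central charge may be any number.\<close>
    case True
    have "h = 0" for h :: "'g semi_inf_cohomology"
    proof -
      obtain w where "h = cls w" by (rule cls_cases)
      then show ?thesis using weil_trivial[OF True, of w] by (simp add: cls_0)
    qed
    then have eq: "h = h'" for h h' :: "'g semi_inf_cohomology" by metis
    have "n2_representation cohomology_part (\<lambda>_ _. 0 :: 'g semi_inf_cohomology)"
      by (simp add: n2_representation_def clinear_iff cvec.subspace_0[OF subspace_cohomology_part])
    moreover have "has_central_charge (\<lambda>_ _. 0 :: 'g semi_inf_cohomology) (3 * of_nat (card
        (lie_basis :: 'g set)))"
      unfolding has_central_charge_def using eq by blast
    ultimately show ?thesis by blast
  next
    case False
    then obtain \<phi> :: "'g weil \<Rightarrow> complex" where "is_vev \<phi>" using vev_exists by blast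
    then interpret vev \<phi> by unfold_locales
    show ?thesis using z by (rule representation_not_unimodular)
  qed
qed

end
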